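(* Let $\mathcal{G}\rightrightarrows M$ be a Lie groupoid. There is a $2$-vector space $$\Omega^k_{\mathrm{aff}}(\mathcal{G})\rightrightarrows\Omega^k_{\mathrm{mult}}(\mathcal{G}),$$ whose arrows are the affine $k$-forms and whose objects are the multiplicative $k$-forms on $\mathcal{G}$, with the following groupoid structure: the source and target maps send $\Theta\in\Omega^k_{\mathrm{aff}}(\mathcal{G})$ to $$\Theta_r:=\Theta-t^*\theta\quad\text{(source)},\qquad \Theta_l:=\Theta-s^*\theta\quad\text{(target)},\qquad \theta=\iota^*\Theta\in\Omega^k(M),$$ and the multiplication is $$\Theta*\Theta'=\Theta+s^*\theta',\qquad \theta'=\iota^*\Theta',$$ for pairs $\Theta,\Theta'\in\Omega^k_{\mathrm{aff}}(\mathcal{G})$ such that $\Theta_r=\Theta'_l$.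
   Context: A $2$-vector space is a category internal to vector spaces: a category $V_1\rightrightarrows V_0$ whose sets of objects and arrows are vector spaces and whose source, target, identity-assigning and composition maps are all linear (it is then automatically a groupoid). Here the identity-assigning map is the inclusion of multiplicative into affine $k$-forms. In $\mathcal{G}\rightrightarrows M$ (source $s$, target $t$), $\iota:M\hookrightarrow\mathcal{G}$ is the inclusion of units; $\iota^*\Theta$ is the $\wedge^kT^*M$-component of $\Theta|_M$. $\mathcal{G}^{(2)}=\{(g,h): s(g)=t(h)\}$, and $m,\mathrm{pr}_1,\mathrm{pr}_2:\mathcal{G}^{(2)}\to\mathcal{G}$ are the multiplication and the projections. $\Theta\in\Omega^k(\mathcal{G})$ is multiplicative if $m^*\Theta=\mathrm{pr}_1^*\Theta+\mathrm{pr}_2^*\Theta$, and affine if $m^*\Theta=\mathrm{pr}_1^*\Theta+\mathrm{pr}_2^*\Theta-\mathrm{pr}_1^*s^*\theta$ with $\theta:=\iota^*\Theta$. *)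

theory Defs
  imports "HOL-Analysis.Analysis" "HOL-Library.Function_Algebras"
begin

section \<open>Pointwise real vector space structure on functions\<close>

instantiation "fun" :: (type, real_vector) real_vector
begin

definition scaleR_fun :: "real \<Rightarrow> ('a \<Rightarrow> 'b) \<Rightarrow> 'a \<Rightarrow> 'b" where
  "scaleR_fun r f = (\<lambda>x. r *\<^sub>R f x)"

instance
  by standard (simp_all add: scaleR_fun_def fun_eq_iff algebra_simps)

end

definition linear_map_on :: "'a::real_vector set \<Rightarrow> ('a \<Rightarrow> 'b::real_vector) \<Rightarrow> bool" where
  "linear_map_on V f \<longleftrightarrow>
     (\<forall>x\<in>V. \<forall>y\<in>V. f (x + y) = f x + f y) \<and> (\<forall>r. \<forall>x\<in>V. f (r *\<^sub>R x) = r *\<^sub>R f x)"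


section \<open>Categories, groupoids and 2-vector spaces\<close>

text \<open>The composite \<open>g \<cdot> h\<close> is meaningful when \<open>s g = t h\<close>, i.e. arrows are composed like functions.\<close>

locale small_category =
  fixes Obj :: "'o set" and Arr :: "'a set"
    and s t :: "'a \<Rightarrow> 'o" and one :: "'o \<Rightarrow> 'a" and comp :: "'a \<Rightarrow> 'a \<Rightarrow> 'a"
  assumes source_closed: "g \<in> Arr \<Longrightarrow> s g \<in> Obj"
    and target_closed: "g \<in> Arr \<Longrightarrow> t g \<in> Obj"
    and one_closed: "x \<in> Obj \<Longrightarrow> one x \<in> Arr"
    and comp_closed: "g \<in> Arr \<Longrightarrow> h \<in> Arr \<Longrightarrow> s g = t h \<Longrightarrow> comp g h \<in> Arr"
    and source_one: "x \<in> Obj \<Longrightarrow> s (one x) = x"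
    and target_one: "x \<in> Obj \<Longrightarrow> t (one x) = x"
    and source_comp: "g \<in> Arr \<Longrightarrow> h \<in> Arr \<Longrightarrow> s g = t h \<Longrightarrow> s (comp g h) = s h"
    and target_comp: "g \<in> Arr \<Longrightarrow> h \<in> Arr \<Longrightarrow> s g = t h \<Longrightarrow> t (comp g h) = t g"
    and comp_assoc: "g \<in> Arr \<Longrightarrow> h \<in> Arr \<Longrightarrow> k \<in> Arr \<Longrightarrow> s g = t h \<Longrightarrow> s h = t k \<Longrightarrow>
      comp (comp g h) k = comp g (comp h k)"
    and comp_one: "g \<in> Arr \<Longrightarrow> comp g (one (s g)) = g"
    and one_comp: "g \<in> Arr \<Longrightarrow> comp (one (t g)) g = g"

locale groupoid = small_category Obj Arr s t one comp
  for Obj :: "'o set" and Arr :: "'a set"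
    and s t :: "'a \<Rightarrow> 'o" and one :: "'o \<Rightarrow> 'a" and comp :: "'a \<Rightarrow> 'a \<Rightarrow> 'a" +
  fixes inv :: "'a \<Rightarrow> 'a"
  assumes inv_closed: "g \<in> Arr \<Longrightarrow> inv g \<in> Arr"
    and source_inv: "g \<in> Arr \<Longrightarrow> s (inv g) = t g"
    and target_inv: "g \<in> Arr \<Longrightarrow> t (inv g) = s g"
    and comp_inv: "g \<in> Arr \<Longrightarrow> comp g (inv g) = one (t g)"
    and inv_comp: "g \<in> Arr \<Longrightarrow> comp (inv g) g = one (s g)"

definition composable :: "'a set \<Rightarrow> ('a \<Rightarrow> 'o) \<Rightarrow> ('a \<Rightarrow> 'o) \<Rightarrow> ('a \<times> 'a) set" where
  "composable A s t = {(g, h). g \<in> A \<and> h \<in> A \<and> s g = t h}"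

locale two_vector_space = small_category V0 V1 s t one comp
  for V0 :: "'o::real_vector set" and V1 :: "'a::real_vector set"
    and s t :: "'a \<Rightarrow> 'o" and one :: "'o \<Rightarrow> 'a" and comp :: "'a \<Rightarrow> 'a \<Rightarrow> 'a" +
  assumes objects_subspace: "subspace V0"
    and arrows_subspace: "subspace V1"
    and source_linear: "linear_map_on V1 s"
    and target_linear: "linear_map_on V1 t"
    and one_linear: "linear_map_on V0 one"
    and comp_linear: "linear_map_on (composable V1 s t) (\<lambda>(g, h). comp g h)"


section \<open>Smooth maps between open subsets of finite-dimensional vector spaces\<close>

text \<open>
  Throughout, \<open>E\<close> is a linear subspace of a Euclidean space and \<open>S\<close> is relatively open in \<open>E\<close>;
  derivatives are taken within \<open>E\<close> and only ever applied to vectors of \<open>E\<close>, on which they are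
  uniquely determined.  Working with subspaces allows manifolds of every dimension, including
  \<open>0\<close>, and makes slice charts of submanifolds available without choosing bases.
\<close>

primrec Ck_on :: "nat \<Rightarrow> 'e::euclidean_space set \<Rightarrow> 'e set \<Rightarrow> ('e \<Rightarrow> 'f::real_normed_vector) \<Rightarrow> bool"
where
  "Ck_on 0 E S f \<longleftrightarrow> continuous_on S f"
| "Ck_on (Suc n) E S f \<longleftrightarrow>
     (\<forall>x\<in>S. f differentiable (at x within E)) \<and>
     (\<forall>v\<in>E. Ck_on n E S (\<lambda>x. frechet_derivative f (at x within E) v))"

definition smooth_on :: "'e::euclidean_space set \<Rightarrow> 'e set \<Rightarrow> ('e \<Rightarrow> 'f::real_normed_vector) \<Rightarrow> bool"
where
  "smooth_on E S f \<longleftrightarrow> (\<forall>n. Ck_on n E S f)"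


section \<open>Smooth manifolds\<close>

record ('a, 'e) chart =
  cdom :: "'a set"
  cmap :: "'a \<Rightarrow> 'e"
  cmodel :: "'e set"

definition cinv :: "('a, 'e) chart \<Rightarrow> 'e \<Rightarrow> 'a" where
  "cinv c = inv_into (cdom c) (cmap c)"

record ('a, 'e) manifold =
  mtop :: "'a topology"
  atlas :: "('a, 'e) chart set"

abbreviation points :: "('a, 'e) manifold \<Rightarrow> 'a set" where
  "points X \<equiv> topspace (mtop X)"

definition charts_at :: "('a, 'e) manifold \<Rightarrow> 'a \<Rightarrow> ('a, 'e) chart set" where
  "charts_at X p = {c \<in> atlas X. p \<in> cdom c}"

definition is_chart :: "'a topology \<Rightarrow> ('a, 'e::euclidean_space) chart \<Rightarrow> bool" where
  "is_chart T c \<longleftrightarrow>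
     openin T (cdom c) \<and>
     subspace (cmodel c) \<and>
     openin (top_of_set (cmodel c)) (cmap c ` cdom c) \<and>
     homeomorphic_map (subtopology T (cdom c)) (top_of_set (cmap c ` cdom c)) (cmap c)"

definition compatible_charts ::
  "('a, 'e::euclidean_space) chart \<Rightarrow> ('a, 'e) chart \<Rightarrow> bool" where
  "compatible_charts c d \<longleftrightarrow>
     smooth_on (cmodel c) (cmap c ` (cdom c \<inter> cdom d)) (cmap d \<circ> cinv c) \<and>
     smooth_on (cmodel d) (cmap d ` (cdom c \<inter> cdom d)) (cmap c \<circ> cinv d)"

text \<open>The topology is not required to be Hausdorff or second countable here.\<close>

definition smooth_manifold :: "nat \<Rightarrow> ('a, 'e::euclidean_space) manifold \<Rightarrow> bool" where
  "smooth_manifold n X \<longleftrightarrow>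
     (\<forall>c\<in>atlas X. is_chart (mtop X) c \<and> dim (cmodel c) = n) \<and>
     (\<Union>c\<in>atlas X. cdom c) = points X \<and>
     (\<forall>c\<in>atlas X. \<forall>d\<in>atlas X. compatible_charts c d)"

definition maximal_atlas :: "('a, 'e::euclidean_space) manifold \<Rightarrow> ('a, 'e) chart set" where
  "maximal_atlas X = {c. is_chart (mtop X) c \<and> (\<forall>d\<in>atlas X. compatible_charts c d)}"

definition smooth_map ::
  "('a, 'e::euclidean_space) manifold \<Rightarrow> ('b, 'f::euclidean_space) manifold \<Rightarrow> ('a \<Rightarrow> 'b) \<Rightarrow> bool"
where
  "smooth_map X Y f \<longleftrightarrow>
     continuous_map (mtop X) (mtop Y) f \<and>
     (\<forall>c\<in>atlas X. \<forall>d\<in>atlas Y.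
        smooth_on (cmodel c) (cmap c ` (cdom c \<inter> f -` cdom d)) (cmap d \<circ> f \<circ> cinv c))"

definition prod_chart ::
  "('a, 'e) chart \<Rightarrow> ('b, 'f) chart \<Rightarrow> ('a \<times> 'b, 'e \<times> 'f) chart" where
  "prod_chart c d =
     \<lparr>cdom = cdom c \<times> cdom d, cmap = map_prod (cmap c) (cmap d), cmodel = cmodel c \<times> cmodel d\<rparr>"

definition prod_manifold ::
  "('a, 'e) manifold \<Rightarrow> ('b, 'f) manifold \<Rightarrow> ('a \<times> 'b, 'e \<times> 'f) manifold" where
  "prod_manifold X Y =
     \<lparr>mtop = prod_topology (mtop X) (mtop Y),
      atlas = {prod_chart c d | c d. c \<in> atlas X \<and> d \<in> atlas Y}\<rparr>"

text \<open>
  The embedded submanifold structure on a subset \<open>S\<close>: its charts are the restrictions to \<open>S\<close> of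
  the charts of the maximal atlas that flatten \<open>S\<close> to a linear subspace \<open>L\<close>.  These
  charts cover \<open>S\<close> precisely when \<open>S\<close> is an embedded submanifold.
\<close>

definition submanifold ::
  "('a, 'e::euclidean_space) manifold \<Rightarrow> 'a set \<Rightarrow> ('a, 'e) manifold" where
  "submanifold X S =
     \<lparr>mtop = subtopology (mtop X) S,
      atlas = {\<lparr>cdom = cdom c \<inter> S, cmap = cmap c, cmodel = L\<rparr> | c L.
        c \<in> maximal_atlas X \<and> subspace L \<and> L \<subseteq> cmodel c \<and>
        cmap c ` (cdom c \<inter> S) = cmap c ` cdom c \<inter> L}\<rparr>"


section \<open>Tangent vectors\<close>

text \<open>
  A tangent vector at \<open>p\<close> assigns to every chart around \<open>p\<close> its coordinate vector; the coordinate
  vectors in different charts are related by the derivative of the transition map.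
\<close>

type_synonym ('a, 'e) tangent = "('a, 'e) chart \<Rightarrow> 'e"

definition coord_change ::
  "'a \<Rightarrow> ('a, 'e::euclidean_space) chart \<Rightarrow> ('a, 'e) chart \<Rightarrow> 'e \<Rightarrow> 'e" where
  "coord_change p c d = frechet_derivative (cmap d \<circ> cinv c) (at (cmap c p) within cmodel c)"

definition tangent_space ::
  "('a, 'e::euclidean_space) manifold \<Rightarrow> 'a \<Rightarrow> ('a, 'e) tangent set" where
  "tangent_space X p =
     {v. (\<forall>c\<in>charts_at X p. v c \<in> cmodel c) \<and>
         (\<forall>c. c \<notin> charts_at X p \<longrightarrow> v c = 0) \<and>
         (\<forall>c\<in>charts_at X p. \<forall>d\<in>charts_at X p. v d = coord_change p c d (v c))}"

text \<open>The tangent vector at \<open>p\<close> whose coordinate vector in the chart \<open>c\<close> is \<open>e\<close>.\<close>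

definition coord_tangent ::
  "('a, 'e::euclidean_space) manifold \<Rightarrow> ('a, 'e) chart \<Rightarrow> 'a \<Rightarrow> 'e \<Rightarrow> ('a, 'e) tangent" where
  "coord_tangent X c p e = (\<lambda>d. if d \<in> charts_at X p then coord_change p c d e else 0)"

text \<open>For smooth \<open>f\<close> and tangent \<open>v\<close> the value does not depend on the chosen chart \<open>c\<close>.\<close>

definition differential ::
  "('a, 'e::euclidean_space) manifold \<Rightarrow> ('b, 'f::euclidean_space) manifold \<Rightarrow>
   ('a \<Rightarrow> 'b) \<Rightarrow> 'a \<Rightarrow> ('a, 'e) tangent \<Rightarrow> ('b, 'f) tangent" where
  "differential X Y f p v =
     (let c = (SOME c. c \<in> charts_at X p) in
      (\<lambda>d. if d \<in> charts_at Y (f p)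
        then frechet_derivative (cmap d \<circ> f \<circ> cinv c) (at (cmap c p) within cmodel c) (v c)
        else 0))"

definition surjective_submersion ::
  "('a, 'e::euclidean_space) manifold \<Rightarrow> ('b, 'f::euclidean_space) manifold \<Rightarrow> ('a \<Rightarrow> 'b) \<Rightarrow> bool"
where
  "surjective_submersion X Y f \<longleftrightarrow>
     smooth_map X Y f \<and> f ` points X = points Y \<and>
     (\<forall>p\<in>points X. differential X Y f p ` tangent_space X p = tangent_space Y (f p))"


section \<open>Differential forms\<close>

text \<open>
  Forms are extended by zero outside their natural domain, so that equality of functions is
  equality of forms.
\<close>

type_synonym ('a, 'e) form = "'a \<Rightarrow> ('a, 'e) tangent list \<Rightarrow> real"

definition vector_tuples :: "nat \<Rightarrow> 'v set \<Rightarrow> 'v list set" where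
  "vector_tuples k V = {vs. length vs = k \<and> set vs \<subseteq> V}"

definition alternating_form :: "nat \<Rightarrow> 'v::real_vector set \<Rightarrow> ('v list \<Rightarrow> real) \<Rightarrow> bool" where
  "alternating_form k V \<alpha> \<longleftrightarrow>
     (\<forall>vs. vs \<notin> vector_tuples k V \<longrightarrow> \<alpha> vs = 0) \<and>
     (\<forall>vs\<in>vector_tuples k V. \<forall>i<k. linear_map_on V (\<lambda>v. \<alpha> (vs[i := v]))) \<and>
     (\<forall>vs\<in>vector_tuples k V. \<forall>i<k. \<forall>j<k. i \<noteq> j \<longrightarrow> vs ! i = vs ! j \<longrightarrow> \<alpha> vs = 0)"

definition forms :: "nat \<Rightarrow> ('a, 'e::euclidean_space) manifold \<Rightarrow> ('a, 'e) form set" where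
  "forms k X =
     {\<omega>. (\<forall>p\<in>points X. alternating_form k (tangent_space X p) (\<omega> p)) \<and>
         (\<forall>p. p \<notin> points X \<longrightarrow> \<omega> p = 0) \<and>
         (\<forall>c\<in>atlas X. \<forall>es\<in>vector_tuples k (cmodel c).
            smooth_on (cmodel c) (cmap c ` cdom c)
              (\<lambda>x. \<omega> (cinv c x) (map (coord_tangent X c (cinv c x)) es)))}"

definition pullback ::
  "nat \<Rightarrow> ('a, 'e::euclidean_space) manifold \<Rightarrow> ('b, 'f::euclidean_space) manifold \<Rightarrow>
   ('a \<Rightarrow> 'b) \<Rightarrow> ('b, 'f) form \<Rightarrow> ('a, 'e) form" where
  "pullback k X Y f \<omega> = (\<lambda>p vs.
     if p \<in> points X \<and> vs \<in> vector_tuples k (tangent_space X p)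
     then \<omega> (f p) (map (differential X Y f p) vs) else 0)"


section \<open>Lie groupoids, multiplicative and affine forms\<close>

abbreviation composable_manifold ::
  "('g, 'e::euclidean_space) manifold \<Rightarrow> ('g \<Rightarrow> 'm) \<Rightarrow> ('g \<Rightarrow> 'm) \<Rightarrow> ('g \<times> 'g, 'e \<times> 'e) manifold"
where
  "composable_manifold G s t \<equiv> submanifold (prod_manifold G G) (composable (points G) s t)"

text \<open>
  As \<open>s\<close> and \<open>t\<close> are submersions, the composable pairs form an embedded submanifold of \<open>G \<times> G\<close>.
  The space of arrows may be non-Hausdorff.
\<close>

locale lie_groupoid = groupoid "points M" "points G" s t u m i
  for G :: "('g, 'e::euclidean_space) manifold" and M :: "('m, 'b::euclidean_space) manifold"
    and s t :: "'g \<Rightarrow> 'm" and u :: "'m \<Rightarrow> 'g" and m :: "'g \<Rightarrow> 'g \<Rightarrow> 'g" and i :: "'g \<Rightarrow> 'g" +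
  assumes arrows_manifold: "\<exists>n. smooth_manifold n G"
    and objects_manifold: "\<exists>n. smooth_manifold n M"
    and objects_Hausdorff: "Hausdorff_space (mtop M)"
    and objects_second_countable: "second_countable (mtop M)"
    and source_submersion: "surjective_submersion G M s"
    and target_submersion: "surjective_submersion G M t"
    and unit_smooth: "smooth_map M G u"
    and mult_smooth: "smooth_map (composable_manifold G s t) G (\<lambda>(g, h). m g h)"
    and inverse_smooth: "smooth_map G G i"

definition multiplicative_forms ::
  "nat \<Rightarrow> ('g, 'e::euclidean_space) manifold \<Rightarrow> ('g \<Rightarrow> 'm) \<Rightarrow> ('g \<Rightarrow> 'm) \<Rightarrow>
   ('g \<Rightarrow> 'g \<Rightarrow> 'g) \<Rightarrow> ('g, 'e) form set" where
  "multiplicative_forms k G s t m =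
     {\<Theta> \<in> forms k G.
        let G2 = composable_manifold G s t in
        pullback k G2 G (\<lambda>(g, h). m g h) \<Theta> = pullback k G2 G fst \<Theta> + pullback k G2 G snd \<Theta>}"

definition affine_forms ::
  "nat \<Rightarrow> ('g, 'e::euclidean_space) manifold \<Rightarrow> ('m, 'b::euclidean_space) manifold \<Rightarrow>
   ('g \<Rightarrow> 'm) \<Rightarrow> ('g \<Rightarrow> 'm) \<Rightarrow> ('m \<Rightarrow> 'g) \<Rightarrow> ('g \<Rightarrow> 'g \<Rightarrow> 'g) \<Rightarrow> ('g, 'e) form set" where
  "affine_forms k G M s t u m =
     {\<Theta> \<in> forms k G.
        let G2 = composable_manifold G s t; \<theta> = pullback k M G u \<Theta> in
        pullback k G2 G (\<lambda>(g, h). m g h) \<Theta> =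
          pullback k G2 G fst \<Theta> + pullback k G2 G snd \<Theta> - pullback k G2 G fst (pullback k G M s \<theta>)}"

end

theory Submission
  imports Defs
begin

text \<open>
  The statement is linear algebra in pullbacks along the structure maps of the groupoid, once four
  geometric facts are available.

  \<^item> Pullback along a smooth map sends forms to forms and is functorial (\<open>pullback_in_forms\<close>,
    \<open>pullback_compose\<close>).
  \<^item> The set \<open>\<G>\<^sup>(\<^sup>2\<^sup>)\<close> of composable pairs is an embedded submanifold of the product
    (\<open>smooth_structure_composable\<close>), so that functoriality also applies to the maps out of it and
    into it.  The laws \<open>s \<circ> m = s \<circ> pr\<^sub>2\<close>, \<open>t \<circ> m = t \<circ> pr\<^sub>1\<close> and \<open>s \<circ> pr\<^sub>1 = t \<circ> pr\<^sub>2\<close> then become identities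
    between pullbacks of forms on the base.
  \<^item> As \<open>s \<circ> u\<close> and \<open>t \<circ> u\<close> are the identity, \<open>u\<^sup>*\<close> is a left inverse of both \<open>s\<^sup>*\<close> and \<open>t\<^sup>*\<close>.
  \<^item> A multiplicative form pulls back to zero on the units, since pulling \<open>m\<^sup>*\<Theta> = pr\<^sub>1\<^sup>*\<Theta> + pr\<^sub>2\<^sup>*\<Theta>\<close> back along
    \<open>x \<mapsto> (1\<^sub>x, 1\<^sub>x)\<close> gives \<open>u\<^sup>*\<Theta> = 2 u\<^sup>*\<Theta>\<close> (\<open>multiplicative_unit\<close>).

  These identities show that \<open>\<Theta> - t\<^sup>*\<theta>\<close> and \<open>\<Theta> - s\<^sup>*\<theta>\<close> are multiplicative when \<open>\<Theta>\<close> is affine, that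
  multiplicative forms are affine, and that the category laws hold
  (\<open>two_vector_space_affine_forms\<close>).  Every category internal to vector spaces is a groupoid
  (\<open>two_vector_space_groupoid\<close>); here the inverse of \<open>\<Theta>\<close> is \<open>\<Theta> - s\<^sup>*\<theta> - t\<^sup>*\<theta>\<close>.

  The analytic core is the submanifold statement.  In charts \<open>\<G>\<^sup>(\<^sup>2\<^sup>)\<close> is the zero set of a map with
  surjective derivative.  It is straightened by a change of coordinates
  (\<open>regular_zero_set_slice\<close>), whose inverse has to be smooth of every order.  This is
  \<open>smooth_local_inverse\<close>, and rests on the fact that inverting linear maps is a smooth operation
  (\<open>Ck_on_inverse_linear_family\<close>).
\<close>

section \<open>Calculus on relatively open subsets of a subspace\<close>

abbreviation open_in_subspace :: "'e::euclidean_space set \<Rightarrow> 'e set \<Rightarrow> bool" where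
  "open_in_subspace E S \<equiv> subspace E \<and> openin (top_of_set E) S"

lemma open_in_subspace_at:
  assumes "open_in_subspace E S" "x \<in> S"
  shows "at x within E = at x within S"
proof -
  obtain T where T: "open T" "S = E \<inter> T"
    using assms by (auto simp: openin_open)
  show ?thesis
    by (rule at_within_nhd[of x T]) (use assms T in auto)
qed

lemma open_in_subspace_mem: "open_in_subspace E S \<Longrightarrow> x \<in> S \<Longrightarrow> x \<in> E"
  by (auto dest: openin_imp_subset)

text \<open>
  The derivative within a subspace is determined on that subspace: restricting to the line through
  \<open>x\<close> in the direction \<open>v\<close> reduces the claim to functions of one real variable.
\<close>

lemma derivative_within_subspace_unique:
  fixes f :: "'e::euclidean_space \<Rightarrow> 'f::real_normed_vector"
  assumes E: "subspace E" "x \<in> E" "v \<in> E"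
    and f': "(f has_derivative f') (at x within E)"
    and f'': "(f has_derivative f'') (at x within E)"
  shows "f' v = f'' v"
proof -
  have line: "((\<lambda>r. f (x + r *\<^sub>R v)) has_derivative (\<lambda>r. F (r *\<^sub>R v))) (at 0)"
    if F: "(f has_derivative F) (at x within E)" for F
  proof -
    have 1: "((\<lambda>r::real. x + r *\<^sub>R v) has_derivative (\<lambda>r. r *\<^sub>R v)) (at 0)"
      by (auto intro!: derivative_eq_intros)
    have sub: "range (\<lambda>r::real. x + r *\<^sub>R v) \<subseteq> E"
      using E by (auto intro: subspace_add subspace_mul)
    have "(f has_derivative F) (at (x + 0 *\<^sub>R v) within range (\<lambda>r::real. x + r *\<^sub>R v))"
      using has_derivative_subset[OF F sub] by simp
    from diff_chain_within[OF 1 this] show ?thesis by (simp add: o_def)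
  qed
  have "(\<lambda>r. f' (r *\<^sub>R v)) = (\<lambda>r. f'' (r *\<^sub>R v))"
    by (rule has_derivative_unique[OF line[OF f'] line[OF f'']])
  from fun_cong[OF this, of 1] show ?thesis by simp
qed

lemma frechet_derivative_within_subspace:
  fixes f :: "'e::euclidean_space \<Rightarrow> 'f::real_normed_vector"
  assumes "subspace E" "x \<in> E" "(f has_derivative f') (at x within E)" "v \<in> E"
  shows "frechet_derivative f (at x within E) v = f' v"
proof -
  have "(f has_derivative frechet_derivative f (at x within E)) (at x within E)"
    using assms(3) by (auto simp: frechet_derivative_works[symmetric] differentiable_def)
  from derivative_within_subspace_unique[OF assms(1,2,4) this assms(3)] show ?thesis .
qed

lemma has_derivative_cong_open_in_subspace:
  assumes "open_in_subspace E S" "x \<in> S" "(f has_derivative f') (at x within E)"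
    and "\<And>y. y \<in> S \<Longrightarrow> f y = g y"
  shows "(g has_derivative f') (at x within E)"
  using assms(3) unfolding open_in_subspace_at[OF assms(1,2)]
  by (rule has_derivative_transform[OF assms(2), rotated]) (simp add: assms(4))

lemma frechet_derivative_cong_open_in_subspace:
  assumes "open_in_subspace E S" "x \<in> S" "f differentiable (at x within E)"
    and "\<And>y. y \<in> S \<Longrightarrow> f y = g y" "v \<in> E"
  shows "frechet_derivative g (at x within E) v = frechet_derivative f (at x within E) v"
proof -
  have "(f has_derivative frechet_derivative f (at x within E)) (at x within E)"
    using assms(3) by (simp add: frechet_derivative_works)
  from has_derivative_cong_open_in_subspace[OF assms(1,2) this assms(4)] show ?thesis
    using assms open_in_subspace_mem[OF assms(1,2)] by (intro frechet_derivative_within_subspace) auto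
qed

lemma Ck_on_cong:
  assumes "open_in_subspace E S" "Ck_on n E S f" "\<And>x. x \<in> S \<Longrightarrow> f x = g x"
  shows "Ck_on n E S g"
  using assms(2,3)
proof (induction n arbitrary: f g)
  case 0
  then show ?case using continuous_on_cong[of S S f g] by simp
next
  case (Suc n)
  have "g differentiable (at x within E)" if x: "x \<in> S" for x
  proof -
    obtain f' where "(f has_derivative f') (at x within E)"
      using Suc.prems(1) x by (auto simp: differentiable_def)
    from has_derivative_cong_open_in_subspace[OF assms(1) x this Suc.prems(2)]
    show ?thesis by (auto simp: differentiable_def)
  qed
  moreover have "Ck_on n E S (\<lambda>x. frechet_derivative g (at x within E) v)" if "v \<in> E" for v
  proof (rule Suc.IH)
    show "Ck_on n E S (\<lambda>x. frechet_derivative f (at x within E) v)"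
      using Suc.prems that by simp
    fix x assume x: "x \<in> S"
    show "frechet_derivative f (at x within E) v = frechet_derivative g (at x within E) v"
      by (rule frechet_derivative_cong_open_in_subspace[OF assms(1) x, symmetric])
        (use Suc.prems x that in auto)
  qed
  ultimately show ?case by simp
qed

lemma Ck_on_SucI:
  assumes S: "open_in_subspace E S"
    and "\<And>x. x \<in> S \<Longrightarrow> (f has_derivative f' x) (at x within E)"
    and "\<And>v. v \<in> E \<Longrightarrow> Ck_on n E S (\<lambda>x. f' x v)"
  shows "Ck_on (Suc n) E S f"
proof -
  have "Ck_on n E S (\<lambda>x. frechet_derivative f (at x within E) v)" if "v \<in> E" for v
  proof (rule Ck_on_cong[OF S assms(3)[OF that]])
    fix x assume x: "x \<in> S"
    show "f' x v = frechet_derivative f (at x within E) v"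
      using frechet_derivative_within_subspace[OF _ open_in_subspace_mem[OF S x] assms(2)[OF x] that] S
      by simp
  qed
  then show ?thesis using assms(2) by (auto simp: differentiable_def)
qed

lemma Ck_on_SucD:
  assumes "Ck_on (Suc n) E S f" "x \<in> S"
  shows "(f has_derivative frechet_derivative f (at x within E)) (at x within E)"
  using assms by (simp add: frechet_derivative_works)

lemma Ck_on_SucD':
  assumes "Ck_on (Suc n) E S f" "v \<in> E"
  shows "Ck_on n E S (\<lambda>x. frechet_derivative f (at x within E) v)"
  using assms by simp

lemma Ck_on_continuous_on:
  assumes "open_in_subspace E S" "Ck_on n E S f"
  shows "continuous_on S f"
proof (cases n)
  case (Suc k)
  then have "continuous (at x within E) f" if "x \<in> S" for x
    using assms that by (auto intro: differentiable_imp_continuous_within)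
  then show ?thesis
    using open_in_subspace_at[OF assms(1)] by (auto simp: continuous_on_eq_continuous_within)
qed (use assms in simp)

lemma Ck_on_Suc_imp:
  assumes "open_in_subspace E S" "Ck_on (Suc n) E S f"
  shows "Ck_on n E S f"
  using assms(2)
proof (induction n arbitrary: f)
  case 0
  show ?case using Ck_on_continuous_on[OF assms(1) 0] by simp
next
  case (Suc n)
  have "Ck_on n E S (\<lambda>x. frechet_derivative f (at x within E) v)" if "v \<in> E" for v
    by (rule Suc.IH[OF Ck_on_SucD'[OF Suc.prems that]])
  then show ?case using Suc.prems by simp
qed

lemma Ck_on_const: "open_in_subspace E S \<Longrightarrow> Ck_on n E S (\<lambda>x. c)"
proof (induction n arbitrary: c)
  case (Suc n)
  show ?case by (rule Ck_on_SucI[where f' = "\<lambda>x v. 0"]) (use Suc in auto)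
qed simp

lemma Ck_on_bounded_linear:
  assumes S: "open_in_subspace E S" and L: "bounded_linear L" and "Ck_on n E S f"
  shows "Ck_on n E S (\<lambda>x. L (f x))"
  using assms(3)
proof (induction n arbitrary: f)
  case 0
  then show ?case using bounded_linear.continuous_on[OF L] by simp
next
  case (Suc n)
  show ?case
    by (rule Ck_on_SucI[OF S bounded_linear.has_derivative[OF L Ck_on_SucD[OF Suc.prems]]])
      (use Suc in auto)
qed

lemma Ck_on_id: "open_in_subspace E S \<Longrightarrow> Ck_on n E S (\<lambda>x. x)"
proof (cases n)
  case (Suc k)
  assume S: "open_in_subspace E S"
  show ?thesis
    unfolding Suc by (rule Ck_on_SucI[OF S, where f' = "\<lambda>x v. v"]) (auto intro: Ck_on_const[OF S])
qed simp

lemma Ck_on_add: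
  assumes S: "open_in_subspace E S" and "Ck_on n E S f" "Ck_on n E S g"
  shows "Ck_on n E S (\<lambda>x. f x + g x)"
  using assms(2,3)
proof (induction n arbitrary: f g)
  case 0
  then show ?case by (simp add: continuous_on_add)
next
  case (Suc n)
  show ?case
    by (rule Ck_on_SucI[OF S has_derivative_add[OF Ck_on_SucD Ck_on_SucD]]) (use Suc in auto)
qed

lemma Ck_on_sum:
  assumes S: "open_in_subspace E S" and "\<And>i. i \<in> I \<Longrightarrow> Ck_on n E S (f i)"
  shows "Ck_on n E S (\<lambda>x. \<Sum>i\<in>I. f i x)"
  using assms(2)
proof (induction I rule: infinite_finite_induct)
  case (insert i I)
  have "Ck_on n E S (\<lambda>x. f i x + (\<Sum>i\<in>I. f i x))"
    by (rule Ck_on_add[OF S]) (use insert in auto)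
  then show ?case using insert.hyps by simp
qed (auto intro: Ck_on_const[OF S])

lemma Ck_on_scaleR:
  assumes S: "open_in_subspace E S" and "Ck_on n E S r" "Ck_on n E S g"
  shows "Ck_on n E S (\<lambda>x. r x *\<^sub>R g x)"
  using assms(2,3)
proof (induction n arbitrary: r g)
  case 0
  then show ?case by (simp add: continuous_on_scaleR)
next
  case (Suc n)
  show ?case
  proof (rule Ck_on_SucI[OF S has_derivative_scaleR[OF Ck_on_SucD Ck_on_SucD]])
    fix v assume v: "v \<in> E"
    show "Ck_on n E S (\<lambda>x. r x *\<^sub>R frechet_derivative g (at x within E) v +
      frechet_derivative r (at x within E) v *\<^sub>R g x)"
      using v Suc.prems by (intro Ck_on_add[OF S] Suc.IH) (auto intro: Ck_on_Suc_imp[OF S])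
  qed (use Suc.prems in auto)
qed

lemma Ck_on_Pair:
  assumes S: "open_in_subspace E S" and "Ck_on n E S f" "Ck_on n E S g"
  shows "Ck_on n E S (\<lambda>x. (f x, g x))"
  using assms(2,3)
proof (induction n arbitrary: f g)
  case 0
  then show ?case by (simp add: continuous_on_Pair)
next
  case (Suc n)
  show ?case
    by (rule Ck_on_SucI[OF S has_derivative_Pair[OF Ck_on_SucD Ck_on_SucD]]) (use Suc in auto)
qed

lemma Ck_on_open_subset:
  assumes S: "open_in_subspace E S" and U: "open_in_subspace E U" "U \<subseteq> S" and "Ck_on n E S f"
  shows "Ck_on n E U f"
  using assms(4)
proof (induction n arbitrary: f)
  case 0
  then show ?case using U continuous_on_subset by auto
next
  case (Suc n)
  then show ?case using U by auto
qed

lemma Ck_on_local: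
  assumes S: "open_in_subspace E S"
    and "\<And>x. x \<in> S \<Longrightarrow> \<exists>U. open_in_subspace E U \<and> x \<in> U \<and> U \<subseteq> S \<and> Ck_on n E U f"
  shows "Ck_on n E S f"
  using assms(2)
proof (induction n arbitrary: f)
  case 0
  have "continuous (at x within S) f" if x: "x \<in> S" for x
  proof -
    obtain U where U: "open_in_subspace E U" "x \<in> U" "U \<subseteq> S" "continuous_on U f"
      using 0[OF x] by auto
    then have "continuous (at x within U) f"
      by (simp add: continuous_on_eq_continuous_within)
    then show ?thesis
      by (metis open_in_subspace_at S U(1,2) x)
  qed
  then show ?case by (simp add: continuous_on_eq_continuous_within)
next
  case (Suc n)
  have "f differentiable (at x within E)" if x: "x \<in> S" for x
    using Suc.prems[OF x] by auto
  moreover have "Ck_on n E S (\<lambda>x. frechet_derivative f (at x within E) v)" if "v \<in> E" for v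
    by (rule Suc.IH) (use Suc.prems that in fastforce)
  ultimately show ?case by simp
qed

text \<open>
  Every smoothness argument about linear maps below expands a vector of the subspace as
  \<open>\<Sum>b\<in>B. (y \<bullet> b) *\<^sub>R b\<close>, which leaves finitely many scalar and vector functions.  The
  defining property of the frame is the reproducing property of an orthonormal basis.
\<close>

definition parseval_frame :: "'e::euclidean_space set \<Rightarrow> 'e set" where
  "parseval_frame F = (SOME B. B \<subseteq> F \<and> finite B \<and> (\<forall>y\<in>F. y = (\<Sum>b\<in>B. (y \<bullet> b) *\<^sub>R b)))"

lemma parseval_frame:
  fixes F :: "'e::euclidean_space set"
  assumes "subspace F"
  shows "parseval_frame F \<subseteq> F" "finite (parseval_frame F)"
    "y \<in> F \<Longrightarrow> y = (\<Sum>b\<in>parseval_frame F. (y \<bullet> b) *\<^sub>R b)"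
proof -
  obtain B where B: "B \<subseteq> F" "pairwise orthogonal B" "\<And>x. x \<in> B \<Longrightarrow> norm x = 1" "independent B"
    "span B = F"
    using orthonormal_basis_subspace[OF assms] by metis
  have fin: "finite B" using B(4) by (rule independent_imp_finite)
  have "y = (\<Sum>b\<in>B. (y \<bullet> b) *\<^sub>R b)" if y: "y \<in> F" for y
  proof -
    obtain c where c: "y = (\<Sum>b\<in>B. c b *\<^sub>R b)"
      using y unfolding B(5)[symmetric] span_finite[OF fin] by auto
    have "y \<bullet> b = c b" if b: "b \<in> B" for b
    proof -
      have "y \<bullet> b = (\<Sum>a\<in>B. c a * (a \<bullet> b))"
        by (simp add: c inner_sum_left)
      also have "\<dots> = (\<Sum>a\<in>B. if a = b then c b else 0)"
      proof (rule sum.cong)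
        fix a assume a: "a \<in> B"
        show "c a * (a \<bullet> b) = (if a = b then c b else 0)"
          using B(2) B(3)[OF b] a b by (auto simp: pairwise_def orthogonal_def dot_square_norm)
      qed simp
      also have "\<dots> = c b" using b fin by simp
      finally show ?thesis .
    qed
    then show ?thesis using c by simp
  qed
  then have "\<exists>B. B \<subseteq> F \<and> finite B \<and> (\<forall>y\<in>F. y = (\<Sum>b\<in>B. (y \<bullet> b) *\<^sub>R b))"
    using B(1) fin by blast
  from someI_ex[OF this] show "parseval_frame F \<subseteq> F" "finite (parseval_frame F)"
    "y \<in> F \<Longrightarrow> y = (\<Sum>b\<in>parseval_frame F. (y \<bullet> b) *\<^sub>R b)"
    unfolding parseval_frame_def[symmetric] by auto
qed

lemma linear_expand_frame:
  assumes "subspace F" "linear L" "y \<in> F"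
  shows "L y = (\<Sum>b\<in>parseval_frame F. (y \<bullet> b) *\<^sub>R L b)"
proof -
  have "L y = L (\<Sum>b\<in>parseval_frame F. (y \<bullet> b) *\<^sub>R b)"
    using parseval_frame(3)[OF assms(1,3)] by simp
  then show ?thesis by (simp add: linear_sum[OF assms(2)] linear_cmul[OF assms(2)])
qed

definition subspace_projection :: "'e::euclidean_space set \<Rightarrow> 'e \<Rightarrow> 'e" where
  "subspace_projection F y = (\<Sum>b\<in>parseval_frame F. (y \<bullet> b) *\<^sub>R b)"

lemma subspace_projection:
  fixes F :: "'e::euclidean_space set"
  assumes "subspace F"
  shows "bounded_linear (subspace_projection F)" "subspace_projection F y \<in> F"
    "y \<in> F \<Longrightarrow> subspace_projection F y = y"
proof -
  show "bounded_linear (subspace_projection F)"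
    unfolding subspace_projection_def
    by (intro bounded_linear_sum bounded_linear_scaleR_left[THEN bounded_linear_compose]
        bounded_linear_inner_left)
  show "subspace_projection F y \<in> F"
    unfolding subspace_projection_def
    using parseval_frame[OF assms] by (intro subspace_sum subspace_mul assms) auto
  show "y \<in> F \<Longrightarrow> subspace_projection F y = y"
    unfolding subspace_projection_def using parseval_frame(3)[OF assms] by metis
qed

text \<open>
  A map into \<open>F\<close> agrees with its projection to \<open>F\<close>, hence so does its derivative.
\<close>

lemma derivative_in_subspace:
  fixes f :: "'e::euclidean_space \<Rightarrow> 'f::euclidean_space"
  assumes S: "open_in_subspace E S" and x: "x \<in> S" and F: "subspace F" "f ` S \<subseteq> F"
    and f': "(f has_derivative f') (at x within E)" and v: "v \<in> E"
  shows "f' v \<in> F"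
proof -
  have xE: "x \<in> E" using open_in_subspace_mem[OF S x] .
  have "((\<lambda>y. subspace_projection F (f y)) has_derivative (\<lambda>v. subspace_projection F (f' v)))
      (at x within E)"
    by (rule bounded_linear.has_derivative[OF subspace_projection(1)[OF F(1)] f'])
  then have "(f has_derivative (\<lambda>v. subspace_projection F (f' v))) (at x within E)"
    by (rule has_derivative_cong_open_in_subspace[OF S x])
      (use F subspace_projection(3)[OF F(1)] in auto)
  then have "f' v = subspace_projection F (f' v)"
    using derivative_within_subspace_unique[OF conjunct1[OF S] xE v f'] by blast
  then show ?thesis using subspace_projection(2)[OF F(1)] by metis
qed

lemma has_derivative_compose_subspace:
  fixes f :: "'e::euclidean_space \<Rightarrow> 'f::euclidean_space"
  assumes S: "open_in_subspace E S" and x: "x \<in> S" and T: "open_in_subspace E' T" "f ` S \<subseteq> T"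
    and f': "(f has_derivative f') (at x within E)"
    and g': "(g has_derivative g') (at (f x) within E')"
  shows "(g \<circ> f has_derivative g' \<circ> f') (at x within E)"
proof -
  have "(f has_derivative f') (at x within S)"
    using f' open_in_subspace_at[OF S x] by simp
  moreover have "(g has_derivative g') (at (f x) within f ` S)"
    by (rule has_derivative_subset[OF g']) (use T openin_imp_subset in fast)
  ultimately have "(g \<circ> f has_derivative g' \<circ> f') (at x within S)"
    by (rule diff_chain_within)
  then show ?thesis using open_in_subspace_at[OF S x] by simp
qed

text \<open>
  The derivative of the composite in the direction \<open>v\<close> is \<open>Dg (f x) (Df x v)\<close>.  Expanding the inner
  vector in a frame turns this into sums of products of functions \<open>\<langle>Df x v, b\<rangle>\<close> and \<open>Dg (f x) b\<close>, to which the
  induction hypothesis for one derivative less applies.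
\<close>

lemma Ck_on_compose:
  fixes f :: "'e::euclidean_space \<Rightarrow> 'f::euclidean_space"
  assumes S: "open_in_subspace E S" and T: "open_in_subspace E' T" "f ` S \<subseteq> T"
    and "Ck_on n E S f" "Ck_on n E' T g"
  shows "Ck_on n E S (g \<circ> f)"
  using assms(4,5)
proof (induction n arbitrary: g)
  case 0
  then show ?case using continuous_on_compose[of S f g] continuous_on_subset[OF _ T(2), of g] by simp
next
  case (Suc n)
  let ?f' = "\<lambda>x. frechet_derivative f (at x within E)"
  let ?g' = "\<lambda>x. frechet_derivative g (at (f x) within E')"
  have fxT: "f x \<in> T" if "x \<in> S" for x using T(2) that by auto
  show ?case
  proof (rule Ck_on_SucI[OF S])
    fix x assume x: "x \<in> S"
    show "(g \<circ> f has_derivative ?g' x \<circ> ?f' x) (at x within E)"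
      by (rule has_derivative_compose_subspace[OF S x T])
        (use Suc.prems x fxT in \<open>auto intro: Ck_on_SucD\<close>)
  next
    fix v assume v: "v \<in> E"
    have E': "subspace E'" using T(1) by simp
    have fE': "f ` S \<subseteq> E'" using T openin_imp_subset by fast
    have "Ck_on n E S (\<lambda>x. \<Sum>b\<in>parseval_frame E'. (?f' x v \<bullet> b) *\<^sub>R ?g' x b)"
    proof (intro Ck_on_sum[OF S] Ck_on_scaleR[OF S])
      fix b assume b: "b \<in> parseval_frame E'"
      show "Ck_on n E S (\<lambda>x. ?f' x v \<bullet> b)"
        using Suc.prems v by (intro Ck_on_bounded_linear[OF S bounded_linear_inner_left]) auto
      have "Ck_on n E S ((\<lambda>y. frechet_derivative g (at y within E') b) \<circ> f)"
      proof (rule Suc.IH)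
        show "Ck_on n E S f" using Ck_on_Suc_imp[OF S Suc.prems(1)] .
        show "Ck_on n E' T (\<lambda>y. frechet_derivative g (at y within E') b)"
          using Suc.prems(2) parseval_frame(1)[OF E'] b by auto
      qed
      then show "Ck_on n E S (\<lambda>x. ?g' x b)" by (simp add: o_def)
    qed
    then show "Ck_on n E S (\<lambda>x. (?g' x \<circ> ?f' x) v)"
    proof (rule Ck_on_cong[OF S])
      fix x assume x: "x \<in> S"
      have "?f' x v \<in> E'"
        by (rule derivative_in_subspace[OF S x E' fE' Ck_on_SucD[OF Suc.prems(1) x] v])
      moreover have "linear (?g' x)"
        using Ck_on_SucD[OF Suc.prems(2) fxT[OF x]] by (rule has_derivative_linear)
      ultimately show "(\<Sum>b\<in>parseval_frame E'. (?f' x v \<bullet> b) *\<^sub>R ?g' x b) = (?g' x \<circ> ?f' x) v"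
        using linear_expand_frame[OF E'] by (metis comp_apply)
    qed
  qed
qed

lemma Ck_on_restrict:
  assumes S: "open_in_subspace E S" and L: "subspace L" "L \<subseteq> E" and "Ck_on n E S f"
  shows "Ck_on n L (S \<inter> L) f"
  using assms(4)
proof (induction n arbitrary: f)
  case 0
  then show ?case by (auto intro: continuous_on_subset)
next
  case (Suc n)
  have SL: "open_in_subspace L (S \<inter> L)"
    using S L by (auto simp: openin_open)
  show ?case
  proof (rule Ck_on_SucI[OF SL])
    show "(f has_derivative frechet_derivative f (at x within E)) (at x within L)" if "x \<in> S \<inter> L" for x
      using has_derivative_subset[OF Ck_on_SucD[OF Suc.prems] L(2)] that by auto
    show "Ck_on n L (S \<inter> L) (\<lambda>x. frechet_derivative f (at x within E) v)" if "v \<in> L" for v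
      using Suc.IH Suc.prems L(2) that by auto
  qed
qed

lemma smooth_on_cong:
  "open_in_subspace E S \<Longrightarrow> smooth_on E S f \<Longrightarrow> (\<And>x. x \<in> S \<Longrightarrow> f x = g x) \<Longrightarrow> smooth_on E S g"
  unfolding smooth_on_def using Ck_on_cong by metis

lemma smooth_on_compose:
  fixes f :: "'e::euclidean_space \<Rightarrow> 'f::euclidean_space"
  shows "open_in_subspace E S \<Longrightarrow> open_in_subspace E' T \<Longrightarrow> f ` S \<subseteq> T \<Longrightarrow>
    smooth_on E S f \<Longrightarrow> smooth_on E' T g \<Longrightarrow> smooth_on E S (g \<circ> f)"
  unfolding smooth_on_def using Ck_on_compose by metis

lemma smooth_on_open_subset:
  "open_in_subspace E S \<Longrightarrow> open_in_subspace E U \<Longrightarrow> U \<subseteq> S \<Longrightarrow> smooth_on E S f \<Longrightarrow> smooth_on E U f"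
  unfolding smooth_on_def using Ck_on_open_subset by metis

lemma smooth_on_local:
  assumes "open_in_subspace E S"
    and "\<And>x. x \<in> S \<Longrightarrow> \<exists>U. open_in_subspace E U \<and> x \<in> U \<and> U \<subseteq> S \<and> smooth_on E U f"
  shows "smooth_on E S f"
  unfolding smooth_on_def using Ck_on_local[OF assms(1)] assms(2) unfolding smooth_on_def by meson

lemma smooth_on_restrict:
  "open_in_subspace E S \<Longrightarrow> subspace L \<Longrightarrow> L \<subseteq> E \<Longrightarrow> smooth_on E S f \<Longrightarrow> smooth_on L (S \<inter> L) f"
  unfolding smooth_on_def using Ck_on_restrict by metis

lemma smooth_on_Pair:
  "open_in_subspace E S \<Longrightarrow> smooth_on E S f \<Longrightarrow> smooth_on E S g \<Longrightarrow> smooth_on E S (\<lambda>x. (f x, g x))"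
  unfolding smooth_on_def using Ck_on_Pair by metis

lemma smooth_on_bounded_linear:
  "open_in_subspace E S \<Longrightarrow> bounded_linear L \<Longrightarrow> smooth_on E S f \<Longrightarrow> smooth_on E S (\<lambda>x. L (f x))"
  unfolding smooth_on_def using Ck_on_bounded_linear by metis

lemma smooth_on_id: "open_in_subspace E S \<Longrightarrow> smooth_on E S (\<lambda>x. x)"
  unfolding smooth_on_def using Ck_on_id by metis

lemma smooth_on_add:
  "open_in_subspace E S \<Longrightarrow> smooth_on E S f \<Longrightarrow> smooth_on E S g \<Longrightarrow> smooth_on E S (\<lambda>x. f x + g x)"
  unfolding smooth_on_def using Ck_on_add by metis

lemma smooth_on_has_derivative:
  assumes "smooth_on E S f" "x \<in> S"
  shows "(f has_derivative frechet_derivative f (at x within E)) (at x within E)"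
  using assms Ck_on_SucD[of 0] unfolding smooth_on_def by metis

lemma open_in_subspace_Times:
  "open_in_subspace E S \<Longrightarrow> open_in_subspace F T \<Longrightarrow> open_in_subspace (E \<times> F) (S \<times> T)"
  by (simp add: subspace_Times openin_Times)

section \<open>Smooth local inverses\<close>

text \<open>
  A remainder that vanishes at the base point only needs to be multiplied by a continuous function
  to stay differentiable there.  This is what makes the derivative of an inverse computable before
  the inverse is known to be differentiable.
\<close>

lemma has_derivative_scaleR_zero:
  fixes r :: "'e::real_normed_vector \<Rightarrow> real" and g :: "'e \<Rightarrow> 'f::real_normed_vector"
  assumes r': "(r has_derivative r') (at x within E)" and r0: "r x = 0"
    and g: "continuous (at x within E) g"
  shows "((\<lambda>y. r y *\<^sub>R g y) has_derivative (\<lambda>v. r' v *\<^sub>R g x)) (at x within E)"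
proof -
  have lin: "bounded_linear r'" using r' by (rule has_derivative_bounded_linear)
  obtain K where K: "K > 0" "\<And>v. norm (r' v) \<le> norm v * K"
    using bounded_linear.pos_bounded[OF lin] by blast
  have "((\<lambda>y. r y *\<^sub>R (g y - g x)) has_derivative (\<lambda>v. 0)) (at x within E)"
    unfolding has_derivative_within_alt
  proof (intro conjI allI impI)
    fix e :: real assume e: "e > 0"
    obtain d1 where d1: "d1 > 0"
      "\<And>y. y \<in> E \<Longrightarrow> norm (y - x) < d1 \<Longrightarrow> norm (r y - r x - r' (y - x)) \<le> 1 * norm (y - x)"
      using r' zero_less_one unfolding has_derivative_within_alt by blast
    have "e / (K + 1) > 0" using e K by simp
    then obtain d2 where d2: "d2 > 0"
      "\<And>y. y \<in> E \<Longrightarrow> dist y x < d2 \<Longrightarrow> dist (g y) (g x) < e / (K + 1)"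
      using g unfolding continuous_within_eps_delta by blast
    show "\<exists>d>0. \<forall>y\<in>E. norm (y - x) < d \<longrightarrow>
      norm (r y *\<^sub>R (g y - g x) - r x *\<^sub>R (g x - g x) - 0) \<le> e * norm (y - x)"
    proof (intro exI conjI ballI impI)
      show "min d1 d2 > 0" using d1 d2 by simp
      fix y assume y: "y \<in> E" "norm (y - x) < min d1 d2"
      have "norm (r y) \<le> norm (r y - r' (y - x)) + norm (r' (y - x))"
        using norm_triangle_ineq[of "r y - r' (y - x)" "r' (y - x)"] by simp
      also have "\<dots> \<le> (K + 1) * norm (y - x)"
        using d1(2)[OF y(1)] y(2) K(2)[of "y - x"] r0 by (simp add: algebra_simps)
      finally have ry: "norm (r y) \<le> (K + 1) * norm (y - x)" .
      have gy: "norm (g y - g x) \<le> e / (K + 1)"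
        using d2(2)[OF y(1)] y(2) by (simp add: dist_norm)
      have "norm (r y *\<^sub>R (g y - g x)) \<le> ((K + 1) * norm (y - x)) * (e / (K + 1))"
        unfolding norm_scaleR using ry gy K by (intro mult_mono) auto
      also have "\<dots> = e * norm (y - x)" using K by simp
      finally show "norm (r y *\<^sub>R (g y - g x) - r x *\<^sub>R (g x - g x) - 0) \<le> e * norm (y - x)"
        using r0 by simp
    qed
  qed simp
  moreover have "((\<lambda>y. r y *\<^sub>R g x) has_derivative (\<lambda>v. r' v *\<^sub>R g x)) (at x within E)"
    by (rule bounded_linear.has_derivative[OF bounded_linear_scaleR_left r'])
  ultimately have "((\<lambda>y. r y *\<^sub>R (g y - g x) + r y *\<^sub>R g x) has_derivative
      (\<lambda>v. 0 + r' v *\<^sub>R g x)) (at x within E)"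
    by (rule has_derivative_add)
  then show ?thesis by (simp add: algebra_simps)
qed

text \<open>
  From \<open>B y v - B z v = - B z (A y - A z) (B y v)\<close> one gets
  \<open>\<parallel>B y v - B z v\<parallel> \<le> K N(y) (\<parallel>B z v\<parallel> + \<parallel>B y v - B z v\<parallel>)\<close>, where \<open>K\<close> bounds \<open>B z\<close> and \<open>N(y) \<rightarrow> 0\<close> bounds
  \<open>A y - A z\<close> on \<open>F\<close>.  Once \<open>K N(y) \<le> 1/2\<close> the last term is absorbed on the left.
\<close>

lemma continuous_on_inverse_linear_family:
  fixes A B :: "'e::euclidean_space \<Rightarrow> 'f::euclidean_space \<Rightarrow> 'f"
  assumes F: "subspace F"
    and linA: "\<And>y. y \<in> S \<Longrightarrow> linear (A y)" and linB: "\<And>y. y \<in> S \<Longrightarrow> linear (B y)"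
    and AF: "\<And>y v. y \<in> S \<Longrightarrow> v \<in> F \<Longrightarrow> A y v \<in> F" and BF: "\<And>y v. y \<in> S \<Longrightarrow> v \<in> F \<Longrightarrow> B y v \<in> F"
    and AB: "\<And>y v. y \<in> S \<Longrightarrow> v \<in> F \<Longrightarrow> A y (B y v) = v"
    and BA: "\<And>y v. y \<in> S \<Longrightarrow> v \<in> F \<Longrightarrow> B y (A y v) = v"
    and cont: "\<And>v. v \<in> F \<Longrightarrow> continuous_on S (\<lambda>y. A y v)" and v: "v \<in> F"
  shows "continuous_on S (\<lambda>y. B y v)"
  unfolding continuous_on_def
proof
  fix z assume z: "z \<in> S"
  define N where "N y = (\<Sum>b\<in>parseval_frame F. norm b * norm (A y b - A z b))" for y
  have N0: "N y \<ge> 0" for y unfolding N_def by (intro sum_nonneg) simp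
  have A_bound: "norm (A y x - A z x) \<le> N y * norm x" if y: "y \<in> S" and x: "x \<in> F" for x y
  proof -
    have "A y x - A z x = (\<Sum>b\<in>parseval_frame F. (x \<bullet> b) *\<^sub>R (A y b - A z b))"
      using linear_expand_frame[OF F linA[OF y] x] linear_expand_frame[OF F linA[OF z] x]
      by (simp add: sum_subtractf algebra_simps)
    also have "norm \<dots> \<le> (\<Sum>b\<in>parseval_frame F. norm x * norm b * norm (A y b - A z b))"
      by (intro sum_norm_le) (auto intro!: mult_right_mono Cauchy_Schwarz_ineq2)
    also have "\<dots> = N y * norm x"
      unfolding N_def by (simp add: sum_distrib_right sum_distrib_left algebra_simps)
    finally show ?thesis .
  qed
  obtain K where K: "K > 0" "\<And>x. norm (B z x) \<le> K * norm x"
    using linear_bounded_pos[OF linB[OF z]] by blast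
  have N_lim: "(N \<longlongrightarrow> 0) (at z within S)"
  proof -
    have "((\<lambda>y. A y b) \<longlongrightarrow> A z b) (at z within S)" if "b \<in> parseval_frame F" for b
      using cont[of b] parseval_frame(1)[OF F] that z by (auto simp: continuous_on_def)
    then have "(N \<longlongrightarrow> (\<Sum>b\<in>parseval_frame F. norm b * norm (A z b - A z b))) (at z within S)"
      unfolding N_def by (intro tendsto_intros)
    then show ?thesis by simp
  qed
  have small: "\<forall>\<^sub>F y in at z within S. N y < 1 / (2 * K)"
    using order_tendstoD(2)[OF N_lim, of "1 / (2 * K)"] K by simp
  have in_S: "\<forall>\<^sub>F y in at z within S. y \<in> S"
    by (simp add: eventually_at_filter)
  have "((\<lambda>y. B y v - B z v) \<longlongrightarrow> 0) (at z within S)"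
  proof (rule Lim_null_comparison)
    show "((\<lambda>y. 2 * K * N y * norm (B z v)) \<longlongrightarrow> 0) (at z within S)"
      using tendsto_mult_right_zero[OF tendsto_mult_left_zero[OF N_lim]]
        tendsto_mult[OF tendsto_mult[OF tendsto_const N_lim] tendsto_const, of "2 * K" "norm (B z v)"]
      by simp
    show "\<forall>\<^sub>F y in at z within S. norm (B y v - B z v) \<le> 2 * K * N y * norm (B z v)"
      using small in_S
    proof eventually_elim
      case (elim y)
      then have y: "y \<in> S" by simp
      let ?x = "B y v"
      have x: "?x \<in> F" using BF[OF y v] .
      have "B z (A y ?x - A z ?x) = B z v - ?x"
        using AB[OF y v] BA[OF z x] by (simp add: linear_diff[OF linB[OF z]])
      then have "norm (?x - B z v) \<le> K * (N y * norm ?x)"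
        using K(2)[of "A y ?x - A z ?x"] A_bound[OF y x] K(1)
        by (metis mult_left_mono norm_minus_commute order_less_imp_le order_trans)
      also have "\<dots> \<le> K * (N y * (norm (B z v) + norm (?x - B z v)))"
        using K(1) N0[of y] norm_triangle_ineq[of "B z v" "?x - B z v"]
        by (intro mult_left_mono) auto
      finally have 1: "norm (?x - B z v) \<le> K * N y * norm (B z v) + (K * N y) * norm (?x - B z v)"
        by (simp add: algebra_simps)
      have "K * N y \<le> 1/2" using elim(1) K(1) by (simp add: field_simps)
      then have "(K * N y) * norm (?x - B z v) \<le> 1/2 * norm (?x - B z v)"
        by (rule mult_right_mono) simp
      with 1 show ?case by simp
    qed
  qed
  then show "((\<lambda>y. B y v) \<longlongrightarrow> B z v) (at z within S)"
    by (rule LIM_zero_cancel)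
qed

text \<open>
  Inverting linear maps is a smooth operation.  Differentiating
  \<open>B y v - B z v = - B y (A y w - v)\<close>, with \<open>w = B z v\<close>, gives the classical formula
  \<open>B' = - B A' B\<close>, whose right-hand side involves one derivative of \<open>A\<close> and none of \<open>B\<close>; hence
  the regularity of \<open>B\<close> catches up with that of \<open>A\<close> by induction.
\<close>

lemma Ck_on_inverse_linear_family:
  fixes A B :: "'e::euclidean_space \<Rightarrow> 'f::euclidean_space \<Rightarrow> 'f"
  assumes S: "open_in_subspace E S" and F: "subspace F"
    and linA: "\<And>y. y \<in> S \<Longrightarrow> linear (A y)" and linB: "\<And>y. y \<in> S \<Longrightarrow> linear (B y)"
    and AF: "\<And>y v. y \<in> S \<Longrightarrow> v \<in> F \<Longrightarrow> A y v \<in> F" and BF: "\<And>y v. y \<in> S \<Longrightarrow> v \<in> F \<Longrightarrow> B y v \<in> F"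
    and AB: "\<And>y v. y \<in> S \<Longrightarrow> v \<in> F \<Longrightarrow> A y (B y v) = v"
    and BA: "\<And>y v. y \<in> S \<Longrightarrow> v \<in> F \<Longrightarrow> B y (A y v) = v"
    and "\<And>v. v \<in> F \<Longrightarrow> Ck_on n E S (\<lambda>y. A y v)" and "v \<in> F"
  shows "Ck_on n E S (\<lambda>y. B y v)"
  using assms(9,10)
proof (induction n arbitrary: v)
  case 0
  have "continuous_on S (\<lambda>y. A y v)" if "v \<in> F" for v
    using 0(1)[OF that] by simp
  from continuous_on_inverse_linear_family[of F S A B, OF F linA linB AF BF AB BA this 0(2)]
  show ?case by simp
next
  case (Suc n)
  let ?O = "parseval_frame F"
  have O: "\<And>b. b \<in> ?O \<Longrightarrow> b \<in> F" using parseval_frame(1)[OF F] by auto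
  have B_n: "Ck_on n E S (\<lambda>y. B y v)" if "v \<in> F" for v
    using Suc.IH[OF Ck_on_Suc_imp[OF S Suc.prems(1)] that] .
  define A' where "A' y b = frechet_derivative (\<lambda>y. A y b) (at y within E)" for y b
  have A': "((\<lambda>y. A y b) has_derivative A' y b) (at y within E)" if "b \<in> F" "y \<in> S" for y b
    unfolding A'_def by (rule Ck_on_SucD[OF Suc.prems(1)[OF that(1)] that(2)])
  \<comment> \<open>The derivative of \<open>z \<mapsto> A z w\<close> at \<open>y\<close> in the direction \<open>u\<close>, where \<open>w = B y v\<close>.\<close>
  define D where "D y u = (\<Sum>b\<in>?O. (B y v \<bullet> b) *\<^sub>R A' y b u)" for y u
  show ?case
  proof (rule Ck_on_SucI[OF S])
    fix z assume z: "z \<in> S"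
    let ?w = "B z v"
    have w: "?w \<in> F" using BF[OF z Suc.prems(2)] .
    have "((\<lambda>y. \<Sum>b\<in>?O. (?w \<bullet> b) *\<^sub>R A y b) has_derivative D z) (at z within E)"
      unfolding D_def
      by (intro has_derivative_sum bounded_linear.has_derivative[OF bounded_linear_scaleR_right] A' O z)
    then have "((\<lambda>y. A y ?w) has_derivative D z) (at z within E)"
      by (rule has_derivative_cong_open_in_subspace[OF S z])
        (simp add: linear_expand_frame[OF F linA w, symmetric])
    then have h': "((\<lambda>y. A y ?w - v) has_derivative D z) (at z within E)"
      by (auto intro!: derivative_eq_intros)
    have cont: "continuous (at z within E) (\<lambda>y. B y b)" if "b \<in> ?O" for b
      using Ck_on_continuous_on[OF S B_n[OF O[OF that]]] z
      by (simp add: continuous_on_eq_continuous_within open_in_subspace_at[OF S z])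
    have "((\<lambda>y. ?w - (\<Sum>b\<in>?O. ((A y ?w - v) \<bullet> b) *\<^sub>R B y b)) has_derivative
        (\<lambda>u. 0 - (\<Sum>b\<in>?O. (D z u \<bullet> b) *\<^sub>R B z b))) (at z within E)"
      by (intro has_derivative_diff has_derivative_const has_derivative_sum
          has_derivative_scaleR_zero has_derivative_inner_left h' cont)
        (simp_all add: AB[OF z Suc.prems(2)])
    then show "((\<lambda>y. B y v) has_derivative (\<lambda>u. 0 - (\<Sum>b\<in>?O. (D z u \<bullet> b) *\<^sub>R B z b))) (at z within E)"
    proof (rule has_derivative_cong_open_in_subspace[OF S z])
      fix y assume y: "y \<in> S"
      have "A y ?w - v \<in> F" using AF[OF y w] Suc.prems(2) F by (intro subspace_diff)
      then have "(\<Sum>b\<in>?O. ((A y ?w - v) \<bullet> b) *\<^sub>R B y b) = B y (A y ?w - v)"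
        using linear_expand_frame[OF F linB[OF y]] by metis
      also have "\<dots> = ?w - B y v" using BA[OF y w] by (simp add: linear_diff[OF linB[OF y]])
      finally show "?w - (\<Sum>b\<in>?O. ((A y ?w - v) \<bullet> b) *\<^sub>R B y b) = B y v" by simp
    qed
  next
    fix u assume u: "u \<in> E"
    have "Ck_on n E S (\<lambda>z. D z u)"
      unfolding D_def
    proof (intro Ck_on_sum[OF S] Ck_on_scaleR[OF S])
      fix b assume b: "b \<in> ?O"
      show "Ck_on n E S (\<lambda>z. B z v \<bullet> b)"
        by (rule Ck_on_bounded_linear[OF S bounded_linear_inner_left B_n[OF Suc.prems(2)]])
      show "Ck_on n E S (\<lambda>z. A' z b u)"
        unfolding A'_def by (rule Ck_on_SucD'[OF Suc.prems(1)[OF O[OF b]] u])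
    qed
    then have "Ck_on n E S (\<lambda>z. \<Sum>b\<in>?O. (D z u \<bullet> b) *\<^sub>R B z b)"
      by (intro Ck_on_sum[OF S] Ck_on_scaleR[OF S] B_n O
          Ck_on_bounded_linear[OF S bounded_linear_inner_left])
    from Ck_on_bounded_linear[OF S bounded_linear_minus[OF bounded_linear_ident] this]
    show "Ck_on n E S (\<lambda>z. 0 - (\<Sum>b\<in>?O. (D z u \<bullet> b) *\<^sub>R B z b))" by simp
  qed
qed

text \<open>
  The inverse function theorem inside a subspace.  Letting the map act on the component in \<open>E\<close> and
  as the identity on the orthogonal complement gives a map of the whole space, to which the usual
  theorem applies, and whose inverse preserves \<open>E\<close>.  The inverse \<open>g\<close> is then as smooth as the map:
  its derivative at \<open>y\<close> inverts the derivative of the map at \<open>g y\<close>, so each derivative of \<open>g\<close> gained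
  gives the next one.
\<close>

lemma smooth_local_inverse:
  fixes \<phi> :: "'e::euclidean_space \<Rightarrow> 'e"
  assumes W: "open_in_subspace E W" and x0: "x0 \<in> W" and sm: "smooth_on E W \<phi>"
    and im: "\<phi> ` W \<subseteq> E"
    and id: "\<And>v. v \<in> E \<Longrightarrow> frechet_derivative \<phi> (at x0 within E) v = v"
  obtains W' V \<psi> where "openin (top_of_set E) W'" "x0 \<in> W'" "W' \<subseteq> W" "openin (top_of_set E) V"
    "homeomorphism W' V \<phi> \<psi>" "smooth_on E V \<psi>"
proof -
  have E: "subspace E" using W by simp
  let ?p = "subspace_projection E"
  have p: "bounded_linear ?p" "\<And>y. ?p y \<in> E" "\<And>y. y \<in> E \<Longrightarrow> ?p y = y"
    using subspace_projection[OF E] by auto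
  have pp: "?p (?p y) = ?p y" for y using p by simp
  obtain T where T: "open T" "W = E \<inter> T" using W by (auto simp: openin_open)
  define U where "U = ?p -` T"
  have cont_p: "continuous_on A ?p" for A by (rule linear_continuous_on[OF p(1)])
  have U: "open U" unfolding U_def by (rule open_vimage[OF T(1) cont_p])
  have pU: "?p x \<in> W" if "x \<in> U" for x using that T p(2) by (auto simp: U_def)
  have UE: "U \<inter> E = W" using T p(3) by (auto simp: U_def)
  let ?D = "\<lambda>x. frechet_derivative \<phi> (at x within E)"
  have C1: "Ck_on (Suc 0) E W \<phi>" using sm by (simp add: smooth_on_def)
  have D: "(\<phi> has_derivative ?D x) (at x within E)" if "x \<in> W" for x
    by (rule Ck_on_SucD[OF C1 that])
  have DE: "?D x v \<in> E" if "x \<in> W" "v \<in> E" for x v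
    by (rule derivative_in_subspace[OF W that(1) E im D[OF that(1)] that(2)])
  \<comment> \<open>The extension to the whole space, with its derivative as a bounded linear map.\<close>
  define f where "f x = \<phi> (?p x) + (x - ?p x)" for x
  define f' where "f' x = Blinfun (\<lambda>v. ?D (?p x) (?p v) + (v - ?p v))" for x
  have bl: "bounded_linear (\<lambda>v. ?D (?p x) (?p v) + (v - ?p v))" if "x \<in> U" for x
    by (intro bounded_linear_add bounded_linear_sub bounded_linear_ident p(1)
        bounded_linear_compose[OF has_derivative_bounded_linear[OF D[OF pU[OF that]]] p(1)])
  have f'_apply: "blinfun_apply (f' x) v = ?D (?p x) (?p v) + (v - ?p v)" if "x \<in> U" for x v
    unfolding f'_def using bounded_linear_Blinfun_apply[OF bl[OF that]] by simp
  have derf: "(f has_derivative blinfun_apply (f' x)) (at x)" if x: "x \<in> U" for x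
  proof -
    have "(?p has_derivative ?p) (at x)" by (rule bounded_linear.has_derivative[OF p(1) has_derivative_ident])
    moreover have "(\<phi> has_derivative ?D (?p x)) (at (?p x) within range ?p)"
      by (rule has_derivative_subset[OF D[OF pU[OF x]]]) (use p in auto)
    ultimately have 1: "(\<phi> \<circ> ?p has_derivative ?D (?p x) \<circ> ?p) (at x)"
      by (rule diff_chain_within)
    have "(f has_derivative (\<lambda>v. (?D (?p x) \<circ> ?p) v + (v - ?p v))) (at x)"
      unfolding f_def using 1
      by (intro has_derivative_add has_derivative_diff has_derivative_ident
          bounded_linear.has_derivative[OF p(1)]) (simp add: o_def)
    then show ?thesis using f'_apply[OF x] by (metis (no_types, lifting) ext comp_apply)
  qed
  have contf: "continuous_on U f'"
  proof (rule continuous_on_blinfun_componentwise)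
    fix b :: 'e
    have "continuous_on W (\<lambda>x. ?D x (?p b))"
      using C1 p(2) by simp
    then have "continuous_on U (\<lambda>x. ?D (?p x) (?p b))"
      by (rule continuous_on_compose2[OF _ cont_p]) (use pU in auto)
    then have "continuous_on U (\<lambda>x. ?D (?p x) (?p b) + (b - ?p b))"
      by (intro continuous_intros)
    then show "continuous_on U (\<lambda>x. blinfun_apply (f' x) b)"
      by (simp add: f'_apply cong: continuous_on_cong)
  qed
  have x0U: "x0 \<in> U" using UE x0 by auto
  have x0E: "?p x0 = x0" using UE x0 p(3) by auto
  have inv: "id_blinfun o\<^sub>L f' x0 = id_blinfun"
    by (rule blinfun_eqI) (simp add: f'_apply[OF x0U] x0E id p(2))
  obtain U' V g g' where U': "open U'" "U' \<subseteq> U" "x0 \<in> U'" and V: "open V"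
    and hom: "homeomorphism U' V f g"
    and g': "\<And>y. y \<in> V \<Longrightarrow> (g has_derivative (g' y)) (at y)"
      "\<And>y. y \<in> V \<Longrightarrow> g' y = inv (blinfun_apply (f'(g y)))"
      "\<And>y. y \<in> V \<Longrightarrow> bij (blinfun_apply (f'(g y)))"
    using inverse_function_theorem[OF U derf contf x0U inv] by metis
  have f_E: "f x = \<phi> x" if "x \<in> E" for x using p(3)[OF that] by (simp add: f_def)
  \<comment> \<open>\<open>f\<close> does not change the component orthogonal to \<open>E\<close>, so neither does its inverse.\<close>
  have gE: "g y \<in> E" if y: "y \<in> V" "y \<in> E" for y
  proof -
    have gU: "g y \<in> U" and fg: "f (g y) = y"
      using hom y(1) U'(2) by (auto simp: homeomorphism_def)
    have "\<phi> (?p (g y)) \<in> E" using im pU[OF gU] by auto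
    moreover have "g y - ?p (g y) = y - \<phi> (?p (g y))"
      using fg unfolding f_def by (metis add_diff_cancel_left')
    ultimately have "g y - ?p (g y) \<in> E"
      using subspace_diff[OF E y(2)] by simp
    then show ?thesis using subspace_add[OF E _ p(2)[of "g y"]] by fastforce
  qed
  define W' where "W' = U' \<inter> E"
  define V' where "V' = V \<inter> E"
  have W'W: "W' \<subseteq> W" using UE U'(2) by (auto simp: W'_def)
  have fgW: "\<And>x. x \<in> U' \<Longrightarrow> f x \<in> V \<and> g (f x) = x" "\<And>y. y \<in> V \<Longrightarrow> g y \<in> U' \<and> f (g y) = y"
    using hom by (auto simp: homeomorphism_def)
  have hom': "homeomorphism W' V' \<phi> g"
  proof (rule homeomorphismI)
    show "continuous_on W' \<phi>"
      using Ck_on_continuous_on[OF W C1] W'W continuous_on_subset by blast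
    show "continuous_on V' g"
      using hom by (auto simp: homeomorphism_def V'_def intro: continuous_on_subset)
    show "\<phi> ` W' \<subseteq> V'"
      using fgW(1) f_E im W'W by (fastforce simp: W'_def V'_def)
    show "g ` V' \<subseteq> W'" using fgW(2) gE by (auto simp: W'_def V'_def)
    show "\<And>x. x \<in> W' \<Longrightarrow> g (\<phi> x) = x" using fgW(1) f_E by (metis IntE W'_def)
    show "\<And>y. y \<in> V' \<Longrightarrow> \<phi> (g y) = y" using fgW(2) f_E gE by (metis IntE V'_def)
  qed
  have V'o: "open_in_subspace E V'" using V E by (auto simp: V'_def openin_open)
  have gV': "g y \<in> W'" "g y \<in> W" "g y \<in> U" "?p (g y) = g y" if "y \<in> V'" for y
  proof -
    show "g y \<in> W'" using fgW(2) gE that by (auto simp: W'_def V'_def)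
    then show "g y \<in> W" "g y \<in> U" "?p (g y) = g y"
      using W'W U'(2) p(3) by (auto simp: W'_def)
  qed
  have g_within: "(g has_derivative g' y) (at y within E)" if "y \<in> V'" for y
    using g'(1)[of y] that by (auto simp: V'_def intro: has_derivative_at_withinI)
  have g'_lin: "linear (g' y)" if "y \<in> V'" for y
    using g_within[OF that] by (rule has_derivative_linear)
  have g'E: "g' y v \<in> E" if "y \<in> V'" "v \<in> E" for y v
    by (rule derivative_in_subspace[OF V'o that(1) E _ g_within[OF that(1)] that(2)])
      (use gV' open_in_subspace_mem[OF W] in auto)
  have Dg': "?D (g y) (g' y v) = v" and g'D: "g' y (?D (g y) v) = v"
    if y: "y \<in> V'" and v: "v \<in> E" for y v
  proof -
    have b: "bij (blinfun_apply (f' (g y)))" and gi: "g' y = inv (blinfun_apply (f' (g y)))"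
      using g'(2,3)[of y] y by (auto simp: V'_def)
    have ap: "blinfun_apply (f' (g y)) w = ?D (g y) w" if "w \<in> E" for w
      using f'_apply[OF gV'(3)[OF y]] gV'(4)[OF y] p(3)[OF that] by simp
    show "?D (g y) (g' y v) = v"
      using ap[OF g'E[OF y v]] b gi by (metis bij_inv_eq_iff)
    show "g' y (?D (g y) v) = v"
      using ap[OF v] b gi by (metis bij_inv_eq_iff)
  qed
  \<comment> \<open>Continuity of \<open>g\<close> starts the induction; differentiability is already known.\<close>
  have gn: "Ck_on n E V' g" for n
  proof (induction n)
    case 0
    then show ?case using hom' by (simp add: homeomorphism_def)
  next
    case (Suc n)
    show ?case
    proof (rule Ck_on_SucI[OF V'o g_within])
      fix v assume v: "v \<in> E"
      show "Ck_on n E V' (\<lambda>y. g' y v)"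
      proof (rule Ck_on_inverse_linear_family[where A = "\<lambda>y. ?D (g y)" and B = g',
            OF V'o E _ g'_lin _ g'E Dg' g'D _ v])
        show "linear (?D (g y))" if "y \<in> V'" for y
          using D[OF gV'(2)[OF that]] by (rule has_derivative_linear)
        show "?D (g y) w \<in> E" if "y \<in> V'" "w \<in> E" for y w
          using DE[OF gV'(2)[OF that(1)] that(2)] .
        show "Ck_on n E V' (\<lambda>y. ?D (g y) w)" if w: "w \<in> E" for w
        proof -
          have "Ck_on n E W (\<lambda>x. ?D x w)"
            using sm w by (auto simp: smooth_on_def intro!: Ck_on_SucD')
          from Ck_on_compose[OF V'o W _ Suc this] gV'(2) show ?thesis by (auto simp: o_def)
        qed
      qed
    qed
  qed
  show ?thesis
  proof
    show "openin (top_of_set E) W'" using U'(1) by (auto simp: W'_def openin_open)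
    show "x0 \<in> W'" using U'(3) x0 UE by (auto simp: W'_def)
    show "W' \<subseteq> W" by (rule W'W)
    show "openin (top_of_set E) V'" using V'o by simp
    show "homeomorphism W' V' \<phi> g" by (rule hom')
    show "smooth_on E V' g" using gn by (simp add: smooth_on_def)
  qed
qed

section \<open>Smoothness in charts\<close>

lemma is_chart_cdom: "is_chart T c \<Longrightarrow> openin T (cdom c)"
  and is_chart_subspace: "is_chart T c \<Longrightarrow> subspace (cmodel c)"
  by (simp_all add: is_chart_def)

lemma is_chart_cdom_subset: "is_chart T c \<Longrightarrow> cdom c \<subseteq> topspace T"
  by (simp add: is_chart_def openin_subset)

lemma is_chart_inj: "is_chart T c \<Longrightarrow> inj_on (cmap c) (cdom c)"
  using homeomorphic_imp_injective_map[of "subtopology T (cdom c)" _ "cmap c"] is_chart_cdom_subset[of T c]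
  by (auto simp: is_chart_def Int_absorb1)

lemma cinv_cmap: "is_chart T c \<Longrightarrow> p \<in> cdom c \<Longrightarrow> cinv c (cmap c p) = p"
  unfolding cinv_def by (rule inv_into_f_f[OF is_chart_inj])

lemma is_chart_image_open:
  assumes c: "is_chart T c" and A: "openin T A" "A \<subseteq> cdom c"
  shows "open_in_subspace (cmodel c) (cmap c ` A)"
proof -
  have "openin (subtopology T (cdom c)) A"
    using A by (simp add: openin_open_subtopology is_chart_cdom[OF c])
  then have "openin (top_of_set (cmap c ` cdom c)) (cmap c ` A)"
    using c homeomorphic_imp_open_map unfolding is_chart_def open_map_def by blast
  then show ?thesis
    using c openin_trans unfolding is_chart_def by blast
qed

lemma is_chart_cdom_image_open:
  "is_chart T c \<Longrightarrow> open_in_subspace (cmodel c) (cmap c ` cdom c)"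
  by (simp add: is_chart_def)

lemma is_chart_preimage_open:
  assumes c: "is_chart T c" and U: "openin (top_of_set (cmodel c)) U"
  shows "openin T (cdom c \<inter> cmap c -` U)"
proof -
  let ?I = "cmap c ` cdom c"
  have top: "topspace (subtopology T (cdom c)) = cdom c"
    using is_chart_cdom_subset[OF c] by auto
  have I: "?I \<subseteq> cmodel c" using is_chart_cdom_image_open[OF c] openin_imp_subset by blast
  obtain O' where "open O'" "U = cmodel c \<inter> O'" using U by (auto simp: openin_open)
  then have "openin (top_of_set ?I) (U \<inter> ?I)"
    using I by (auto simp: openin_open)
  moreover have "continuous_map (subtopology T (cdom c)) (top_of_set ?I) (cmap c)"
    using c homeomorphic_imp_continuous_map by (auto simp: is_chart_def)
  ultimately have "openin (subtopology T (cdom c))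
      {x \<in> topspace (subtopology T (cdom c)). cmap c x \<in> U \<inter> ?I}"
    by (rule openin_continuous_map_preimage[rotated])
  then have "openin (subtopology T (cdom c)) {x \<in> cdom c. cmap c x \<in> U \<inter> ?I}"
    unfolding top .
  moreover have "{x \<in> cdom c. cmap c x \<in> U \<inter> ?I} = cdom c \<inter> cmap c -` U" by auto
  ultimately show ?thesis
    using openin_trans_full is_chart_cdom[OF c] by metis
qed

lemma is_chart_preimage_map_open:
  assumes "is_chart T c" "continuous_map T T' f" "openin T' V"
  shows "openin T (cdom c \<inter> f -` V)"
  using openin_continuous_map_preimage_gen[OF assms(2) is_chart_cdom[OF assms(1)] assms(3)]
  by (simp add: vimage_def Int_def)

definition smooth_in_charts ::
  "('a, 'e::euclidean_space) chart \<Rightarrow> ('b, 'f::euclidean_space) chart \<Rightarrow> ('a \<Rightarrow> 'b) \<Rightarrow> bool" where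
  "smooth_in_charts c d f \<longleftrightarrow>
     smooth_on (cmodel c) (cmap c ` (cdom c \<inter> f -` cdom d)) (cmap d \<circ> f \<circ> cinv c)"

lemma compatible_charts_iff:
  "compatible_charts c d \<longleftrightarrow> smooth_in_charts c d id \<and> smooth_in_charts d c id"
  by (simp add: compatible_charts_def smooth_in_charts_def Int_commute)

lemma smooth_map_iff:
  "smooth_map X Y f \<longleftrightarrow> continuous_map (mtop X) (mtop Y) f \<and>
     (\<forall>c\<in>atlas X. \<forall>d\<in>atlas Y. smooth_in_charts c d f)"
  by (simp add: smooth_map_def smooth_in_charts_def)

text \<open>
  Smoothness is a local property, so the middle chart may vary from point to point.  Every
  comparison of atlases below is an instance, with one or both of the maps the identity.
\<close>

lemma smooth_in_charts_compose:
  fixes c :: "('a, 'e::euclidean_space) chart" and e :: "('c, 'g::euclidean_space) chart"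
    and f :: "'a \<Rightarrow> 'b" and g :: "'b \<Rightarrow> 'c"
  assumes c: "is_chart T c" and e: "is_chart T'' e"
    and f: "continuous_map T T' f" and g: "continuous_map T' T'' g"
    and mid: "\<And>p. p \<in> cdom c \<Longrightarrow> g (f p) \<in> cdom e \<Longrightarrow>
      \<exists>d :: ('b, 'f::euclidean_space) chart. is_chart T' d \<and> f p \<in> cdom d \<and> smooth_in_charts c d f \<and> smooth_in_charts d e g"
  shows "smooth_in_charts c e (g \<circ> f)"
  unfolding smooth_in_charts_def
proof (rule smooth_on_local)
  let ?S = "cdom c \<inter> (g \<circ> f) -` cdom e"
  have S: "openin T ?S"
    by (rule is_chart_preimage_map_open[OF c continuous_map_compose[OF f g] is_chart_cdom[OF e]])
  show "open_in_subspace (cmodel c) (cmap c ` ?S)" by (rule is_chart_image_open[OF c S]) auto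
  fix x assume "x \<in> cmap c ` ?S"
  then obtain p where p: "p \<in> cdom c" "g (f p) \<in> cdom e" "x = cmap c p" by auto
  obtain d :: "('b, 'f) chart" where d: "is_chart T' d" "f p \<in> cdom d" "smooth_in_charts c d f" "smooth_in_charts d e g"
    using mid[OF p(1,2)] by auto
  let ?A = "cdom c \<inter> f -` cdom d"
  let ?U = "?S \<inter> ?A"
  let ?V = "cdom d \<inter> g -` cdom e"
  have A: "openin T ?A" by (rule is_chart_preimage_map_open[OF c f is_chart_cdom[OF d(1)]])
  have V: "openin T' ?V" by (rule is_chart_preimage_map_open[OF d(1) g is_chart_cdom[OF e]])
  have A': "open_in_subspace (cmodel c) (cmap c ` ?A)" by (rule is_chart_image_open[OF c A]) auto
  have U': "open_in_subspace (cmodel c) (cmap c ` ?U)"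
    by (rule is_chart_image_open[OF c openin_Int[OF S A]]) auto
  have V': "open_in_subspace (cmodel d) (cmap d ` ?V)" by (rule is_chart_image_open[OF d(1) V]) auto
  have "smooth_on (cmodel c) (cmap c ` ?U) (cmap d \<circ> f \<circ> cinv c)"
    by (rule smooth_on_open_subset[OF A' U']) (use d(3) in \<open>auto simp: smooth_in_charts_def\<close>)
  moreover have "(cmap d \<circ> f \<circ> cinv c) ` cmap c ` ?U \<subseteq> cmap d ` ?V"
    using cinv_cmap[OF c] by auto
  ultimately have "smooth_on (cmodel c) (cmap c ` ?U) ((cmap e \<circ> g \<circ> cinv d) \<circ> (cmap d \<circ> f \<circ> cinv c))"
    using smooth_on_compose[OF U' V'] d(4) unfolding smooth_in_charts_def by blast
  then have "smooth_on (cmodel c) (cmap c ` ?U) (cmap e \<circ> (g \<circ> f) \<circ> cinv c)"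
    by (rule smooth_on_cong[OF U']) (auto simp: cinv_cmap[OF c] cinv_cmap[OF d(1)])
  with U' p d(2) show "\<exists>U. open_in_subspace (cmodel c) U \<and> x \<in> U \<and> U \<subseteq> cmap c ` ?S \<and>
      smooth_on (cmodel c) U (cmap e \<circ> (g \<circ> f) \<circ> cinv c)"
    by (intro exI[of _ "cmap c ` ?U"]) auto
qed

text \<open>
  Smooth manifolds with their dimension forgotten.  In this form the structure passes to products
  and to slices without any dimension count.
\<close>

definition smooth_structure :: "('a, 'e::euclidean_space) manifold \<Rightarrow> bool" where
  "smooth_structure X \<longleftrightarrow>
     (\<forall>c\<in>atlas X. is_chart (mtop X) c) \<and> (\<Union>c\<in>atlas X. cdom c) = points X \<and>
     (\<forall>c\<in>atlas X. \<forall>d\<in>atlas X. smooth_in_charts c d id)"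

lemma smooth_manifold_imp_smooth_structure: "smooth_manifold n X \<Longrightarrow> smooth_structure X"
  by (auto simp: smooth_manifold_def smooth_structure_def compatible_charts_iff)

lemma smooth_structure_chart: "smooth_structure X \<Longrightarrow> c \<in> atlas X \<Longrightarrow> is_chart (mtop X) c"
  by (simp add: smooth_structure_def)

lemma smooth_structure_transition:
  "smooth_structure X \<Longrightarrow> c \<in> atlas X \<Longrightarrow> d \<in> atlas X \<Longrightarrow> smooth_in_charts c d id"
  by (simp add: smooth_structure_def)

lemma smooth_structure_cover:
  "smooth_structure X \<Longrightarrow> p \<in> points X \<Longrightarrow> \<exists>c\<in>atlas X. p \<in> cdom c"
  by (auto simp: smooth_structure_def)

lemma smooth_in_charts_maximal_source:
  fixes X :: "('a, 'e::euclidean_space) manifold"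
  assumes X: "smooth_structure X" and Y: "is_chart (mtop Y) d" and f: "continuous_map (mtop X) (mtop Y) f"
    and sm: "\<And>c. c \<in> atlas X \<Longrightarrow> smooth_in_charts c d f" and c: "c \<in> maximal_atlas X"
  shows "smooth_in_charts c d f"
proof -
  have "smooth_in_charts c d (f \<circ> id)"
  proof (rule smooth_in_charts_compose[OF _ Y _ f])
    show c': "is_chart (mtop X) c" using c by (simp add: maximal_atlas_def)
    fix p assume "p \<in> cdom c"
    then obtain c1 where "c1 \<in> atlas X" "p \<in> cdom c1"
      using smooth_structure_cover[OF X] is_chart_cdom_subset[OF c'] by blast
    then show "\<exists>d' :: ('a, 'e) chart. is_chart (mtop X) d' \<and> id p \<in> cdom d' \<and> smooth_in_charts c d' id \<and> smooth_in_charts d' d f"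
      using smooth_structure_chart[OF X] c sm by (auto simp: maximal_atlas_def compatible_charts_iff)
  qed simp
  then show ?thesis by simp
qed

lemma smooth_in_charts_maximal_target:
  fixes Y :: "('b, 'f::euclidean_space) manifold"
  assumes Y: "smooth_structure Y" and c: "is_chart (mtop X) c" and f: "continuous_map (mtop X) (mtop Y) f"
    and sm: "\<And>d. d \<in> atlas Y \<Longrightarrow> smooth_in_charts c d f" and d: "d \<in> maximal_atlas Y"
  shows "smooth_in_charts c d f"
proof -
  have "smooth_in_charts c d (id \<circ> f)"
  proof (rule smooth_in_charts_compose[OF c _ f])
    show d': "is_chart (mtop Y) d" using d by (simp add: maximal_atlas_def)
    fix p assume "id (f p) \<in> cdom d"
    then obtain d1 where "d1 \<in> atlas Y" "f p \<in> cdom d1"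
      using smooth_structure_cover[OF Y] is_chart_cdom_subset[OF d'] by fastforce
    then show "\<exists>d' :: ('b, 'f) chart. is_chart (mtop Y) d' \<and> f p \<in> cdom d' \<and> smooth_in_charts c d' f \<and> smooth_in_charts d' d id"
      using smooth_structure_chart[OF Y] d sm by (auto simp: maximal_atlas_def compatible_charts_iff)
  qed simp
  then show ?thesis by simp
qed

lemma smooth_in_charts_maximal_transition:
  assumes X: "smooth_structure X" and c: "c \<in> maximal_atlas X" and d: "d \<in> maximal_atlas X"
  shows "smooth_in_charts c d id"
  by (rule smooth_in_charts_maximal_source[OF X _ _ _ c])
    (use d in \<open>auto simp: maximal_atlas_def compatible_charts_iff\<close>)

section \<open>Submanifolds and products\<close>

lemma submanifold_points [simp]: "points (submanifold X S) = points X \<inter> S"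
  by (simp add: submanifold_def)

lemma submanifold_mtop [simp]: "mtop (submanifold X S) = subtopology (mtop X) S"
  by (simp add: submanifold_def)

definition slice_chart :: "('a, 'e::euclidean_space) chart \<Rightarrow> 'a set \<Rightarrow> 'e set \<Rightarrow> ('a, 'e) chart" where
  "slice_chart c S L = \<lparr>cdom = cdom c \<inter> S, cmap = cmap c, cmodel = L\<rparr>"

lemma slice_chart_simps [simp]:
  "cdom (slice_chart c S L) = cdom c \<inter> S" "cmap (slice_chart c S L) = cmap c"
  "cmodel (slice_chart c S L) = L"
  by (simp_all add: slice_chart_def)

definition flattens :: "('a, 'e::euclidean_space) chart \<Rightarrow> 'a set \<Rightarrow> 'e set \<Rightarrow> bool" where
  "flattens c S L \<longleftrightarrow> subspace L \<and> L \<subseteq> cmodel c \<and> cmap c ` (cdom c \<inter> S) = cmap c ` cdom c \<inter> L"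

lemma submanifold_atlas:
  "atlas (submanifold X S) = {slice_chart c S L | c L. c \<in> maximal_atlas X \<and> flattens c S L}"
  by (simp add: submanifold_def slice_chart_def flattens_def)

lemma is_chart_slice:
  assumes c: "is_chart T c" and L: "flattens c S L"
  shows "is_chart (subtopology T S) (slice_chart c S L)"
  unfolding is_chart_def slice_chart_simps
proof (intro conjI)
  show "openin (subtopology T S) (cdom c \<inter> S)"
    using openin_subtopology_Int[OF is_chart_cdom[OF c]] .
  show "subspace L" using L by (simp add: flattens_def)
  have im: "cmap c ` (cdom c \<inter> S) = cmap c ` cdom c \<inter> L" and LE: "L \<subseteq> cmodel c"
    using L by (simp_all add: flattens_def)
  obtain O' where "open O'" "cmap c ` cdom c = cmodel c \<inter> O'"
    using is_chart_cdom_image_open[OF c] by (auto simp: openin_open)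
  then show "openin (top_of_set L) (cmap c ` (cdom c \<inter> S))"
    unfolding im using LE by (auto simp: openin_open)
  have "homeomorphic_map (subtopology (subtopology T (cdom c)) S)
      (subtopology (top_of_set (cmap c ` cdom c)) L) (cmap c)"
    by (rule homeomorphic_map_subtopologies)
      (use c im is_chart_cdom_subset[OF c] in \<open>auto simp: is_chart_def Int_absorb1\<close>)
  then show "homeomorphic_map (subtopology (subtopology T S) (cdom c \<inter> S))
      (top_of_set (cmap c ` (cdom c \<inter> S))) (cmap c)"
    unfolding subtopology_subtopology im[symmetric] by (simp add: Int_ac)
qed

lemma cinv_slice:
  assumes "is_chart T c" "p \<in> cdom c \<inter> S"
  shows "cinv (slice_chart c S L) (cmap c p) = p"
proof -
  have "inj_on (cmap c) (cdom c \<inter> S)" by (rule inj_on_subset[OF is_chart_inj[OF assms(1)]]) auto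
  from inv_into_f_f[OF this assms(2)] show ?thesis by (simp add: cinv_def)
qed

lemma smooth_in_charts_slice_source:
  assumes c: "is_chart T c" and L: "flattens c S L" and d: "is_chart T' d" and f: "continuous_map T T' f"
    and sm: "smooth_in_charts c d f"
  shows "smooth_in_charts (slice_chart c S L) d f"
proof -
  let ?A = "cmap c ` (cdom c \<inter> f -` cdom d)"
  have A: "open_in_subspace (cmodel c) ?A"
    by (rule is_chart_image_open[OF c is_chart_preimage_map_open[OF c f is_chart_cdom[OF d]]]) auto
  have L': "subspace L" "L \<subseteq> cmodel c" using L by (auto simp: flattens_def)
  have im: "cmap c ` (cdom c \<inter> S \<inter> f -` cdom d) = ?A \<inter> L"
  proof (intro equalityI subsetI)
    fix x assume "x \<in> ?A \<inter> L"
    then obtain p where p: "p \<in> cdom c" "f p \<in> cdom d" "x = cmap c p" "x \<in> L" by auto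
    then have "x \<in> cmap c ` (cdom c \<inter> S)" using L by (auto simp: flattens_def)
    then have "p \<in> S" using p inj_onD[OF is_chart_inj[OF c]] by auto
    then show "x \<in> cmap c ` (cdom c \<inter> S \<inter> f -` cdom d)" using p by auto
  qed (use L in \<open>auto simp: flattens_def\<close>)
  obtain O' where "open O'" "?A = cmodel c \<inter> O'" using A by (auto simp: openin_open)
  then have "?A \<inter> L = L \<inter> O'" using L'(2) by blast
  then have AL: "open_in_subspace L (?A \<inter> L)"
    using L'(1) \<open>open O'\<close> by (auto simp: openin_open)
  have "smooth_on L (?A \<inter> L) (cmap d \<circ> f \<circ> cinv c)"
    by (rule smooth_on_restrict[OF A L']) (use sm in \<open>simp add: smooth_in_charts_def\<close>)
  then have "smooth_on L (?A \<inter> L) (cmap d \<circ> f \<circ> cinv (slice_chart c S L))"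
    by (rule smooth_on_cong[OF AL])
      (auto simp: im[symmetric] cinv_cmap[OF c] cinv_slice[OF c])
  then show ?thesis by (simp add: smooth_in_charts_def im)
qed

text \<open>
  A slice chart uses the same coordinates as the chart it comes from, so for a map with values in
  the slice the two coordinate expressions are literally equal.
\<close>

lemma smooth_in_charts_slice_target:
  assumes "f ` cdom c \<subseteq> S" "smooth_in_charts c d f"
  shows "smooth_in_charts c (slice_chart d S L) f"
proof -
  have "cdom c \<inter> f -` (cdom d \<inter> S) = cdom c \<inter> f -` cdom d" using assms(1) by auto
  then show ?thesis using assms(2) by (simp add: smooth_in_charts_def)
qed

text \<open>
  Slice charts are automatically compatible, being restrictions of compatible charts.  What makes
  \<open>S\<close> an embedded submanifold is that they cover it.
\<close>

lemma smooth_structure_submanifold: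
  assumes X: "smooth_structure X"
    and cover: "\<And>p. p \<in> points X \<Longrightarrow> p \<in> S \<Longrightarrow> \<exists>c L. c \<in> maximal_atlas X \<and> p \<in> cdom c \<and> flattens c S L"
  shows "smooth_structure (submanifold X S)"
  unfolding smooth_structure_def
proof (intro conjI ballI)
  have max: "is_chart (mtop X) c" if "c \<in> maximal_atlas X" for c
    using that by (simp add: maximal_atlas_def)
  show "is_chart (mtop (submanifold X S)) c" if "c \<in> atlas (submanifold X S)" for c
    using that is_chart_slice[OF max] by (auto simp: submanifold_atlas)
  then have "cdom c \<subseteq> points (submanifold X S)" if "c \<in> atlas (submanifold X S)" for c
    using that is_chart_cdom_subset by blast
  moreover have "\<exists>c\<in>atlas (submanifold X S). p \<in> cdom c" if p: "p \<in> points (submanifold X S)" for p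
  proof -
    obtain c L where "c \<in> maximal_atlas X" "p \<in> cdom c" "flattens c S L" "p \<in> S"
      using cover[of p] p by auto
    then have "slice_chart c S L \<in> atlas (submanifold X S)" "p \<in> cdom (slice_chart c S L)"
      by (auto simp: submanifold_atlas)
    then show ?thesis by blast
  qed
  ultimately show "(\<Union>c\<in>atlas (submanifold X S). cdom c) = points (submanifold X S)" by blast
  fix c d assume "c \<in> atlas (submanifold X S)" "d \<in> atlas (submanifold X S)"
  then obtain c' L d' L' where c: "c = slice_chart c' S L" "c' \<in> maximal_atlas X" "flattens c' S L"
    and d: "d = slice_chart d' S L'" "d' \<in> maximal_atlas X" by (auto simp: submanifold_atlas)
  have "smooth_in_charts c d' id"
    unfolding c(1)
    by (rule smooth_in_charts_slice_source[OF max[OF c(2)] c(3) max[OF d(2)]])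
      (auto intro: smooth_in_charts_maximal_transition[OF X c(2) d(2)])
  then show "smooth_in_charts c d id"
    unfolding d(1) by (rule smooth_in_charts_slice_target[rotated]) (simp add: c(1))
qed

lemma smooth_map_from_submanifold:
  assumes X: "smooth_structure X" and Y: "smooth_structure Y" and f: "smooth_map X Y f"
  shows "smooth_map (submanifold X S) Y f"
  unfolding smooth_map_iff
proof (intro conjI ballI)
  have cont: "continuous_map (mtop X) (mtop Y) f" using f by (simp add: smooth_map_def)
  then show "continuous_map (mtop (submanifold X S)) (mtop Y) f"
    by (simp add: continuous_map_from_subtopology)
  fix c d assume "c \<in> atlas (submanifold X S)" and d: "d \<in> atlas Y"
  then obtain c' L where c: "c = slice_chart c' S L" "c' \<in> maximal_atlas X" "flattens c' S L"
    by (auto simp: submanifold_atlas)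
  have d': "is_chart (mtop Y) d" using smooth_structure_chart[OF Y d] .
  have "smooth_in_charts c' d f"
    by (rule smooth_in_charts_maximal_source[OF X d' cont _ c(2)])
      (use f d in \<open>simp add: smooth_map_iff\<close>)
  then show "smooth_in_charts c d f"
    unfolding c(1) by (rule smooth_in_charts_slice_source[OF _ c(3) d' cont, rotated])
      (use c(2) in \<open>simp add: maximal_atlas_def\<close>)
qed

lemma smooth_map_into_submanifold:
  assumes X: "smooth_structure X" and Y: "smooth_structure Y" and f: "smooth_map X Y f"
    and S: "f ` points X \<subseteq> S"
  shows "smooth_map X (submanifold Y S) f"
  unfolding smooth_map_iff
proof (intro conjI ballI)
  have cont: "continuous_map (mtop X) (mtop Y) f" using f by (simp add: smooth_map_def)
  then show "continuous_map (mtop X) (mtop (submanifold Y S)) f"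
    using S by (auto simp: continuous_map_in_subtopology)
  fix c d assume c: "c \<in> atlas X" and "d \<in> atlas (submanifold Y S)"
  then obtain d' L where d: "d = slice_chart d' S L" "d' \<in> maximal_atlas Y"
    by (auto simp: submanifold_atlas)
  have c': "is_chart (mtop X) c" using smooth_structure_chart[OF X c] .
  have "smooth_in_charts c d' f"
    by (rule smooth_in_charts_maximal_target[OF Y c' cont _ d(2)])
      (use f c in \<open>simp add: smooth_map_iff\<close>)
  then show "smooth_in_charts c d f"
    unfolding d(1) by (rule smooth_in_charts_slice_target[rotated])
      (use S is_chart_cdom_subset[OF c'] in auto)
qed

lemma prod_manifold_mtop [simp]: "mtop (prod_manifold X Y) = prod_topology (mtop X) (mtop Y)"
  by (simp add: prod_manifold_def)

lemma prod_manifold_atlas: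
  "atlas (prod_manifold X Y) = {prod_chart c d | c d. c \<in> atlas X \<and> d \<in> atlas Y}"
  by (simp add: prod_manifold_def)

lemma prod_chart_simps [simp]:
  "cdom (prod_chart c d) = cdom c \<times> cdom d" "cmap (prod_chart c d) = map_prod (cmap c) (cmap d)"
  "cmodel (prod_chart c d) = cmodel c \<times> cmodel d"
  by (simp_all add: prod_chart_def)

lemma map_prod_image_Times: "map_prod f g ` (A \<times> B) = f ` A \<times> g ` B"
  by auto

lemma prod_topology_top_of_set:
  fixes A :: "'a::topological_space set" and B :: "'b::topological_space set"
  shows "prod_topology (top_of_set A) (top_of_set B) = top_of_set (A \<times> B)"
proof -
  have "prod_topology euclidean euclidean = (euclidean :: ('a \<times> 'b) topology)"
    unfolding topology_eq openin_prod_topology_alt open_openin[symmetric] open_prod_def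
    by (auto, meson mem_Sigma_iff)
  then show ?thesis by (metis subtopology_Times)
qed

lemma is_chart_prod:
  assumes c: "is_chart T c" and d: "is_chart T' d"
  shows "is_chart (prod_topology T T') (prod_chart c d)"
  unfolding is_chart_def prod_chart_simps
proof (intro conjI)
  show "openin (prod_topology T T') (cdom c \<times> cdom d)"
    using c d by (simp add: openin_prod_Times_iff is_chart_cdom)
  show "subspace (cmodel c \<times> cmodel d)"
    using c d by (simp add: subspace_Times is_chart_subspace)
  show "openin (top_of_set (cmodel c \<times> cmodel d)) (map_prod (cmap c) (cmap d) ` (cdom c \<times> cdom d))"
    unfolding map_prod_image_Times using c d by (intro openin_Times) (auto simp: is_chart_def)
  obtain f' g' where "homeomorphic_maps (subtopology T (cdom c)) (top_of_set (cmap c ` cdom c)) (cmap c) f'"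
    "homeomorphic_maps (subtopology T' (cdom d)) (top_of_set (cmap d ` cdom d)) (cmap d) g'"
    using c d unfolding is_chart_def homeomorphic_map_maps by blast
  then have "homeomorphic_maps
      (prod_topology (subtopology T (cdom c)) (subtopology T' (cdom d)))
      (prod_topology (top_of_set (cmap c ` cdom c)) (top_of_set (cmap d ` cdom d)))
      (\<lambda>(x, y). (cmap c x, cmap d y)) (\<lambda>(x, y). (f' x, g' y))"
    unfolding homeomorphic_maps_prod by blast
  then have "homeomorphic_map
      (prod_topology (subtopology T (cdom c)) (subtopology T' (cdom d)))
      (prod_topology (top_of_set (cmap c ` cdom c)) (top_of_set (cmap d ` cdom d)))
      (map_prod (cmap c) (cmap d))"
    unfolding homeomorphic_map_maps map_prod_def by blast
  then show "homeomorphic_map (subtopology (prod_topology T T') (cdom c \<times> cdom d))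
      (top_of_set (map_prod (cmap c) (cmap d) ` (cdom c \<times> cdom d))) (map_prod (cmap c) (cmap d))"
    unfolding map_prod_image_Times prod_topology_top_of_set subtopology_Times .
qed

lemma cinv_prod:
  assumes "is_chart T c" "is_chart T' d" "p \<in> cdom c" "q \<in> cdom d"
  shows "cinv (prod_chart c d) (cmap c p, cmap d q) = (p, q)"
  using cinv_cmap[OF is_chart_prod[OF assms(1,2)], of "(p, q)"] assms(3,4) by simp

lemma smooth_in_charts_fst:
  assumes c: "is_chart T c" and c2: "is_chart T' c2" and d: "is_chart T'' d"
    and f: "continuous_map T T'' f" and sm: "smooth_in_charts c d f"
  shows "smooth_in_charts (prod_chart c c2) d (f \<circ> fst)"
proof -
  let ?A = "cmap c ` (cdom c \<inter> f -` cdom d)" and ?B = "cmap c2 ` cdom c2"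
  have A: "open_in_subspace (cmodel c) ?A"
    by (rule is_chart_image_open[OF c is_chart_preimage_map_open[OF c f is_chart_cdom[OF d]]]) auto
  have AB: "open_in_subspace (cmodel c \<times> cmodel c2) (?A \<times> ?B)"
    by (rule open_in_subspace_Times[OF A is_chart_cdom_image_open[OF c2]])
  have im: "map_prod (cmap c) (cmap c2) ` ((cdom c \<times> cdom c2) \<inter> (f \<circ> fst) -` cdom d) = ?A \<times> ?B"
    by force
  have "smooth_on (cmodel c \<times> cmodel c2) (?A \<times> ?B) ((cmap d \<circ> f \<circ> cinv c) \<circ> fst)"
    by (rule smooth_on_compose[OF AB A _ smooth_on_bounded_linear[OF AB bounded_linear_fst smooth_on_id[OF AB]]])
      (use sm in \<open>auto simp: smooth_in_charts_def\<close>)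
  then have "smooth_on (cmodel c \<times> cmodel c2) (?A \<times> ?B) (cmap d \<circ> (f \<circ> fst) \<circ> cinv (prod_chart c c2))"
    by (rule smooth_on_cong[OF AB]) (auto simp: cinv_cmap[OF c] cinv_prod[OF c c2])
  then show ?thesis by (simp add: smooth_in_charts_def im)
qed

lemma smooth_in_charts_snd:
  assumes c: "is_chart T c" and c2: "is_chart T' c2" and d: "is_chart T'' d"
    and f: "continuous_map T' T'' f" and sm: "smooth_in_charts c2 d f"
  shows "smooth_in_charts (prod_chart c c2) d (f \<circ> snd)"
proof -
  let ?A = "cmap c ` cdom c" and ?B = "cmap c2 ` (cdom c2 \<inter> f -` cdom d)"
  have B: "open_in_subspace (cmodel c2) ?B"
    by (rule is_chart_image_open[OF c2 is_chart_preimage_map_open[OF c2 f is_chart_cdom[OF d]]]) auto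
  have AB: "open_in_subspace (cmodel c \<times> cmodel c2) (?A \<times> ?B)"
    by (rule open_in_subspace_Times[OF is_chart_cdom_image_open[OF c] B])
  have im: "map_prod (cmap c) (cmap c2) ` ((cdom c \<times> cdom c2) \<inter> (f \<circ> snd) -` cdom d) = ?A \<times> ?B"
    by force
  have "smooth_on (cmodel c \<times> cmodel c2) (?A \<times> ?B) ((cmap d \<circ> f \<circ> cinv c2) \<circ> snd)"
    by (rule smooth_on_compose[OF AB B _ smooth_on_bounded_linear[OF AB bounded_linear_snd smooth_on_id[OF AB]]])
      (use sm in \<open>auto simp: smooth_in_charts_def\<close>)
  then have "smooth_on (cmodel c \<times> cmodel c2) (?A \<times> ?B) (cmap d \<circ> (f \<circ> snd) \<circ> cinv (prod_chart c c2))"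
    by (rule smooth_on_cong[OF AB]) (auto simp: cinv_cmap[OF c2] cinv_prod[OF c c2])
  then show ?thesis by (simp add: smooth_in_charts_def im)
qed

lemma smooth_in_charts_into_prod:
  assumes c: "is_chart T c" and d1: "is_chart T1 d1" and d2: "is_chart T2 d2"
    and f: "continuous_map T (prod_topology T1 T2) f"
    and sm: "smooth_in_charts c d1 (fst \<circ> f)" "smooth_in_charts c d2 (snd \<circ> f)"
  shows "smooth_in_charts c (prod_chart d1 d2) f"
proof -
  let ?S = "cdom c \<inter> f -` (cdom d1 \<times> cdom d2)"
  have f1: "continuous_map T T1 (fst \<circ> f)" and f2: "continuous_map T T2 (snd \<circ> f)"
    using f by (simp_all add: continuous_map_pairwise)
  have S: "open_in_subspace (cmodel c) (cmap c ` ?S)"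
    using is_chart_preimage_map_open[OF c f is_chart_cdom[OF is_chart_prod[OF d1 d2]]]
    by (intro is_chart_image_open[OF c]) auto
  have S1: "open_in_subspace (cmodel c) (cmap c ` (cdom c \<inter> (fst \<circ> f) -` cdom d1))"
    by (rule is_chart_image_open[OF c is_chart_preimage_map_open[OF c f1 is_chart_cdom[OF d1]]]) auto
  have S2: "open_in_subspace (cmodel c) (cmap c ` (cdom c \<inter> (snd \<circ> f) -` cdom d2))"
    by (rule is_chart_image_open[OF c is_chart_preimage_map_open[OF c f2 is_chart_cdom[OF d2]]]) auto
  have "smooth_on (cmodel c) (cmap c ` ?S) (cmap d1 \<circ> (fst \<circ> f) \<circ> cinv c)"
    by (rule smooth_on_open_subset[OF S1 S]) (use sm in \<open>auto simp: smooth_in_charts_def\<close>)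
  moreover have "smooth_on (cmodel c) (cmap c ` ?S) (cmap d2 \<circ> (snd \<circ> f) \<circ> cinv c)"
    by (rule smooth_on_open_subset[OF S2 S]) (use sm in \<open>auto simp: smooth_in_charts_def\<close>)
  ultimately have "smooth_on (cmodel c) (cmap c ` ?S)
      (\<lambda>x. ((cmap d1 \<circ> (fst \<circ> f) \<circ> cinv c) x, (cmap d2 \<circ> (snd \<circ> f) \<circ> cinv c) x))"
    by (rule smooth_on_Pair[OF S])
  then have "smooth_on (cmodel c) (cmap c ` ?S) (cmap (prod_chart d1 d2) \<circ> f \<circ> cinv c)"
    by (rule smooth_on_cong[OF S]) (simp add: map_prod_def case_prod_beta)
  then show ?thesis by (simp add: smooth_in_charts_def)
qed

lemma smooth_structure_prod:
  assumes X: "smooth_structure X" and Y: "smooth_structure Y"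
  shows "smooth_structure (prod_manifold X Y)"
  unfolding smooth_structure_def
proof (intro conjI ballI)
  show "is_chart (mtop (prod_manifold X Y)) c" if "c \<in> atlas (prod_manifold X Y)" for c
    using that
    by (auto simp: prod_manifold_atlas
        intro!: is_chart_prod smooth_structure_chart[OF X] smooth_structure_chart[OF Y])
  have "atlas (prod_manifold X Y) = (\<lambda>(c, d). prod_chart c d) ` (atlas X \<times> atlas Y)"
    by (auto simp: prod_manifold_atlas)
  then have "(\<Union>c\<in>atlas (prod_manifold X Y). cdom c) = (\<Union>c\<in>atlas X. cdom c) \<times> (\<Union>d\<in>atlas Y. cdom d)"
    by auto
  then show "(\<Union>c\<in>atlas (prod_manifold X Y). cdom c) = points (prod_manifold X Y)"
    using X Y by (simp add: smooth_structure_def)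
  fix c d assume "c \<in> atlas (prod_manifold X Y)" "d \<in> atlas (prod_manifold X Y)"
  then obtain c1 c2 d1 d2 where c: "c = prod_chart c1 c2" "c1 \<in> atlas X" "c2 \<in> atlas Y"
    and d: "d = prod_chart d1 d2" "d1 \<in> atlas X" "d2 \<in> atlas Y"
    by (auto simp: prod_manifold_atlas)
  note ch = smooth_structure_chart[OF X c(2)] smooth_structure_chart[OF Y c(3)]
    smooth_structure_chart[OF X d(2)] smooth_structure_chart[OF Y d(3)]
  show "smooth_in_charts c d id"
    unfolding c(1) d(1)
    using smooth_in_charts_fst[OF ch(1,2,3) continuous_map_id smooth_structure_transition[OF X c(2) d(2)]]
      smooth_in_charts_snd[OF ch(1,2,4) continuous_map_id smooth_structure_transition[OF Y c(3) d(3)]]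
    by (intro smooth_in_charts_into_prod[OF is_chart_prod[OF ch(1,2)] ch(3,4)]) auto
qed

lemma smooth_map_fst:
  assumes X: "smooth_structure X" and Y: "smooth_structure Y"
  shows "smooth_map (prod_manifold X Y) X fst"
  unfolding smooth_map_iff
  using smooth_in_charts_fst[OF smooth_structure_chart[OF X] smooth_structure_chart[OF Y]
      smooth_structure_chart[OF X] continuous_map_id smooth_structure_transition[OF X]]
  by (auto simp: prod_manifold_atlas continuous_map_fst)

lemma smooth_map_snd:
  assumes X: "smooth_structure X" and Y: "smooth_structure Y"
  shows "smooth_map (prod_manifold X Y) Y snd"
  unfolding smooth_map_iff
  using smooth_in_charts_snd[OF smooth_structure_chart[OF X] smooth_structure_chart[OF Y]
      smooth_structure_chart[OF Y] continuous_map_id smooth_structure_transition[OF Y]]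
  by (auto simp: prod_manifold_atlas continuous_map_snd)

lemma smooth_map_Pair:
  assumes X: "smooth_structure X" and Y: "smooth_structure Y" and Z: "smooth_structure Z"
    and f: "smooth_map X Y f" and g: "smooth_map X Z g"
  shows "smooth_map X (prod_manifold Y Z) (\<lambda>x. (f x, g x))"
  unfolding smooth_map_iff
proof (intro conjI ballI)
  show cont: "continuous_map (mtop X) (mtop (prod_manifold Y Z)) (\<lambda>x. (f x, g x))"
    using f g by (simp add: smooth_map_def continuous_map_paired)
  fix c d assume c: "c \<in> atlas X" and "d \<in> atlas (prod_manifold Y Z)"
  then obtain d1 d2 where d: "d = prod_chart d1 d2" "d1 \<in> atlas Y" "d2 \<in> atlas Z"
    by (auto simp: prod_manifold_atlas)
  show "smooth_in_charts c d (\<lambda>x. (f x, g x))"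
    unfolding d(1)
    by (rule smooth_in_charts_into_prod[OF smooth_structure_chart[OF X c]
          smooth_structure_chart[OF Y d(2)] smooth_structure_chart[OF Z d(3)]])
      (use cont f g c d in \<open>auto simp: smooth_map_iff o_def\<close>)
qed

section \<open>Tangent maps\<close>

definition coord_derivative ::
  "('a, 'e::euclidean_space) chart \<Rightarrow> ('b, 'f::euclidean_space) chart \<Rightarrow> ('a \<Rightarrow> 'b) \<Rightarrow> 'a \<Rightarrow> 'e \<Rightarrow> 'f" where
  "coord_derivative c d f p = frechet_derivative (cmap d \<circ> f \<circ> cinv c) (at (cmap c p) within cmodel c)"

lemma coord_change_eq: "coord_change p c d = coord_derivative c d id p"
  by (simp add: coord_change_def coord_derivative_def)

lemma smooth_in_charts_domain_open:
  assumes "is_chart T c" "is_chart T' d" "continuous_map T T' f"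
  shows "open_in_subspace (cmodel c) (cmap c ` (cdom c \<inter> f -` cdom d))"
  by (rule is_chart_image_open[OF assms(1) is_chart_preimage_map_open[OF assms(1,3) is_chart_cdom[OF assms(2)]]]) auto

lemma coord_derivative:
  assumes "smooth_in_charts c d f" "p \<in> cdom c" "f p \<in> cdom d"
  shows "(cmap d \<circ> f \<circ> cinv c has_derivative coord_derivative c d f p) (at (cmap c p) within cmodel c)"
  unfolding coord_derivative_def
  by (rule smooth_on_has_derivative[OF assms(1)[unfolded smooth_in_charts_def]]) (use assms in auto)

lemma coord_derivative_linear:
  assumes "smooth_in_charts c d f" "p \<in> cdom c" "f p \<in> cdom d"
  shows "linear (coord_derivative c d f p)"
  using coord_derivative[OF assms] by (rule has_derivative_linear)

lemma coord_derivative_eqI: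
  assumes c: "is_chart T c" and d: "is_chart T' d" and f: "continuous_map T T' f"
    and p: "p \<in> cdom c" "f p \<in> cdom d"
    and F: "(F has_derivative F') (at (cmap c p) within cmodel c)"
    and eq: "\<And>q. q \<in> cdom c \<Longrightarrow> f q \<in> cdom d \<Longrightarrow> F (cmap c q) = cmap d (f q)"
    and v: "v \<in> cmodel c"
  shows "coord_derivative c d f p v = F' v"
proof -
  let ?S = "cmap c ` (cdom c \<inter> f -` cdom d)"
  have S: "open_in_subspace (cmodel c) ?S" by (rule smooth_in_charts_domain_open[OF c d f])
  have pS: "cmap c p \<in> ?S" using p by auto
  have "(cmap d \<circ> f \<circ> cinv c has_derivative F') (at (cmap c p) within cmodel c)"
    by (rule has_derivative_cong_open_in_subspace[OF S pS F]) (auto simp: cinv_cmap[OF c] eq)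
  from frechet_derivative_within_subspace[OF conjunct1[OF S] open_in_subspace_mem[OF S pS] this v]
  show ?thesis unfolding coord_derivative_def .
qed

lemma coord_derivative_in_model:
  assumes c: "is_chart T c" and d: "is_chart T' d" and f: "continuous_map T T' f"
    and sm: "smooth_in_charts c d f" and p: "p \<in> cdom c" "f p \<in> cdom d" and v: "v \<in> cmodel c"
  shows "coord_derivative c d f p v \<in> cmodel d"
proof (rule derivative_in_subspace[OF smooth_in_charts_domain_open[OF c d f] _ is_chart_subspace[OF d] _
        coord_derivative[OF sm p] v])
  show "(cmap d \<circ> f \<circ> cinv c) ` cmap c ` (cdom c \<inter> f -` cdom d) \<subseteq> cmodel d"
    using open_in_subspace_mem[OF is_chart_cdom_image_open[OF d]] by (auto simp: cinv_cmap[OF c])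
qed (use p in auto)

lemma coord_derivative_compose:
  assumes c: "is_chart T c" and d: "is_chart T' d" and e: "is_chart T'' e"
    and f: "continuous_map T T' f" and g: "continuous_map T' T'' g"
    and sm: "smooth_in_charts c d f" "smooth_in_charts d e g"
    and p: "p \<in> cdom c" "f p \<in> cdom d" "g (f p) \<in> cdom e" and v: "v \<in> cmodel c"
  shows "coord_derivative c e (g \<circ> f) p v = coord_derivative d e g (f p) (coord_derivative c d f p v)"
proof -
  let ?F = "cmap d \<circ> f \<circ> cinv c" and ?G = "cmap e \<circ> g \<circ> cinv d"
  let ?S = "cmap c ` (cdom c \<inter> f -` cdom d)"
  have S: "open_in_subspace (cmodel c) ?S" by (rule smooth_in_charts_domain_open[OF c d f])
  have pS: "cmap c p \<in> ?S" using p by auto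
  have Fp: "?F (cmap c p) = cmap d (f p)" using cinv_cmap[OF c p(1)] by simp
  have comp: "(?G \<circ> ?F has_derivative coord_derivative d e g (f p) \<circ> coord_derivative c d f p)
      (at (cmap c p) within cmodel c)"
    by (rule has_derivative_compose_subspace[OF S pS is_chart_cdom_image_open[OF d] _
          coord_derivative[OF sm(1) p(1,2)]])
      (use coord_derivative[OF sm(2) p(2,3)] Fp in \<open>auto simp: cinv_cmap[OF c]\<close>)
  let ?R = "cmap c ` ((cdom c \<inter> f -` cdom d) \<inter> (cdom c \<inter> (g \<circ> f) -` cdom e))"
  have R: "open_in_subspace (cmodel c) ?R"
    by (rule is_chart_image_open[OF c openin_Int[OF
          is_chart_preimage_map_open[OF c f is_chart_cdom[OF d]]
          is_chart_preimage_map_open[OF c continuous_map_compose[OF f g] is_chart_cdom[OF e]]]]) auto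
  have "(cmap e \<circ> (g \<circ> f) \<circ> cinv c has_derivative coord_derivative d e g (f p) \<circ> coord_derivative c d f p)
      (at (cmap c p) within cmodel c)"
    by (rule has_derivative_cong_open_in_subspace[OF R _ comp])
      (use p in \<open>auto simp: cinv_cmap[OF c] cinv_cmap[OF d]\<close>)
  from frechet_derivative_within_subspace[OF conjunct1[OF S] open_in_subspace_mem[OF S pS] this v]
  show ?thesis unfolding coord_derivative_def[of c e] by simp
qed

lemma coord_derivative_id:
  assumes c: "is_chart T c" and p: "p \<in> cdom c" and v: "v \<in> cmodel c"
  shows "coord_derivative c c id p v = v"
  by (rule coord_derivative_eqI[OF c c continuous_map_id p _ has_derivative_ident _ v]) (use p in auto)

lemma coord_derivative_cong:
  assumes c: "is_chart T c" and d: "is_chart T' d" and f: "continuous_map T T' f" and g: "continuous_map T T' g"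
    and sm: "smooth_in_charts c d f" and p: "p \<in> cdom c" "f p \<in> cdom d"
    and eq: "\<And>q. q \<in> topspace T \<Longrightarrow> f q = g q" and v: "v \<in> cmodel c"
  shows "coord_derivative c d g p v = coord_derivative c d f p v"
proof (rule coord_derivative_eqI[OF c d g p(1) _ coord_derivative[OF sm p] _ v])
  have dom: "\<And>q. q \<in> cdom c \<Longrightarrow> f q = g q" using eq is_chart_cdom_subset[OF c] by auto
  show "g p \<in> cdom d" using dom p by metis
  show "\<And>q. q \<in> cdom c \<Longrightarrow> g q \<in> cdom d \<Longrightarrow> (cmap d \<circ> f \<circ> cinv c) (cmap c q) = cmap d (g q)"
    using dom by (simp add: cinv_cmap[OF c])
qed

lemma charts_atD: "c \<in> charts_at X p \<Longrightarrow> c \<in> atlas X \<and> p \<in> cdom c"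
  by (simp add: charts_at_def)

lemma charts_at_nonempty: "smooth_structure X \<Longrightarrow> p \<in> points X \<Longrightarrow> \<exists>c. c \<in> charts_at X p"
  using smooth_structure_cover by (fastforce simp: charts_at_def)

lemma charts_at_is_chart: "smooth_structure X \<Longrightarrow> c \<in> charts_at X p \<Longrightarrow> is_chart (mtop X) c"
  by (simp add: charts_at_def smooth_structure_chart)

lemma coord_change_compose:
  assumes X: "smooth_structure X" and "b \<in> charts_at X p" "c \<in> charts_at X p" "d \<in> charts_at X p" "v \<in> cmodel b"
  shows "coord_change p c d (coord_change p b c v) = coord_change p b d v"
  using assms coord_derivative_compose[of "mtop X" b "mtop X" c "mtop X" d id id p v]
  by (simp add: coord_change_eq charts_at_def smooth_structure_chart smooth_structure_transition)

lemma coord_change_in_model: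
  assumes X: "smooth_structure X" and "c \<in> charts_at X p" "d \<in> charts_at X p" "v \<in> cmodel c"
  shows "coord_change p c d v \<in> cmodel d"
  using assms coord_derivative_in_model[of "mtop X" c "mtop X" d id p v]
  by (simp add: coord_change_eq charts_at_def smooth_structure_chart smooth_structure_transition)

lemma coord_change_same:
  assumes X: "smooth_structure X" and "c \<in> charts_at X p" "v \<in> cmodel c"
  shows "coord_change p c c v = v"
  using assms coord_derivative_id[of "mtop X" c p v]
  by (simp add: coord_change_eq charts_at_def smooth_structure_chart)

lemma tangent_spaceI:
  assumes "\<And>c. c \<in> charts_at X p \<Longrightarrow> v c \<in> cmodel c" "\<And>c. c \<notin> charts_at X p \<Longrightarrow> v c = 0"
    and "\<And>c d. c \<in> charts_at X p \<Longrightarrow> d \<in> charts_at X p \<Longrightarrow> v d = coord_change p c d (v c)"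
  shows "v \<in> tangent_space X p"
  unfolding tangent_space_def by (intro CollectI conjI ballI allI impI assms)

lemma coord_tangent_in_tangent_space:
  assumes X: "smooth_structure X" and c: "c \<in> charts_at X p" and e: "e \<in> cmodel c"
  shows "coord_tangent X c p e \<in> tangent_space X p"
  by (rule tangent_spaceI)
    (simp_all add: coord_tangent_def coord_change_in_model[OF X c _ e] coord_change_compose[OF X c _ _ e])

lemma coord_tangent_coord:
  assumes X: "smooth_structure X" and c: "c \<in> charts_at X p" and e: "e \<in> cmodel c"
  shows "coord_tangent X c p e c = e"
  using coord_change_same[OF X c e] c by (simp add: coord_tangent_def)

lemma tangent_coord_in_model: "v \<in> tangent_space X p \<Longrightarrow> c \<in> charts_at X p \<Longrightarrow> v c \<in> cmodel c"
  unfolding tangent_space_def by blast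

lemma tangent_space_outside: "v \<in> tangent_space X p \<Longrightarrow> c \<notin> charts_at X p \<Longrightarrow> v c = 0"
  unfolding tangent_space_def by blast

lemma tangent_coord_change:
  "v \<in> tangent_space X p \<Longrightarrow> c \<in> charts_at X p \<Longrightarrow> d \<in> charts_at X p \<Longrightarrow> v d = coord_change p c d (v c)"
  unfolding tangent_space_def by blast

text \<open>
  A tangent vector is known from its coordinates in a single chart; equalities between tangent
  vectors and their images are checked that way.
\<close>

lemma tangent_eqI:
  assumes v: "v \<in> tangent_space X p" and w: "w \<in> tangent_space X p"
    and c: "c \<in> charts_at X p" and eq: "v c = w c"
  shows "v = w"
proof
  fix d show "v d = w d"
  proof (cases "d \<in> charts_at X p")
    case True
    show ?thesis
      unfolding tangent_coord_change[OF v c True] tangent_coord_change[OF w c True] eq ..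
  next
    case False
    then show ?thesis by (simp add: tangent_space_outside[OF v] tangent_space_outside[OF w])
  qed
qed

lemma coord_change_linear:
  assumes "smooth_structure X" "c \<in> charts_at X p" "d \<in> charts_at X p"
  shows "linear (coord_change p c d)"
  unfolding coord_change_eq
  by (rule coord_derivative_linear) (use assms in \<open>auto simp: charts_at_def smooth_structure_transition\<close>)

lemma subspace_tangent_space:
  assumes X: "smooth_structure X"
  shows "subspace (tangent_space X p)"
proof (rule subspaceI)
  note lin = linear_0[OF coord_change_linear[OF X]] linear_add[OF coord_change_linear[OF X]]
    linear_cmul[OF coord_change_linear[OF X]]
  have sub: "c \<in> charts_at X p \<Longrightarrow> subspace (cmodel c)" for c
    using is_chart_subspace charts_at_is_chart[OF X] by blast
  show "0 \<in> tangent_space X p"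
    by (rule tangent_spaceI) (simp_all add: lin(1) subspace_0 sub)
  show "v + w \<in> tangent_space X p" if v: "v \<in> tangent_space X p" and w: "w \<in> tangent_space X p" for v w
  proof (rule tangent_spaceI)
    fix c d assume c: "c \<in> charts_at X p" and d: "d \<in> charts_at X p"
    show "(v + w) d = coord_change p c d ((v + w) c)"
      using tangent_coord_change[OF v c d] tangent_coord_change[OF w c d] by (simp add: lin(2)[OF c d])
  qed (simp_all add: tangent_space_outside[OF v] tangent_space_outside[OF w] subspace_add[OF sub]
      tangent_coord_in_model[OF v] tangent_coord_in_model[OF w])
  show "r *\<^sub>R v \<in> tangent_space X p" if v: "v \<in> tangent_space X p" for r v
  proof (rule tangent_spaceI)
    fix c d assume c: "c \<in> charts_at X p" and d: "d \<in> charts_at X p"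
    show "(r *\<^sub>R v) d = coord_change p c d ((r *\<^sub>R v) c)"
      using tangent_coord_change[OF v c d] by (simp add: lin(3)[OF c d] scaleR_fun_def)
  qed (simp_all add: scaleR_fun_def tangent_space_outside[OF v] subspace_mul[OF sub]
      tangent_coord_in_model[OF v])
qed

lemma smooth_map_chartsD:
  assumes "smooth_map X Y f" "c \<in> charts_at X p" "d \<in> charts_at Y q"
  shows "smooth_in_charts c d f" "p \<in> cdom c" "q \<in> cdom d"
  using assms by (auto simp: smooth_map_iff charts_at_def)

lemma smooth_map_continuous: "smooth_map X Y f \<Longrightarrow> continuous_map (mtop X) (mtop Y) f"
  by (simp add: smooth_map_def)

lemma smooth_map_points: "smooth_map X Y f \<Longrightarrow> p \<in> points X \<Longrightarrow> f p \<in> points Y"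
  using continuous_map_image_subset_topspace[OF smooth_map_continuous, of X Y f] by auto

lemma charts_at_points: "smooth_structure X \<Longrightarrow> c \<in> charts_at X p \<Longrightarrow> p \<in> points X"
  using is_chart_cdom_subset[OF charts_at_is_chart, of X c p] charts_atD[of c X p] by auto

text \<open>
  The chain rule for transition maps makes the coordinates of the differential independent of the
  chart chosen in its definition.
\<close>

lemma differential_coord:
  assumes X: "smooth_structure X" and Y: "smooth_structure Y" and f: "smooth_map X Y f"
    and v: "v \<in> tangent_space X p" and c: "c \<in> charts_at X p" and d: "d \<in> charts_at Y (f p)"
  shows "differential X Y f p v d = coord_derivative c d f p (v c)"
proof -
  define b where "b = (SOME c. c \<in> charts_at X p)"
  have b: "b \<in> charts_at X p" unfolding b_def using c by (rule someI)
  have "differential X Y f p v d = coord_derivative b d f p (coord_derivative c b id p (v c))"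
    using d tangent_coord_change[OF v c b]
    by (simp add: differential_def b_def[symmetric] Let_def coord_derivative_def coord_change_eq)
  also have "\<dots> = coord_derivative c d (f \<circ> id) p (v c)"
    using coord_derivative_compose[OF charts_at_is_chart[OF X c] charts_at_is_chart[OF X b]
        charts_at_is_chart[OF Y d] continuous_map_id smooth_map_continuous[OF f], of p "v c"]
      smooth_map_chartsD[OF f b d] smooth_structure_transition[OF X] charts_atD[OF c] charts_atD[OF b]
      tangent_coord_in_model[OF v c] by simp
  finally show ?thesis by simp
qed

lemma differential_outside: "d \<notin> charts_at Y (f p) \<Longrightarrow> differential X Y f p v d = 0"
  by (simp add: differential_def Let_def)

lemma differential_in_tangent_space:
  assumes X: "smooth_structure X" and Y: "smooth_structure Y" and f: "smooth_map X Y f"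
    and p: "p \<in> points X" and v: "v \<in> tangent_space X p"
  shows "differential X Y f p v \<in> tangent_space Y (f p)"
proof -
  obtain c where c: "c \<in> charts_at X p" using charts_at_nonempty[OF X p] by blast
  have D: "differential X Y f p v d = coord_derivative c d f p (v c)" if "d \<in> charts_at Y (f p)" for d
    by (rule differential_coord[OF X Y f v c that])
  have vc: "v c \<in> cmodel c" by (rule tangent_coord_in_model[OF v c])
  have in_model: "coord_derivative c d f p (v c) \<in> cmodel d" if d: "d \<in> charts_at Y (f p)" for d
    by (rule coord_derivative_in_model[OF charts_at_is_chart[OF X c] charts_at_is_chart[OF Y d]
          smooth_map_continuous[OF f] smooth_map_chartsD[OF f c d] vc])
  have change: "coord_derivative c d' f p (v c) = coord_change (f p) d d' (coord_derivative c d f p (v c))"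
    if d: "d \<in> charts_at Y (f p)" and d': "d' \<in> charts_at Y (f p)" for d d'
    using coord_derivative_compose[OF charts_at_is_chart[OF X c] charts_at_is_chart[OF Y d]
        charts_at_is_chart[OF Y d'] smooth_map_continuous[OF f] continuous_map_id, of p "v c"]
      smooth_map_chartsD[OF f c d] smooth_map_chartsD[OF f c d'] smooth_structure_transition[OF Y]
      charts_atD[OF d] charts_atD[OF d'] vc
    by (simp add: coord_change_eq)
  show ?thesis
  proof (rule tangent_spaceI)
    fix d d' assume d: "d \<in> charts_at Y (f p)" and d': "d' \<in> charts_at Y (f p)"
    show "differential X Y f p v d' = coord_change (f p) d d' (differential X Y f p v d)"
      unfolding D[OF d] D[OF d'] by (rule change[OF d d'])
  qed (simp_all add: D in_model differential_outside)
qed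

lemma differential_eqI:
  assumes X: "smooth_structure X" and Y: "smooth_structure Y" and f: "smooth_map X Y f"
    and p: "p \<in> points X" and v: "v \<in> tangent_space X p" and w: "w \<in> tangent_space Y (f p)"
    and eq: "\<And>c d. c \<in> charts_at X p \<Longrightarrow> d \<in> charts_at Y (f p) \<Longrightarrow> w d = coord_derivative c d f p (v c)"
  shows "differential X Y f p v = w"
proof -
  obtain c where c: "c \<in> charts_at X p" using charts_at_nonempty[OF X p] by blast
  obtain d where d: "d \<in> charts_at Y (f p)"
    using charts_at_nonempty[OF Y smooth_map_points[OF f p]] by blast
  show ?thesis
    by (rule tangent_eqI[OF differential_in_tangent_space[OF X Y f p v] w d])
      (simp add: differential_coord[OF X Y f v c d] eq[OF c d])
qed

text \<open>
  The chain rule, stated for a map \<open>h\<close> that only has to agree with \<open>g \<circ> f\<close> on the points of \<open>X\<close>.  The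
  groupoid laws, such as \<open>s (m g h) = s h\<close>, hold for arrows only, and are fed in through this form.
\<close>

lemma differential_compose:
  assumes X: "smooth_structure X" and Y: "smooth_structure Y" and Z: "smooth_structure Z"
    and f: "smooth_map X Y f" and g: "smooth_map Y Z g" and h: "smooth_map X Z h"
    and gf: "\<And>q. q \<in> points X \<Longrightarrow> g (f q) = h q"
    and p: "p \<in> points X" and v: "v \<in> tangent_space X p"
  shows "differential Y Z g (f p) (differential X Y f p v) = differential X Z h p v"
proof (rule sym, rule differential_eqI[OF X Z h p v])
  have fp: "f p \<in> points Y" by (rule smooth_map_points[OF f p])
  have dv: "differential X Y f p v \<in> tangent_space Y (f p)"
    by (rule differential_in_tangent_space[OF X Y f p v])
  show "differential Y Z g (f p) (differential X Y f p v) \<in> tangent_space Z (h p)"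
    using differential_in_tangent_space[OF Y Z g fp dv] gf[OF p] by simp
  fix c e assume c: "c \<in> charts_at X p" and "e \<in> charts_at Z (h p)"
  then have e: "e \<in> charts_at Z (g (f p))" using gf[OF p] by simp
  have e': "e \<in> charts_at Z (h p)" using e gf[OF p] by simp
  obtain d where d: "d \<in> charts_at Y (f p)" using charts_at_nonempty[OF Y fp] by blast
  note ch = charts_at_is_chart[OF X c] charts_at_is_chart[OF Y d] charts_at_is_chart[OF Z e]
  note ct = smooth_map_continuous[OF f] smooth_map_continuous[OF g]
  have vc: "v c \<in> cmodel c" by (rule tangent_coord_in_model[OF v c])
  have "differential Y Z g (f p) (differential X Y f p v) e
      = coord_derivative d e g (f p) (coord_derivative c d f p (v c))"
    by (simp add: differential_coord[OF Y Z g dv d e] differential_coord[OF X Y f v c d])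
  also have "\<dots> = coord_derivative c e (g \<circ> f) p (v c)"
    by (rule coord_derivative_compose[OF ch ct, symmetric])
      (use smooth_map_chartsD[OF f c d] smooth_map_chartsD[OF g d e] vc in auto)
  also have "\<dots> = coord_derivative c e h p (v c)"
    by (rule coord_derivative_cong[OF ch(1,3) smooth_map_continuous[OF h] continuous_map_compose[OF ct]
          smooth_map_chartsD(1,2)[OF h c e'] _ _ vc])
      (use gf charts_atD[OF e'] in auto)
  finally show "differential Y Z g (f p) (differential X Y f p v) e = coord_derivative c e h p (v c)" .
qed

lemma differential_identity:
  assumes X: "smooth_structure X" and Y: "smooth_structure Y"
    and f: "smooth_map X Y f" and g: "smooth_map Y X g"
    and gf: "\<And>q. q \<in> points X \<Longrightarrow> g (f q) = q" and p: "p \<in> points X" and v: "v \<in> tangent_space X p"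
  shows "differential Y X g (f p) (differential X Y f p v) = v"
proof -
  have id: "smooth_map X X id"
    using smooth_structure_transition[OF X] by (auto simp: smooth_map_iff)
  have "differential X X id p v = v"
  proof (rule differential_eqI[OF X X id p v])
    fix c d assume c: "c \<in> charts_at X p" and d: "d \<in> charts_at X (id p)"
    then show "v d = coord_derivative c d id p (v c)"
      using tangent_coord_change[OF v c, of d] by (simp add: coord_change_eq)
  qed (use v in simp)
  then show ?thesis
    using differential_compose[OF X Y X f g id _ p v] gf by simp
qed

lemma differential_coord_tangent:
  assumes X: "smooth_structure X" and Y: "smooth_structure Y" and f: "smooth_map X Y f"
    and c: "c \<in> charts_at X p" and d: "d \<in> charts_at Y (f p)" and e: "e \<in> cmodel c"
  shows "differential X Y f p (coord_tangent X c p e) = coord_tangent Y d (f p) (coord_derivative c d f p e)"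
proof (rule tangent_eqI[OF _ _ d])
  let ?v = "coord_tangent X c p e"
  have v: "?v \<in> tangent_space X p" by (rule coord_tangent_in_tangent_space[OF X c e])
  show "differential X Y f p ?v \<in> tangent_space Y (f p)"
    by (rule differential_in_tangent_space[OF X Y f charts_at_points[OF X c] v])
  have de: "coord_derivative c d f p e \<in> cmodel d"
    by (rule coord_derivative_in_model[OF charts_at_is_chart[OF X c] charts_at_is_chart[OF Y d]
          smooth_map_continuous[OF f] smooth_map_chartsD[OF f c d] e])
  show "coord_tangent Y d (f p) (coord_derivative c d f p e) \<in> tangent_space Y (f p)"
    by (rule coord_tangent_in_tangent_space[OF Y d de])
  show "differential X Y f p ?v d = coord_tangent Y d (f p) (coord_derivative c d f p e) d"
    by (simp add: differential_coord[OF X Y f v c d] coord_tangent_coord[OF X c e] coord_tangent_coord[OF Y d de])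
qed

lemma differential_linear:
  assumes X: "smooth_structure X" and Y: "smooth_structure Y" and f: "smooth_map X Y f" and p: "p \<in> points X"
  shows "linear_map_on (tangent_space X p) (differential X Y f p)"
proof -
  obtain c where c: "c \<in> charts_at X p" using charts_at_nonempty[OF X p] by blast
  obtain d where d: "d \<in> charts_at Y (f p)"
    using charts_at_nonempty[OF Y smooth_map_points[OF f p]] by blast
  note in_TY = differential_in_tangent_space[OF X Y f p]
  note TX = subspace_tangent_space[OF X, of p] and TY = subspace_tangent_space[OF Y, of "f p"]
  have lin: "linear (coord_derivative c d f p)"
    by (rule coord_derivative_linear[OF smooth_map_chartsD[OF f c d]])
  show ?thesis
    unfolding linear_map_on_def
  proof (intro conjI ballI allI)
    fix v w assume v: "v \<in> tangent_space X p" and w: "w \<in> tangent_space X p"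
    have vw: "v + w \<in> tangent_space X p" using subspace_add[OF TX v w] .
    show "differential X Y f p (v + w) = differential X Y f p v + differential X Y f p w"
      by (rule tangent_eqI[OF in_TY[OF vw] subspace_add[OF TY in_TY[OF v] in_TY[OF w]] d])
        (simp add: differential_coord[OF X Y f _ c d] v w vw linear_add[OF lin])
  next
    fix r v assume v: "v \<in> tangent_space X p"
    have rv: "r *\<^sub>R v \<in> tangent_space X p" using subspace_mul[OF TX v] .
    show "differential X Y f p (r *\<^sub>R v) = r *\<^sub>R differential X Y f p v"
      by (rule tangent_eqI[OF in_TY[OF rv] subspace_mul[OF TY in_TY[OF v]] d])
        (use differential_coord[OF X Y f rv c d] differential_coord[OF X Y f v c d]
          linear_cmul[OF lin, of r "v c"] in \<open>simp add: scaleR_fun_def\<close>)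
  qed
qed

section \<open>Regular zero sets and fibre products\<close>

text \<open>
  Straightening a regular zero set.  With a linear right inverse \<open>\<rho>\<close> of \<open>A = DH(x\<^sub>0)\<close>, the map
  \<open>\<Phi> z = z + \<rho> (H z - A z)\<close> has the identity as derivative at \<open>x\<^sub>0\<close>, so it is a change of
  coordinates, and \<open>A (\<Phi> z) = H z\<close>: in the new coordinates the zero set is the kernel of \<open>A\<close>.
\<close>

lemma regular_zero_set_slice:
  fixes X :: "('a, 'e::euclidean_space) manifold" and H :: "'e \<Rightarrow> 'f::euclidean_space"
  assumes X: "smooth_structure X" and c: "c \<in> atlas X" and p: "p \<in> cdom c"
    and U: "open_in_subspace (cmodel c) U" "cmap c p \<in> U" "U \<subseteq> cmap c ` cdom c"
    and H: "smooth_on (cmodel c) U H" and F: "subspace F" "H ` U \<subseteq> F"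
    and zero: "\<And>q. q \<in> cdom c \<Longrightarrow> cmap c q \<in> U \<Longrightarrow> q \<in> S \<longleftrightarrow> H (cmap c q) = 0"
    and surj: "frechet_derivative H (at (cmap c p) within cmodel c) ` cmodel c = F"
  shows "\<exists>c' L. c' \<in> maximal_atlas X \<and> p \<in> cdom c' \<and> flattens c' S L"
proof -
  let ?E = "cmodel c" and ?x = "cmap c p"
  let ?A = "frechet_derivative H (at ?x within ?E)"
  have c': "is_chart (mtop X) c" by (rule smooth_structure_chart[OF X c])
  have E: "subspace ?E" using U by simp
  have HA: "(H has_derivative ?A) (at ?x within ?E)" by (rule smooth_on_has_derivative[OF H U(2)])
  have A: "bounded_linear ?A" using HA by (rule has_derivative_bounded_linear)
  have linA: "linear ?A" using A by (rule bounded_linear.linear)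
  obtain \<rho> where \<rho>: "range \<rho> \<subseteq> ?E" "linear \<rho>" "\<And>v. v \<in> F \<Longrightarrow> ?A (\<rho> v) = v"
    using linear_exists_right_inverse_on[OF linA E] surj by blast
  have \<rho>': "bounded_linear \<rho>" using \<rho>(2) by (simp add: linear_conv_bounded_linear)
  define \<Phi> where "\<Phi> z = z + \<rho> (H z + - ?A z)" for z
  have A\<Phi>: "?A (\<Phi> z) = H z" if z: "z \<in> U" for z
  proof -
    have "?A z \<in> F" using surj open_in_subspace_mem[OF U(1) z] by auto
    then have "H z + - ?A z \<in> F" using F z by (simp add: subspace_diff image_subset_iff)
    then show ?thesis unfolding \<Phi>_def linear_add[OF linA] \<rho>(3)[OF \<open>H z + - ?A z \<in> F\<close>] by simp
  qed
  have sm: "smooth_on ?E U \<Phi>"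
    unfolding \<Phi>_def
    by (intro smooth_on_add[OF U(1)] smooth_on_id[OF U(1)] smooth_on_bounded_linear[OF U(1) \<rho>'] H
        smooth_on_bounded_linear[OF U(1) bounded_linear_minus[OF A]])
  have \<Phi>E: "\<Phi> ` U \<subseteq> ?E"
    unfolding \<Phi>_def using \<rho>(1) open_in_subspace_mem[OF U(1)] by (auto intro!: subspace_add[OF E])
  have "(\<Phi> has_derivative (\<lambda>v. v + \<rho> (?A v + - ?A v))) (at ?x within ?E)"
    unfolding \<Phi>_def
    by (intro has_derivative_add has_derivative_ident bounded_linear.has_derivative[OF \<rho>'] HA
        has_derivative_minus bounded_linear_imp_has_derivative[OF A])
  from frechet_derivative_within_subspace[OF E open_in_subspace_mem[OF U(1,2)] this]
  have \<Phi>_id: "frechet_derivative \<Phi> (at ?x within ?E) v = v" if "v \<in> ?E" for v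
    using linear_0[OF \<rho>(2)] that by simp
  obtain W V \<psi> where W: "openin (top_of_set ?E) W" "?x \<in> W" "W \<subseteq> U" and V: "openin (top_of_set ?E) V"
    and hom: "homeomorphism W V \<Phi> \<psi>" and \<psi>: "smooth_on ?E V \<psi>"
    using smooth_local_inverse[OF U(1,2) sm \<Phi>E \<Phi>_id] by metis
  have inv: "\<And>z. z \<in> W \<Longrightarrow> \<Phi> z \<in> V \<and> \<psi> (\<Phi> z) = z" "\<And>y. y \<in> V \<Longrightarrow> \<psi> y \<in> W \<and> \<Phi> (\<psi> y) = y"
    using hom by (auto simp: homeomorphism_def)
  \<comment> \<open>The straightened chart: \<open>c\<close> near \<open>p\<close>, followed by \<open>\<Phi>\<close>.\<close>
  define b where "b = \<lparr>cdom = cdom c \<inter> cmap c -` W, cmap = \<Phi> \<circ> cmap c, cmodel = ?E\<rparr>"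
  have b: "cdom b = cdom c \<inter> cmap c -` W" "cmap b = \<Phi> \<circ> cmap c" "cmodel b = ?E"
    by (simp_all add: b_def)
  have imW: "cmap c ` (cdom c \<inter> cmap c -` W) = W" using W(3) U(3) by auto
  have imV: "cmap b ` cdom b = V"
    unfolding b image_comp[symmetric] imW using hom by (simp add: homeomorphism_def)
  have b_chart: "is_chart (mtop X) b"
    unfolding is_chart_def imV unfolding b
  proof (intro conjI)
    show "openin (mtop X) (cdom c \<inter> cmap c -` W)" by (rule is_chart_preimage_open[OF c' W(1)])
    have "homeomorphic_map (subtopology (subtopology (mtop X) (cdom c)) (cmap c -` W))
        (subtopology (top_of_set (cmap c ` cdom c)) W) (cmap c)"
      by (rule homeomorphic_map_subtopologies)
        (use c' imW W(3) U(3) is_chart_cdom_subset[OF c'] in \<open>auto simp: is_chart_def Int_absorb1\<close>)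
    moreover have "cmap c ` cdom c \<inter> W = W" using W(3) U(3) by auto
    ultimately have "homeomorphic_map (subtopology (mtop X) (cdom c \<inter> cmap c -` W)) (top_of_set W) (cmap c)"
      by (simp add: subtopology_subtopology)
    moreover have "homeomorphic_map (top_of_set W) (top_of_set V) \<Phi>"
      unfolding homeomorphic_map_maps homeomorphic_maps_def using hom
      by (intro exI[of _ \<psi>]) (auto simp: homeomorphism_def)
    ultimately show "homeomorphic_map (subtopology (mtop X) (cdom c \<inter> cmap c -` W)) (top_of_set V) (\<Phi> \<circ> cmap c)"
      by (rule homeomorphic_map_compose)
  qed (use E V in auto)
  have Wo: "open_in_subspace ?E W" and Vo: "open_in_subspace ?E V" using W V E by auto
  have "smooth_on ?E W \<Phi>" by (rule smooth_on_open_subset[OF U(1) Wo W(3) sm])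
  then have "smooth_on ?E W (cmap b \<circ> id \<circ> cinv c)"
    by (rule smooth_on_cong[OF Wo]) (use W(3) U(3) cinv_cmap[OF c'] in \<open>auto simp: b\<close>)
  then have cb: "smooth_in_charts c b id" by (simp add: smooth_in_charts_def b imW)
  have "smooth_on ?E V (cmap c \<circ> id \<circ> cinv b)"
  proof (rule smooth_on_cong[OF Vo \<psi>])
    fix y assume "y \<in> V"
    then obtain q where q: "q \<in> cdom b" "y = cmap b q" using imV by auto
    then have "cinv b y = q" using cinv_cmap[OF b_chart] by simp
    then show "\<psi> y = (cmap c \<circ> id \<circ> cinv b) y" using q inv(1) by (simp add: b)
  qed
  moreover have "cdom b \<inter> cdom c = cdom b" by (auto simp: b)
  ultimately have bc: "smooth_in_charts b c id" using imV by (simp add: smooth_in_charts_def b(3))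
  have max: "b \<in> maximal_atlas X"
    unfolding maximal_atlas_def compatible_charts_iff
  proof (intro CollectI conjI ballI)
    show "is_chart (mtop X) b" by (rule b_chart)
    fix d assume d: "d \<in> atlas X"
    have d': "is_chart (mtop X) d" by (rule smooth_structure_chart[OF X d])
    have "smooth_in_charts b d (id \<circ> id)"
      by (rule smooth_in_charts_compose[OF b_chart d' continuous_map_id continuous_map_id])
        (use bc c' smooth_structure_transition[OF X c d] in \<open>auto simp: b\<close>)
    then show "smooth_in_charts b d id" by simp
    have "smooth_in_charts d b (id \<circ> id)"
      by (rule smooth_in_charts_compose[OF d' b_chart continuous_map_id continuous_map_id])
        (use cb c' smooth_structure_transition[OF X d c] in \<open>auto simp: b\<close>)
    then show "smooth_in_charts d b id" by simp
  qed
  define L where "L = {v \<in> ?E. ?A v = 0}"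
  have "flattens b S L"
    unfolding flattens_def imV
  proof (intro conjI)
    show "subspace L"
      unfolding L_def using subspace_inter[OF E linear_subspace_kernel[OF linA]]
      by (simp add: Int_def)
    show "L \<subseteq> cmodel b" by (auto simp: L_def b)
    have "q \<in> S \<longleftrightarrow> cmap b q \<in> L" if q: "q \<in> cdom b" for q
    proof -
      have "cmap c q \<in> U" "q \<in> cdom c" using q W(3) by (auto simp: b)
      then show ?thesis
        using zero[of q] A\<Phi>[of "cmap c q"] \<Phi>E by (auto simp: L_def b)
    qed
    then show "cmap b ` (cdom b \<inter> S) = V \<inter> L" using imV by auto
  qed
  then show ?thesis using max p W(2) by (auto simp: b intro!: exI[of _ b])
qed

lemma submersion_coord_surjective:
  assumes X: "smooth_structure X" and Y: "smooth_structure Y" and f: "surjective_submersion X Y f"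
    and c: "c \<in> charts_at X p" and d: "d \<in> charts_at Y (f p)"
  shows "coord_derivative c d f p ` cmodel c = cmodel d"
proof (intro equalityI subsetI)
  have sm: "smooth_map X Y f" and sj: "differential X Y f p ` tangent_space X p = tangent_space Y (f p)"
    using f charts_at_points[OF X c] by (auto simp: surjective_submersion_def)
  fix y assume y: "y \<in> cmodel d"
  have "coord_tangent Y d (f p) y \<in> differential X Y f p ` tangent_space X p"
    unfolding sj by (rule coord_tangent_in_tangent_space[OF Y d y])
  then obtain v where v: "v \<in> tangent_space X p" "coord_tangent Y d (f p) y = differential X Y f p v" by auto
  have "y = coord_derivative c d f p (v c)"
    using coord_tangent_coord[OF Y d y] differential_coord[OF X Y sm v(1) c d] v(2) by simp
  then show "y \<in> coord_derivative c d f p ` cmodel c" using tangent_coord_in_model[OF v(1) c] by auto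
next
  fix y assume "y \<in> coord_derivative c d f p ` cmodel c"
  then show "y \<in> cmodel d"
    using coord_derivative_in_model[OF charts_at_is_chart[OF X c] charts_at_is_chart[OF Y d]]
      smooth_map_chartsD[of X Y f c p d "f p"] f c d smooth_map_continuous[of X Y f]
    by (auto simp: surjective_submersion_def)
qed

text \<open>
  In charts the composable pairs are the zero set of \<open>(x, y) \<mapsto> s x - t y\<close>, whose derivative is
  onto because that of \<open>s\<close> is.
\<close>

lemma smooth_structure_composable:
  fixes G :: "('g, 'e::euclidean_space) manifold" and M :: "('m, 'b::euclidean_space) manifold"
  assumes G: "smooth_structure G" and M: "smooth_structure M"
    and s: "surjective_submersion G M s" and t: "smooth_map G M t"
  shows "smooth_structure (composable_manifold G s t)"
proof (rule smooth_structure_submanifold[OF smooth_structure_prod[OF G G]])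
  let ?GG = "prod_manifold G G" and ?S = "composable (points G) s t"
  have sms: "smooth_map G M s" using s by (simp add: surjective_submersion_def)
  fix p assume "p \<in> points ?GG" "p \<in> ?S"
  then obtain g h where p: "p = (g, h)" and g: "g \<in> points G" and h: "h \<in> points G" and gh: "s g = t h"
    by (auto simp: composable_def)
  obtain c where c: "c \<in> charts_at G g" using charts_at_nonempty[OF G g] by blast
  obtain c2 where c2: "c2 \<in> charts_at G h" using charts_at_nonempty[OF G h] by blast
  obtain d where d: "d \<in> charts_at M (s g)" using charts_at_nonempty[OF M smooth_map_points[OF sms g]] by blast
  have d2: "d \<in> charts_at M (t h)" using d gh by simp
  note ch = charts_at_is_chart[OF G c] charts_at_is_chart[OF G c2] charts_at_is_chart[OF M d]
  note ct = smooth_map_continuous[OF sms] smooth_map_continuous[OF t]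
  note ss = smooth_map_chartsD[OF sms c d] and tt = smooth_map_chartsD[OF t c2 d2]
  let ?c = "prod_chart c c2"
  let ?F = "cmap d \<circ> s \<circ> cinv c" and ?K = "cmap d \<circ> t \<circ> cinv c2"
  let ?A = "cmap c ` (cdom c \<inter> s -` cdom d)" and ?B = "cmap c2 ` (cdom c2 \<inter> t -` cdom d)"
  have A: "open_in_subspace (cmodel c) ?A" by (rule smooth_in_charts_domain_open[OF ch(1,3) ct(1)])
  have B: "open_in_subspace (cmodel c2) ?B" by (rule smooth_in_charts_domain_open[OF ch(2,3) ct(2)])
  have AB: "open_in_subspace (cmodel c \<times> cmodel c2) (?A \<times> ?B)" by (rule open_in_subspace_Times[OF A B])
  define H where "H z = ?F (fst z) + - ?K (snd z)" for z
  have "smooth_on (cmodel c \<times> cmodel c2) (?A \<times> ?B) (?F \<circ> fst)"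
    by (rule smooth_on_compose[OF AB A _ smooth_on_bounded_linear[OF AB bounded_linear_fst smooth_on_id[OF AB]]])
      (use ss in \<open>auto simp: smooth_in_charts_def\<close>)
  moreover have K: "smooth_on (cmodel c \<times> cmodel c2) (?A \<times> ?B) (?K \<circ> snd)"
    by (rule smooth_on_compose[OF AB B _ smooth_on_bounded_linear[OF AB bounded_linear_snd smooth_on_id[OF AB]]])
      (use tt in \<open>auto simp: smooth_in_charts_def\<close>)
  ultimately have H: "smooth_on (cmodel c \<times> cmodel c2) (?A \<times> ?B) H"
    using smooth_on_add[OF AB _ smooth_on_bounded_linear[OF AB bounded_linear_minus[OF bounded_linear_ident] K]]
    unfolding H_def by (simp add: o_def)
  have dim: "cmap d q \<in> cmodel d" if "q \<in> cdom d" for q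
    using open_in_subspace_mem[OF is_chart_cdom_image_open[OF ch(3)]] that by auto
  have sub_d: "subspace (cmodel d)" by (rule is_chart_subspace[OF ch(3)])
  show "\<exists>c' L. c' \<in> maximal_atlas ?GG \<and> p \<in> cdom c' \<and> flattens c' ?S L"
  proof (rule regular_zero_set_slice[OF smooth_structure_prod[OF G G], where c = ?c and F = "cmodel d"
        and H = H and U = "?A \<times> ?B"])
    show "?c \<in> atlas ?GG" using c c2 by (auto simp: prod_manifold_atlas charts_at_def)
    show "p \<in> cdom ?c" using ss tt p by simp
    show "open_in_subspace (cmodel ?c) (?A \<times> ?B)" using AB by simp
    show "cmap ?c p \<in> ?A \<times> ?B" using p ss tt by auto
    show "?A \<times> ?B \<subseteq> cmap ?c ` cdom ?c" by (auto simp: map_prod_image_Times)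
    show "smooth_on (cmodel ?c) (?A \<times> ?B) H" using H by simp
    show "subspace (cmodel d)" by (rule sub_d)
    show "H ` (?A \<times> ?B) \<subseteq> cmodel d"
      using dim by (auto simp: H_def cinv_cmap[OF ch(1)] cinv_cmap[OF ch(2)] subspace_diff[OF sub_d])
    show "q \<in> ?S \<longleftrightarrow> H (cmap ?c q) = 0" if q: "q \<in> cdom ?c" "cmap ?c q \<in> ?A \<times> ?B" for q
    proof -
      obtain x y where xy: "q = (x, y)" "x \<in> cdom c" "y \<in> cdom c2" using q(1) by auto
      have "s x \<in> cdom d" "t y \<in> cdom d"
        using q(2) xy inj_onD[OF is_chart_inj[OF ch(1)]] inj_onD[OF is_chart_inj[OF ch(2)]] by auto
      then have "s x = t y \<longleftrightarrow> cmap d (s x) = cmap d (t y)"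
        using inj_onD[OF is_chart_inj[OF ch(3)]] by auto
      moreover have "x \<in> points G" "y \<in> points G"
        using xy is_chart_cdom_subset[OF ch(1)] is_chart_cdom_subset[OF ch(2)] by auto
      ultimately show ?thesis
        using xy by (simp add: composable_def H_def cinv_cmap[OF ch(1)] cinv_cmap[OF ch(2)])
    qed
    have "(H has_derivative (\<lambda>v. coord_derivative c d s g (fst v) + - coord_derivative c2 d t h (snd v)))
        (at (cmap c g, cmap c2 h) within cmodel c \<times> cmodel c2)"
    proof -
      have in_AB: "(cmap c g, cmap c2 h) \<in> ?A \<times> ?B" using ss tt by auto
      have 1: "(?F \<circ> fst has_derivative coord_derivative c d s g \<circ> fst)
          (at (cmap c g, cmap c2 h) within cmodel c \<times> cmodel c2)"
        by (rule has_derivative_compose_subspace[OF AB in_AB A _ bounded_linear_imp_has_derivative[OF bounded_linear_fst]])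
          (use coord_derivative[OF ss] in auto)
      have 2: "(?K \<circ> snd has_derivative coord_derivative c2 d t h \<circ> snd)
          (at (cmap c g, cmap c2 h) within cmodel c \<times> cmodel c2)"
        by (rule has_derivative_compose_subspace[OF AB in_AB B _ bounded_linear_imp_has_derivative[OF bounded_linear_snd]])
          (use coord_derivative[OF tt] in auto)
      show ?thesis
        using has_derivative_add[OF 1 has_derivative_minus[OF 2]] unfolding H_def by (simp add: o_def)
    qed
    then have DH: "frechet_derivative H (at (cmap ?c p) within cmodel ?c) v
        = coord_derivative c d s g (fst v) + - coord_derivative c2 d t h (snd v)" if "v \<in> cmodel ?c" for v
      using frechet_derivative_within_subspace[OF conjunct1[OF AB], of "(cmap c g, cmap c2 h)"]
        open_in_subspace_mem[OF AB, of "(cmap c g, cmap c2 h)"] that p ss tt by auto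
    have onto: "coord_derivative c d s g ` cmodel c = cmodel d"
      by (rule submersion_coord_surjective[OF G M s c d])
    show "frechet_derivative H (at (cmap ?c p) within cmodel ?c) ` cmodel ?c = cmodel d"
    proof (intro equalityI subsetI)
      fix y assume "y \<in> cmodel d"
      then obtain x where x: "x \<in> cmodel c" "y = coord_derivative c d s g x" using onto by auto
      have 0: "(x, 0) \<in> cmodel ?c" using x is_chart_subspace[OF ch(2)] by (simp add: subspace_0)
      have "frechet_derivative H (at (cmap ?c p) within cmodel ?c) (x, 0) = y"
        unfolding DH[OF 0] using x linear_0[OF coord_derivative_linear[OF tt]] by simp
      then show "y \<in> frechet_derivative H (at (cmap ?c p) within cmodel ?c) ` cmodel ?c" using 0 by blast
    next
      fix y assume "y \<in> frechet_derivative H (at (cmap ?c p) within cmodel ?c) ` cmodel ?c"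
      then obtain v where v: "v \<in> cmodel ?c" "y = frechet_derivative H (at (cmap ?c p) within cmodel ?c) v" by auto
      have "coord_derivative c d s g (fst v) \<in> cmodel d" "coord_derivative c2 d t h (snd v) \<in> cmodel d"
        using v(1) onto coord_derivative_in_model[OF ch(2,3) ct(2) tt] by auto
      then show "y \<in> cmodel d" unfolding v(2) DH[OF v(1)] by (simp add: subspace_diff[OF sub_d])
    qed
  qed
qed

section \<open>Forms and their pullbacks\<close>

lemma linear_map_onD:
  assumes "linear_map_on V L"
  shows "x \<in> V \<Longrightarrow> y \<in> V \<Longrightarrow> L (x + y) = L x + L y" "x \<in> V \<Longrightarrow> L (r *\<^sub>R x) = r *\<^sub>R L x"
  using assms by (simp_all add: linear_map_on_def)

lemma linear_map_on_compose:
  assumes "linear_map_on V f" "f ` V \<subseteq> W" "linear_map_on W g"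
  shows "linear_map_on V (\<lambda>x. g (f x))"
  using assms unfolding linear_map_on_def by (simp add: image_subset_iff)

lemma linear_map_on_sum:
  assumes V: "subspace V" and L: "linear_map_on V L" and B: "\<And>b. b \<in> B \<Longrightarrow> v b \<in> V"
  shows "L (\<Sum>b\<in>B. v b) = (\<Sum>b\<in>B. L (v b))"
proof -
  have L0: "L 0 = 0" using linear_map_onD(2)[OF L subspace_0[OF V], of 0] by simp
  show ?thesis
    using B
  proof (induction B rule: infinite_finite_induct)
    case (insert b B)
    then have "L (v b + (\<Sum>b\<in>B. v b)) = L (v b) + L (\<Sum>b\<in>B. v b)"
      by (intro linear_map_onD(1)[OF L] subspace_sum[OF V]) auto
    then show ?case using insert by simp
  qed (simp_all add: L0)
qed

lemma linear_map_on_expand_frame: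
  assumes V: "subspace V" and L: "linear_map_on V L" and y: "y \<in> V"
  shows "L y = (\<Sum>b\<in>parseval_frame V. (y \<bullet> b) *\<^sub>R L b)"
proof -
  have B: "\<And>b. b \<in> parseval_frame V \<Longrightarrow> b \<in> V" using parseval_frame(1)[OF V] by auto
  have "L y = L (\<Sum>b\<in>parseval_frame V. (y \<bullet> b) *\<^sub>R b)"
    using parseval_frame(3)[OF V y] by simp
  also have "\<dots> = (\<Sum>b\<in>parseval_frame V. L ((y \<bullet> b) *\<^sub>R b))"
    by (rule linear_map_on_sum[OF V L]) (simp add: B subspace_mul[OF V])
  also have "\<dots> = (\<Sum>b\<in>parseval_frame V. (y \<bullet> b) *\<^sub>R L b)"
    by (rule sum.cong) (simp_all add: B linear_map_onD(2)[OF L])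
  finally show ?thesis .
qed

text \<open>
  Moving frames.  A form has smooth coefficients on constant frames; expanding the arguments one
  at a time in a frame of the model space gives smoothness on smoothly varying arguments, which is what
  pulling back along a smooth map requires.
\<close>

lemma smooth_on_multilinear:
  fixes \<beta> :: "'f::euclidean_space \<Rightarrow> 'f list \<Rightarrow> real" and F :: "'e::euclidean_space \<Rightarrow> 'f"
  assumes S: "open_in_subspace E S" and T: "open_in_subspace V T" and F: "smooth_on E S F" "F ` S \<subseteq> T"
    and lin: "\<And>y us ws. y \<in> T \<Longrightarrow> set us \<subseteq> V \<Longrightarrow> set ws \<subseteq> V \<Longrightarrow> length us + length ws + 1 = k \<Longrightarrow>
      linear_map_on V (\<lambda>w. \<beta> y (us @ w # ws))"
    and sm: "\<And>ws. ws \<in> vector_tuples k V \<Longrightarrow> smooth_on V T (\<lambda>y. \<beta> y ws)"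
    and "\<And>h. h \<in> set hs \<Longrightarrow> smooth_on E S h \<and> h ` S \<subseteq> V" "set ws \<subseteq> V" "length hs + length ws = k"
  shows "smooth_on E S (\<lambda>x. \<beta> (F x) (map (\<lambda>h. h x) hs @ ws))"
  using assms(7-9)
proof (induction hs arbitrary: ws rule: rev_induct)
  case Nil
  then have "smooth_on V T (\<lambda>y. \<beta> y ws)" by (intro sm) (simp add: vector_tuples_def)
  from smooth_on_compose[OF S T F(2,1) this] show ?case by (simp add: o_def)
next
  case (snoc h hs)
  have V: "subspace V" using T by simp
  have h: "smooth_on E S h" "\<And>x. x \<in> S \<Longrightarrow> h x \<in> V" using snoc.prems(1)[of h] by auto
  have hs: "\<And>g. g \<in> set hs \<Longrightarrow> smooth_on E S g \<and> g ` S \<subseteq> V" using snoc.prems(1) by auto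
  have "smooth_on E S (\<lambda>x. \<Sum>b\<in>parseval_frame V. (h x \<bullet> b) *\<^sub>R \<beta> (F x) (map (\<lambda>h. h x) hs @ b # ws))"
    unfolding smooth_on_def
  proof (intro allI Ck_on_sum[OF S] Ck_on_scaleR[OF S])
    fix n b assume b: "b \<in> parseval_frame V"
    show "Ck_on n E S (\<lambda>x. h x \<bullet> b)"
      using h(1) by (intro Ck_on_bounded_linear[OF S bounded_linear_inner_left]) (simp add: smooth_on_def)
    have "smooth_on E S (\<lambda>x. \<beta> (F x) (map (\<lambda>h. h x) hs @ b # ws))"
      by (rule snoc.IH[OF hs]) (use snoc.prems b parseval_frame(1)[OF V] in auto)
    then show "Ck_on n E S (\<lambda>x. \<beta> (F x) (map (\<lambda>h. h x) hs @ b # ws))" by (simp add: smooth_on_def)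
  qed
  then show ?case
  proof (rule smooth_on_cong[OF S])
    fix x assume x: "x \<in> S"
    have "linear_map_on V (\<lambda>w. \<beta> (F x) (map (\<lambda>h. h x) hs @ w # ws))"
      by (rule lin) (use F x hs snoc.prems in auto)
    from linear_map_on_expand_frame[OF V this h(2)[OF x]]
    show "(\<Sum>b\<in>parseval_frame V. (h x \<bullet> b) *\<^sub>R \<beta> (F x) (map (\<lambda>h. h x) hs @ b # ws)) =
        \<beta> (F x) (map (\<lambda>h. h x) (hs @ [h]) @ ws)"
      by simp
  qed
qed

lemma alternating_form_linear_slot:
  assumes V: "subspace V" and \<alpha>: "alternating_form k V \<alpha>"
    and us: "set us \<subseteq> V" "set ws \<subseteq> V" "length us + length ws + 1 = k"
  shows "linear_map_on V (\<lambda>w. \<alpha> (us @ w # ws))"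
proof -
  have "us @ 0 # ws \<in> vector_tuples k V" using us subspace_0[OF V] by (auto simp: vector_tuples_def)
  moreover have "length us < k" using us by simp
  ultimately have "linear_map_on V (\<lambda>w. \<alpha> ((us @ 0 # ws)[length us := w]))"
    using \<alpha> unfolding alternating_form_def by blast
  then show ?thesis by simp
qed

lemma linear_map_on_coord_tangent:
  assumes X: "smooth_structure X" and c: "c \<in> charts_at X p"
  shows "linear_map_on (cmodel c) (coord_tangent X c p)"
  using linear_add[OF coord_change_linear[OF X c]] linear_cmul[OF coord_change_linear[OF X c]]
  by (auto simp: linear_map_on_def coord_tangent_def fun_eq_iff scaleR_fun_def)

text \<open>
  The point is smoothness.  In charts, constant vectors \<open>e\<close> are mapped to the vectors
  \<open>Df x e\<close>, which vary smoothly with \<open>x\<close>, so the coefficients of the pullback are values of the form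
  on a moving frame.
\<close>

lemma pullback_in_forms:
  assumes X: "smooth_structure X" and Y: "smooth_structure Y" and f: "smooth_map X Y f"
    and \<omega>: "\<omega> \<in> forms k Y"
  shows "pullback k X Y f \<omega> \<in> forms k X"
  unfolding forms_def
proof (intro CollectI conjI ballI allI impI)
  have alt: "alternating_form k (tangent_space Y q) (\<omega> q)" if "q \<in> points Y" for q
    using \<omega> that by (simp add: forms_def)
  fix p assume p: "p \<in> points X"
  let ?D = "differential X Y f p" and ?TX = "tangent_space X p" and ?TY = "tangent_space Y (f p)"
  have TX: "subspace ?TX" by (rule subspace_tangent_space[OF X])
  have fp: "f p \<in> points Y" by (rule smooth_map_points[OF f p])
  have D: "?D v \<in> ?TY" if "v \<in> ?TX" for v by (rule differential_in_tangent_space[OF X Y f p that])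
  have Dvs: "map ?D vs \<in> vector_tuples k ?TY" if "vs \<in> vector_tuples k ?TX" for vs
    using that D by (auto simp: vector_tuples_def)
  show "alternating_form k ?TX (pullback k X Y f \<omega> p)"
    unfolding alternating_form_def
  proof (intro conjI ballI allI impI)
    fix vs assume vs: "vs \<in> vector_tuples k ?TX"
    fix i assume i: "i < k"
    have "linear_map_on ?TY (\<lambda>w. \<omega> (f p) ((map ?D vs)[i := w]))"
      using alt[OF fp] Dvs[OF vs] i by (simp add: alternating_form_def)
    then have lin: "linear_map_on ?TX (\<lambda>v. \<omega> (f p) ((map ?D vs)[i := ?D v]))"
      by (rule linear_map_on_compose[OF differential_linear[OF X Y f p], rotated]) (use D in auto)
    have "vs[i := v] \<in> vector_tuples k ?TX" if "v \<in> ?TX" for v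
      using vs that set_update_subset_insert[of vs i v] by (auto simp: vector_tuples_def)
    then have "pullback k X Y f \<omega> p (vs[i := v]) = \<omega> (f p) ((map ?D vs)[i := ?D v])" if "v \<in> ?TX" for v
      using that p by (simp add: pullback_def map_update)
    then show "linear_map_on ?TX (\<lambda>v. pullback k X Y f \<omega> p (vs[i := v]))"
      using lin subspace_add[OF TX] subspace_mul[OF TX] by (simp add: linear_map_on_def)
  next
    fix vs i j assume vs: "vs \<in> vector_tuples k ?TX" and ij: "i < k" "j < k" "i \<noteq> j" "vs ! i = vs ! j"
    have "map ?D vs ! i = map ?D vs ! j" using vs ij by (simp add: vector_tuples_def)
    then have "\<omega> (f p) (map ?D vs) = 0"
      using alt[OF fp] Dvs[OF vs] ij unfolding alternating_form_def by blast
    then show "pullback k X Y f \<omega> p vs = 0" by (simp add: pullback_def)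
  qed (simp add: pullback_def)
next
  show "pullback k X Y f \<omega> p = 0" if "p \<notin> points X" for p
    using that by (simp add: pullback_def fun_eq_iff)
next
  have alt: "alternating_form k (tangent_space Y q) (\<omega> q)" if "q \<in> points Y" for q
    using \<omega> that by (simp add: forms_def)
  fix c es assume c: "c \<in> atlas X" and es: "es \<in> vector_tuples k (cmodel c)"
  have c': "is_chart (mtop X) c" by (rule smooth_structure_chart[OF X c])
  let ?P = "\<lambda>x. pullback k X Y f \<omega> (cinv c x) (map (coord_tangent X c (cinv c x)) es)"
  show "smooth_on (cmodel c) (cmap c ` cdom c) ?P"
  proof (rule smooth_on_local[OF is_chart_cdom_image_open[OF c']])
    fix x assume "x \<in> cmap c ` cdom c"
    then obtain p where p: "p \<in> cdom c" "x = cmap c p" by auto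
    have cp: "c \<in> charts_at X p" using c p by (simp add: charts_at_def)
    obtain d where d: "d \<in> charts_at Y (f p)"
      using charts_at_nonempty[OF Y smooth_map_points[OF f charts_at_points[OF X cp]]] by blast
    have d': "is_chart (mtop Y) d" and dY: "d \<in> atlas Y" and fpd: "f p \<in> cdom d"
      using charts_at_is_chart[OF Y d] charts_atD[OF d] by auto
    have ct: "continuous_map (mtop X) (mtop Y) f" by (rule smooth_map_continuous[OF f])
    have sm: "smooth_in_charts c d f" by (rule smooth_map_chartsD(1)[OF f cp d])
    let ?U = "cmap c ` (cdom c \<inter> f -` cdom d)" and ?T = "cmap d ` cdom d"
    let ?F = "cmap d \<circ> f \<circ> cinv c"
    have U: "open_in_subspace (cmodel c) ?U" by (rule smooth_in_charts_domain_open[OF c' d' ct])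
    have T: "open_in_subspace (cmodel d) ?T" by (rule is_chart_cdom_image_open[OF d'])
    \<comment> \<open>The coefficients of \<open>\<omega>\<close> in the chart \<open>d\<close>, and the image of the constant vector \<open>e\<close>.\<close>
    define \<beta> where "\<beta> y ws = \<omega> (cinv d y) (map (coord_tangent Y d (cinv d y)) ws)" for y ws
    define h where "h e x = coord_derivative c d f (cinv c x) e" for e x
    have smF: "smooth_on (cmodel c) ?U ?F" using sm by (simp add: smooth_in_charts_def)
    have h_smooth: "smooth_on (cmodel c) ?U (h e)" if e: "e \<in> cmodel c" for e
    proof -
      have "smooth_on (cmodel c) ?U (\<lambda>x. frechet_derivative ?F (at x within cmodel c) e)"
        using smF e Ck_on_SucD' unfolding smooth_on_def by blast
      then show ?thesis
        by (rule smooth_on_cong[OF U]) (auto simp: h_def coord_derivative_def cinv_cmap[OF c'])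
    qed
    have h_model: "h e x \<in> cmodel d" if "e \<in> cmodel c" "x \<in> ?U" for e x
      using that coord_derivative_in_model[OF c' d' ct sm] by (auto simp: h_def cinv_cmap[OF c'])
    have "smooth_on (cmodel c) ?U (\<lambda>x. \<beta> (?F x) (map (\<lambda>h. h x) (map h es) @ []))"
    proof (rule smooth_on_multilinear[OF U T smF])
      show "?F ` ?U \<subseteq> ?T" by (auto simp: cinv_cmap[OF c'])
      show "smooth_on (cmodel d) ?T (\<lambda>y. \<beta> y ws)" if "ws \<in> vector_tuples k (cmodel d)" for ws
        using \<omega> dY that by (simp add: forms_def \<beta>_def)
      show "\<And>g. g \<in> set (map h es) \<Longrightarrow> smooth_on (cmodel c) ?U g \<and> g ` ?U \<subseteq> cmodel d"
        using es h_smooth h_model by (auto simp: vector_tuples_def subset_iff)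
      show "length (map h es) + length [] = k" using es by (simp add: vector_tuples_def)
      fix y us ws assume y: "y \<in> ?T" and us: "set us \<subseteq> cmodel d" "set ws \<subseteq> cmodel d"
        "length us + length ws + 1 = k"
      obtain q where q: "q \<in> cdom d" "y = cmap d q" using y by auto
      have dq: "d \<in> charts_at Y q" using dY q by (simp add: charts_at_def)
      let ?C = "coord_tangent Y d q"
      have C: "?C ` cmodel d \<subseteq> tangent_space Y q" using coord_tangent_in_tangent_space[OF Y dq] by auto
      have "linear_map_on (tangent_space Y q) (\<lambda>w. \<omega> q (map ?C us @ w # map ?C ws))"
        by (rule alternating_form_linear_slot[OF subspace_tangent_space[OF Y] alt[OF charts_at_points[OF Y dq]]])
          (use us C in auto)
      from linear_map_on_compose[OF linear_map_on_coord_tangent[OF Y dq] C this]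
      show "linear_map_on (cmodel d) (\<lambda>w. \<beta> y (us @ w # ws))"
        by (simp add: \<beta>_def q(2) cinv_cmap[OF d' q(1)])
    qed simp
    then have "smooth_on (cmodel c) ?U ?P"
    proof (rule smooth_on_cong[OF U])
      fix x assume "x \<in> ?U"
      then obtain q where q: "q \<in> cdom c" "f q \<in> cdom d" "x = cmap c q" by auto
      have cq: "c \<in> charts_at X q" and dq: "d \<in> charts_at Y (f q)"
        using c dY q by (auto simp: charts_at_def)
      have es': "\<And>e. e \<in> set es \<Longrightarrow> e \<in> cmodel c" using es by (auto simp: vector_tuples_def)
      have "map (coord_tangent X c q) es \<in> vector_tuples k (tangent_space X q)"
        using es coord_tangent_in_tangent_space[OF X cq] by (auto simp: vector_tuples_def)
      then have "?P x = \<omega> (f q) (map (differential X Y f q) (map (coord_tangent X c q) es))"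
        using charts_at_points[OF X cq] by (simp add: pullback_def q(3) cinv_cmap[OF c' q(1)])
      also have "map (differential X Y f q) (map (coord_tangent X c q) es)
          = map (coord_tangent Y d (f q)) (map (\<lambda>e. h e x) es)"
        using differential_coord_tangent[OF X Y f cq dq es']
        by (simp add: h_def q(3) cinv_cmap[OF c' q(1)])
      finally show "\<beta> (?F x) (map (\<lambda>h. h x) (map h es) @ []) = ?P x"
        by (simp add: \<beta>_def q(3) cinv_cmap[OF c' q(1)] cinv_cmap[OF d' q(2)] o_def)
    qed
    then show "\<exists>U. open_in_subspace (cmodel c) U \<and> x \<in> U \<and> U \<subseteq> cmap c ` cdom c \<and> smooth_on (cmodel c) U ?P"
      using U p fpd by (intro exI[of _ ?U]) auto
  qed
qed

lemma subspace_forms: "smooth_structure X \<Longrightarrow> subspace (forms k X)"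
proof (rule subspaceI)
  assume X: "smooth_structure X"
  have open_c: "open_in_subspace (cmodel c) (cmap c ` cdom c)" if "c \<in> atlas X" for c
    by (rule is_chart_cdom_image_open[OF smooth_structure_chart[OF X that]])
  have "smooth_on (cmodel c) (cmap c ` cdom c) (\<lambda>x. 0 :: real)" if "c \<in> atlas X" for c
    unfolding smooth_on_def by (intro allI Ck_on_const[OF open_c[OF that]])
  then show "0 \<in> forms k X"
    by (auto simp: forms_def alternating_form_def linear_map_on_def)
  show "\<omega> + \<eta> \<in> forms k X" if "\<omega> \<in> forms k X" "\<eta> \<in> forms k X" for \<omega> \<eta>
    using that
    by (auto simp: forms_def alternating_form_def linear_map_on_def algebra_simps
        intro!: smooth_on_add[OF open_c])
  show "r *\<^sub>R \<omega> \<in> forms k X" if "\<omega> \<in> forms k X" for r \<omega>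
    using that
    by (auto simp: forms_def alternating_form_def linear_map_on_def scaleR_fun_def algebra_simps
        intro!: smooth_on_bounded_linear[OF open_c bounded_linear_mult_right])
qed

lemma pullback_add: "pullback k X Y f (\<omega> + \<eta>) = pullback k X Y f \<omega> + pullback k X Y f \<eta>"
  and pullback_diff: "pullback k X Y f (\<omega> - \<eta>) = pullback k X Y f \<omega> - pullback k X Y f \<eta>"
  and pullback_scaleR: "pullback k X Y f (r *\<^sub>R \<omega>) = r *\<^sub>R pullback k X Y f \<omega>"
  and pullback_zero: "pullback k X Y f 0 = 0"
  by (simp_all add: pullback_def fun_eq_iff scaleR_fun_def)

lemma smooth_map_compose:
  fixes Y :: "('b, 'f::euclidean_space) manifold"
  assumes X: "smooth_structure X" and Y: "smooth_structure Y" and Z: "smooth_structure Z"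
    and f: "smooth_map X Y f" and g: "smooth_map Y Z g"
  shows "smooth_map X Z (g \<circ> f)"
  unfolding smooth_map_iff
proof (intro conjI ballI)
  note ct = smooth_map_continuous[OF f] smooth_map_continuous[OF g]
  show "continuous_map (mtop X) (mtop Z) (g \<circ> f)" by (rule continuous_map_compose[OF ct])
  fix c e assume c: "c \<in> atlas X" and e: "e \<in> atlas Z"
  note ch = smooth_structure_chart[OF X c] smooth_structure_chart[OF Z e]
  show "smooth_in_charts c e (g \<circ> f)"
  proof (rule smooth_in_charts_compose[OF ch ct])
    fix p assume p: "p \<in> cdom c"
    then have "f p \<in> points Y" using is_chart_cdom_subset[OF ch(1)] smooth_map_points[OF f] by blast
    then obtain d where d: "d \<in> atlas Y" "f p \<in> cdom d" using smooth_structure_cover[OF Y] by blast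
    then show "\<exists>d :: ('b, 'f) chart. is_chart (mtop Y) d \<and> f p \<in> cdom d \<and> smooth_in_charts c d f \<and> smooth_in_charts d e g"
      using f g c e smooth_structure_chart[OF Y d(1)] by (auto simp: smooth_map_iff intro!: exI[of _ d])
  qed
qed

lemma pullback_compose:
  assumes X: "smooth_structure X" and Y: "smooth_structure Y" and Z: "smooth_structure Z"
    and f: "smooth_map X Y f" and g: "smooth_map Y Z g" and h: "smooth_map X Z h"
    and gf: "\<And>q. q \<in> points X \<Longrightarrow> g (f q) = h q"
  shows "pullback k X Y f (pullback k Y Z g \<omega>) = pullback k X Z h \<omega>"
proof (intro ext)
  fix p vs
  show "pullback k X Y f (pullback k Y Z g \<omega>) p vs = pullback k X Z h \<omega> p vs"
  proof (cases "p \<in> points X \<and> vs \<in> vector_tuples k (tangent_space X p)")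
    case True
    then have p: "p \<in> points X" and vs: "\<And>v. v \<in> set vs \<Longrightarrow> v \<in> tangent_space X p" and len: "length vs = k"
      by (auto simp: vector_tuples_def)
    have "map (differential X Y f p) vs \<in> vector_tuples k (tangent_space Y (f p))"
      using differential_in_tangent_space[OF X Y f p vs] len by (auto simp: vector_tuples_def)
    then have "pullback k X Y f (pullback k Y Z g \<omega>) p vs
        = \<omega> (h p) (map (differential Y Z g (f p)) (map (differential X Y f p) vs))"
      using True smooth_map_points[OF f p] gf[OF p] by (simp add: pullback_def del: map_map)
    also have "map (differential Y Z g (f p)) (map (differential X Y f p) vs) = map (differential X Z h p) vs"
      using differential_compose[OF X Y Z f g h gf p vs] by simp
    finally show ?thesis using True by (simp add: pullback_def)
  qed (auto simp: pullback_def)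
qed

lemma pullback_compose_eq:
  assumes X: "smooth_structure X" and Y: "smooth_structure Y" and Y': "smooth_structure Y'"
    and Z: "smooth_structure Z"
    and f: "smooth_map X Y f" and g: "smooth_map Y Z g" and f': "smooth_map X Y' f'" and g': "smooth_map Y' Z g'"
    and eq: "\<And>q. q \<in> points X \<Longrightarrow> g (f q) = g' (f' q)"
  shows "pullback k X Y f (pullback k Y Z g \<omega>) = pullback k X Y' f' (pullback k Y' Z g' \<omega>)"
proof -
  have h: "smooth_map X Z (g \<circ> f)" by (rule smooth_map_compose[OF X Y Z f g])
  show ?thesis
    using pullback_compose[OF X Y Z f g h, of k \<omega>] pullback_compose[OF X Y' Z f' g' h, of k \<omega>] eq by simp
qed

lemma pullback_section:
  assumes X: "smooth_structure X" and Y: "smooth_structure Y"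
    and f: "smooth_map X Y f" and g: "smooth_map Y X g"
    and gf: "\<And>q. q \<in> points X \<Longrightarrow> g (f q) = q" and \<omega>: "\<omega> \<in> forms k X"
  shows "pullback k X Y f (pullback k Y X g \<omega>) = \<omega>"
proof (intro ext)
  fix p vs
  show "pullback k X Y f (pullback k Y X g \<omega>) p vs = \<omega> p vs"
  proof (cases "p \<in> points X \<and> vs \<in> vector_tuples k (tangent_space X p)")
    case True
    then have p: "p \<in> points X" and vs: "\<And>v. v \<in> set vs \<Longrightarrow> v \<in> tangent_space X p" and len: "length vs = k"
      by (auto simp: vector_tuples_def)
    have "map (differential X Y f p) vs \<in> vector_tuples k (tangent_space Y (f p))"
      using differential_in_tangent_space[OF X Y f p vs] len by (auto simp: vector_tuples_def)
    moreover have "map (differential Y X g (f p)) (map (differential X Y f p) vs) = vs"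
      using differential_identity[OF X Y f g gf p vs] by (simp add: map_idI)
    ultimately show ?thesis
      using True smooth_map_points[OF f p] gf[OF p] unfolding pullback_def by simp
  next
    case False
    then have "\<omega> p vs = 0" using \<omega> by (cases "p \<in> points X") (auto simp: forms_def alternating_form_def)
    then show ?thesis using False by (auto simp: pullback_def)
  qed
qed

section \<open>Categories internal to vector spaces are groupoids\<close>

text \<open>
  Linearity of the composition forces inverses: with \<open>g\<^sup>-\<^sup>1 = 1\<^bsub>s g\<^esub> + 1\<^bsub>t g\<^esub> - g\<close>, the pair
  \<open>(g, g\<^sup>-\<^sup>1)\<close> is the sum \<open>(g, 1\<^bsub>s g\<^esub>) + (1\<^bsub>t g\<^esub>, 1\<^bsub>t g\<^esub>) - (1\<^bsub>t g\<^esub>, g)\<close> of pairs whose composites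
  are given by the unit laws.
\<close>

lemma two_vector_space_groupoid:
  assumes "two_vector_space V0 V1 s t one cmp"
  shows "groupoid V0 V1 s t one cmp (\<lambda>g. one (s g) + one (t g) - g)"
proof -
  interpret two_vector_space V0 V1 s t one cmp by (rule assms)
  have diff: "L (x - y) = L x - L y" if "subspace V" "linear_map_on V L" "x \<in> V" "y \<in> V"
    for V :: "'x::real_vector set" and L :: "'x \<Rightarrow> 'y::real_vector" and x y
    using linear_map_onD(1)[OF that(2), of "x - y" y] subspace_diff[OF that(1,3,4)] that(4) by simp
  have sub: "subspace (composable V1 s t)"
  proof (rule subspaceI)
    have "s 0 = 0" "t 0 = 0"
      using linear_map_onD(2)[OF source_linear subspace_0[OF arrows_subspace], of 0]
        linear_map_onD(2)[OF target_linear subspace_0[OF arrows_subspace], of 0] by simp_all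
    then show "0 \<in> composable V1 s t"
      using subspace_0[OF arrows_subspace] by (simp add: composable_def zero_prod_def)
    show "x + y \<in> composable V1 s t" if "x \<in> composable V1 s t" "y \<in> composable V1 s t" for x y
      using that linear_map_onD(1)[OF source_linear] linear_map_onD(1)[OF target_linear]
        subspace_add[OF arrows_subspace] by (auto simp: composable_def)
    show "r *\<^sub>R x \<in> composable V1 s t" if "x \<in> composable V1 s t" for r x
      using that linear_map_onD(2)[OF source_linear] linear_map_onD(2)[OF target_linear]
        subspace_mul[OF arrows_subspace] by (auto simp: composable_def)
  qed
  note s_add = linear_map_onD(1)[OF source_linear] and t_add = linear_map_onD(1)[OF target_linear]
  note s_diff = diff[OF arrows_subspace source_linear] and t_diff = diff[OF arrows_subspace target_linear]
  let ?inv = "\<lambda>g. one (s g) + one (t g) - g"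
  have comb: "cmp (a + a' - a'') (b + b' - b'') = cmp a b + cmp a' b' - cmp a'' b''"
    if "(a, b) \<in> composable V1 s t" "(a', b') \<in> composable V1 s t" "(a'', b'') \<in> composable V1 s t"
    for a a' a'' b b' b''
    using diff[OF sub comp_linear subspace_add[OF sub that(1,2)] that(3)]
      linear_map_onD(1)[OF comp_linear that(1,2)] by simp
  show ?thesis
  proof (intro groupoid.intro groupoid_axioms.intro small_category_axioms)
    fix g assume g: "g \<in> V1"
    let ?a = "one (s g)" and ?b = "one (t g)"
    have a: "?a \<in> V1" "s ?a = s g" "t ?a = s g"
      using one_closed source_one target_one source_closed[OF g] by auto
    have b: "?b \<in> V1" "s ?b = t g" "t ?b = t g"
      using one_closed source_one target_one target_closed[OF g] by auto
    have ab: "?a + ?b \<in> V1" using subspace_add[OF arrows_subspace a(1) b(1)] .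
    show "?inv g \<in> V1" by (rule subspace_diff[OF arrows_subspace ab g])
    show "s (?inv g) = t g" by (simp add: s_diff[OF ab g] s_add[OF a(1) b(1)] a b)
    show "t (?inv g) = s g" by (simp add: t_diff[OF ab g] t_add[OF a(1) b(1)] a b)
    have pairs: "(g, ?a) \<in> composable V1 s t" "(?b, ?b) \<in> composable V1 s t" "(?b, g) \<in> composable V1 s t"
      "(?a, ?a) \<in> composable V1 s t"
      using a b g by (auto simp: composable_def)
    have units: "cmp ?a ?a = ?a" "cmp ?b ?b = ?b" "cmp g ?a = g" "cmp ?b g = g"
      using comp_one[OF a(1)] comp_one[OF b(1)] comp_one[OF g] one_comp[OF g] a(2) b(2) by simp_all
    show "cmp g (?inv g) = ?b"
      using comb[OF pairs(1,2,3)] units by simp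
    show "cmp (?inv g) g = ?a"
      using comb[OF pairs(4,3,1)] units by (simp add: algebra_simps)
  qed
qed

section \<open>Multiplicative and affine forms\<close>

context lie_groupoid
begin

abbreviation composables where "composables \<equiv> composable_manifold G s t"

lemma smooth_structure_arrows: "smooth_structure G"
  using arrows_manifold smooth_manifold_imp_smooth_structure by blast

lemma smooth_structure_objects: "smooth_structure M"
  using objects_manifold smooth_manifold_imp_smooth_structure by blast

lemma source_smooth: "smooth_map G M s" and target_smooth: "smooth_map G M t"
  using source_submersion target_submersion by (simp_all add: surjective_submersion_def)

lemma smooth_structure_composables: "smooth_structure composables"
  by (rule smooth_structure_composable[OF smooth_structure_arrows smooth_structure_objects
        source_submersion target_smooth])

lemma composablesD:
  "q \<in> points composables \<Longrightarrow> fst q \<in> points G \<and> snd q \<in> points G \<and> s (fst q) = t (snd q)"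
  by (auto simp: composable_def)

lemma fst_smooth: "smooth_map composables G fst" and snd_smooth: "smooth_map composables G snd"
  by (rule smooth_map_from_submanifold[OF smooth_structure_prod]
      smooth_map_fst smooth_map_snd smooth_structure_arrows)+

text \<open>
  The map \<open>x \<mapsto> (1\<^sub>x, 1\<^sub>x)\<close>, along which identities on composable pairs are restricted to units.
\<close>

lemma unit_pair_smooth: "smooth_map M composables (\<lambda>x. (u x, u x))"
proof (rule smooth_map_into_submanifold[OF smooth_structure_objects
      smooth_structure_prod[OF smooth_structure_arrows smooth_structure_arrows]])
  show "smooth_map M (prod_manifold G G) (\<lambda>x. (u x, u x))"
    by (rule smooth_map_Pair[OF smooth_structure_objects smooth_structure_arrows
          smooth_structure_arrows unit_smooth unit_smooth])
  show "(\<lambda>x. (u x, u x)) ` points M \<subseteq> composable (points G) s t"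
    using one_closed source_one target_one by (auto simp: composable_def)
qed

lemma pullback_unit_source:
  assumes "\<theta> \<in> forms k M"
  shows "pullback k M G u (pullback k G M s \<theta>) = \<theta>"
  by (rule pullback_section[OF smooth_structure_objects smooth_structure_arrows unit_smooth
        source_smooth source_one assms])

lemma pullback_unit_target:
  assumes "\<theta> \<in> forms k M"
  shows "pullback k M G u (pullback k G M t \<theta>) = \<theta>"
  by (rule pullback_section[OF smooth_structure_objects smooth_structure_arrows unit_smooth
        target_smooth target_one assms])

text \<open>
  The next three lemmas are the laws \<open>s \<circ> m = s \<circ> pr\<^sub>2\<close>, \<open>t \<circ> m = t \<circ> pr\<^sub>1\<close> and \<open>s \<circ> pr\<^sub>1 = t \<circ> pr\<^sub>2\<close> on composable
  pairs, read on pullbacks of forms from the base.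
\<close>

lemma pullback_mult_source:
  "pullback k composables G (\<lambda>(g, h). m g h) (pullback k G M s \<theta>)
    = pullback k composables G snd (pullback k G M s \<theta>)"
  by (rule pullback_compose_eq[OF smooth_structure_composables smooth_structure_arrows
        smooth_structure_arrows smooth_structure_objects mult_smooth source_smooth snd_smooth source_smooth])
    (simp add: case_prod_beta composablesD source_comp target_comp)

lemma pullback_mult_target:
  "pullback k composables G (\<lambda>(g, h). m g h) (pullback k G M t \<theta>)
    = pullback k composables G fst (pullback k G M t \<theta>)"
  by (rule pullback_compose_eq[OF smooth_structure_composables smooth_structure_arrows
        smooth_structure_arrows smooth_structure_objects mult_smooth target_smooth fst_smooth target_smooth])
    (simp add: case_prod_beta composablesD source_comp target_comp)

lemma pullback_fst_source:
  "pullback k composables G fst (pullback k G M s \<theta>) = pullback k composables G snd (pullback k G M t \<theta>)"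
  by (rule pullback_compose_eq[OF smooth_structure_composables smooth_structure_arrows
        smooth_structure_arrows smooth_structure_objects fst_smooth source_smooth snd_smooth target_smooth])
    (simp add: case_prod_beta composablesD source_comp target_comp)

text \<open>Pulling the defining identity back to the pairs of units gives \<open>\<iota>\<^sup>*\<Theta> = 2 \<iota>\<^sup>*\<Theta>\<close>.\<close>

lemma multiplicative_unit:
  assumes "\<Theta> \<in> multiplicative_forms k G s t m"
  shows "pullback k M G u \<Theta> = 0"
proof -
  have eq: "pullback k composables G (\<lambda>(g, h). m g h) \<Theta>
      = pullback k composables G fst \<Theta> + pullback k composables G snd \<Theta>"
    using assms by (simp add: multiplicative_forms_def Let_def)
  have "m (u x) (u x) = u x" if "x \<in> points M" for x
    using comp_one[OF one_closed[OF that]] source_one[OF that] by simp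
  then have mu: "pullback k M composables (\<lambda>x. (u x, u x)) (pullback k composables G (\<lambda>(g, h). m g h) \<Theta>)
      = pullback k M G u \<Theta>"
    by (intro pullback_compose[OF smooth_structure_objects smooth_structure_composables
          smooth_structure_arrows unit_pair_smooth mult_smooth unit_smooth]) simp
  have pr: "pullback k M composables (\<lambda>x. (u x, u x)) (pullback k composables G pr \<Theta>) = pullback k M G u \<Theta>"
    if "smooth_map composables G pr" "\<And>g. pr (g, g) = g" for pr
    by (rule pullback_compose[OF smooth_structure_objects smooth_structure_composables
          smooth_structure_arrows unit_pair_smooth that(1) unit_smooth]) (rule that(2))
  show ?thesis
    using mu unfolding eq pullback_add pr[OF fst_smooth fst_conv] pr[OF snd_smooth snd_conv] by simp
qed

text \<open>
  Write \<open>S\<close>, \<open>T\<close>, \<open>U\<close> for pullback along \<open>s\<close>, \<open>t\<close>, \<open>u\<close>, and \<open>mu\<close>, \<open>p1\<close>, \<open>p2\<close> for pullback along \<open>m\<close>, \<open>pr\<^sub>1\<close>,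
  \<open>pr\<^sub>2\<close>.  Everything is linear algebra with the relations \<open>U S = U T = 1\<close>, \<open>mu S = p2 S\<close>, \<open>mu T = p1 T\<close>,
  \<open>p1 S = p2 T\<close>, and \<open>U = 0\<close> on multiplicative forms.  For instance, for \<open>\<Theta>\<close> affine with \<open>\<theta> = U \<Theta>\<close>,
  \<open>mu (\<Theta> - T \<theta>) = p1 \<Theta> + p2 \<Theta> - p1 S \<theta> - p1 T \<theta> = p1 (\<Theta> - T \<theta>) + p2 (\<Theta> - T \<theta>)\<close>.
  For composable \<open>\<Theta>\<close>, \<open>\<Theta>'\<close> the relation \<open>U S = 1\<close> gives \<open>U (\<Theta> * \<Theta>') = \<theta> + \<theta>'\<close>, from which the source,
  the target and the associativity of the product are read off.
\<close>

lemma two_vector_space_affine_forms: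
  "two_vector_space (multiplicative_forms k G s t m) (affine_forms k G M s t u m)
     (\<lambda>\<Theta>. \<Theta> - pullback k G M t (pullback k M G u \<Theta>)) (\<lambda>\<Theta>. \<Theta> - pullback k G M s (pullback k M G u \<Theta>))
     (\<lambda>\<Theta>. \<Theta>) (\<lambda>\<Theta> \<Theta>'. \<Theta> + pullback k G M s (pullback k M G u \<Theta>'))"
proof -
  let ?aff = "affine_forms k G M s t u m" and ?mult = "multiplicative_forms k G s t m"
  define S where "S = pullback k G M s"
  define T where "T = pullback k G M t"
  define U where "U = pullback k M G u"
  define mu where "mu = pullback k composables G (\<lambda>(g, h). m g h)"
  define p1 where "p1 = pullback k composables G fst"
  define p2 where "p2 = pullback k composables G snd"
  note defs = S_def T_def U_def mu_def p1_def p2_def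
  have aff: "\<Theta> \<in> ?aff \<longleftrightarrow> \<Theta> \<in> forms k G \<and> mu \<Theta> = p1 \<Theta> + p2 \<Theta> - p1 (S (U \<Theta>))" for \<Theta>
    by (simp add: affine_forms_def Let_def defs)
  have mult: "\<Theta> \<in> ?mult \<longleftrightarrow> \<Theta> \<in> forms k G \<and> mu \<Theta> = p1 \<Theta> + p2 \<Theta>" for \<Theta>
    by (simp add: multiplicative_forms_def Let_def defs)
  have mult_U: "U \<Theta> = 0" if "\<Theta> \<in> ?mult" for \<Theta>
    using multiplicative_unit[OF that] by (simp add: defs)
  have add: "S (a + b) = S a + S b" "T (a + b) = T a + T b" "U (\<Theta> + \<Theta>') = U \<Theta> + U \<Theta>'"
    "mu (\<Theta> + \<Theta>') = mu \<Theta> + mu \<Theta>'" "p1 (\<Theta> + \<Theta>') = p1 \<Theta> + p1 \<Theta>'" "p2 (\<Theta> + \<Theta>') = p2 \<Theta> + p2 \<Theta>'" for a b \<Theta> \<Theta>'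
    by (simp_all add: defs pullback_add)
  have diff: "S (a - b) = S a - S b" "T (a - b) = T a - T b" "U (\<Theta> - \<Theta>') = U \<Theta> - U \<Theta>'"
    "mu (\<Theta> - \<Theta>') = mu \<Theta> - mu \<Theta>'" "p1 (\<Theta> - \<Theta>') = p1 \<Theta> - p1 \<Theta>'" "p2 (\<Theta> - \<Theta>') = p2 \<Theta> - p2 \<Theta>'" for a b \<Theta> \<Theta>'
    by (simp_all add: defs pullback_diff)
  have scale: "S (r *\<^sub>R a) = r *\<^sub>R S a" "T (r *\<^sub>R a) = r *\<^sub>R T a" "U (r *\<^sub>R \<Theta>) = r *\<^sub>R U \<Theta>"
    "mu (r *\<^sub>R \<Theta>) = r *\<^sub>R mu \<Theta>" "p1 (r *\<^sub>R \<Theta>) = r *\<^sub>R p1 \<Theta>" "p2 (r *\<^sub>R \<Theta>) = r *\<^sub>R p2 \<Theta>" for r a \<Theta>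
    by (simp_all add: defs pullback_scaleR)
  have zero: "S 0 = 0" "T 0 = 0" "U 0 = 0" "mu 0 = 0" "p1 0 = 0" "p2 0 = 0"
    by (simp_all add: defs pullback_zero)
  have simplicial: "mu (S a) = p2 (S a)" "mu (T a) = p1 (T a)" "p2 (T a) = p1 (S a)" for a
    using pullback_mult_source pullback_mult_target pullback_fst_source by (simp_all add: defs)
  have forms: "S a \<in> forms k G" "T a \<in> forms k G" if "a \<in> forms k M" for a
    using pullback_in_forms[OF smooth_structure_arrows smooth_structure_objects _ that]
      source_smooth target_smooth by (simp_all add: defs)
  have U_forms: "U \<Theta> \<in> forms k M" if "\<Theta> \<in> forms k G" for \<Theta>
    using pullback_in_forms[OF smooth_structure_objects smooth_structure_arrows unit_smooth that]
    by (simp add: defs)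
  have US: "U (S (U \<Theta>)) = U \<Theta>" and UT: "U (T (U \<Theta>)) = U \<Theta>" if "\<Theta> \<in> forms k G" for \<Theta>
    using pullback_unit_source[OF U_forms[OF that]] pullback_unit_target[OF U_forms[OF that]]
    by (simp_all add: defs)
  note sub = subspace_forms[OF smooth_structure_arrows, of k]
  note closed = subspace_add[OF sub] subspace_diff[OF sub] subspace_mul[OF sub] subspace_0[OF sub]
  have aff_forms: "\<Theta> \<in> forms k G" if "\<Theta> \<in> ?aff" for \<Theta> using that aff by blast
  have "two_vector_space ?mult ?aff (\<lambda>\<Theta>. \<Theta> - T (U \<Theta>)) (\<lambda>\<Theta>. \<Theta> - S (U \<Theta>)) (\<lambda>\<Theta>. \<Theta>) (\<lambda>\<Theta> \<Theta>'. \<Theta> + S (U \<Theta>'))"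
  proof (intro two_vector_space.intro small_category.intro two_vector_space_axioms.intro)
    show "\<Theta> - T (U \<Theta>) \<in> ?mult" if "\<Theta> \<in> ?aff" for \<Theta>
      using that unfolding mult aff
      by (simp add: closed forms U_forms diff simplicial algebra_simps)
    show "\<Theta> - S (U \<Theta>) \<in> ?mult" if "\<Theta> \<in> ?aff" for \<Theta>
      using that unfolding mult aff
      by (simp add: closed forms U_forms diff simplicial algebra_simps)
    show "\<Theta> \<in> ?aff" if "\<Theta> \<in> ?mult" for \<Theta>
      using that mult_U[OF that] unfolding mult aff by (simp add: zero)
    show "\<Theta> - T (U \<Theta>) = \<Theta>" "\<Theta> - S (U \<Theta>) = \<Theta>" if "\<Theta> \<in> ?mult" for \<Theta>
      using mult_U[OF that] by (simp_all add: zero)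
    show "\<Theta> + S (U (\<Theta> - T (U \<Theta>))) = \<Theta>" if "\<Theta> \<in> ?aff" for \<Theta>
      using UT[OF aff_forms[OF that]] by (simp add: diff zero)
    show "\<Theta> - S (U \<Theta>) + S (U \<Theta>) = \<Theta>" if "\<Theta> \<in> ?aff" for \<Theta>
      by simp
    show "linear_map_on ?aff (\<lambda>\<Theta>. \<Theta> - T (U \<Theta>))" "linear_map_on ?aff (\<lambda>\<Theta>. \<Theta> - S (U \<Theta>))"
      "linear_map_on ?mult (\<lambda>\<Theta>. \<Theta>)"
      by (simp_all add: linear_map_on_def add scale scaleR_diff_right)
    show "linear_map_on (composable ?aff (\<lambda>\<Theta>. \<Theta> - T (U \<Theta>)) (\<lambda>\<Theta>. \<Theta> - S (U \<Theta>))) (\<lambda>(g, h). g + S (U h))"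
      by (auto simp: linear_map_on_def add scale scaleR_add_right)
    show "subspace ?mult"
      by (rule subspaceI) (auto simp: mult closed add scale zero scaleR_add_right)
    show "subspace ?aff"
      by (rule subspaceI) (auto simp: aff closed add scale zero scaleR_add_right scaleR_diff_right)
  next
    fix \<Theta> \<Theta>' assume \<Theta>: "\<Theta> \<in> ?aff" and \<Theta>': "\<Theta>' \<in> ?aff" and match: "\<Theta> - T (U \<Theta>) = \<Theta>' - S (U \<Theta>')"
    note f = aff_forms[OF \<Theta>] aff_forms[OF \<Theta>']
    have UU: "U (\<Theta> + S (U \<Theta>')) = U \<Theta> + U \<Theta>'" using US[OF f(2)] by (simp add: add)
    show "\<Theta> + S (U \<Theta>') \<in> ?aff"
      using \<Theta> unfolding aff UU
      by (simp add: closed forms U_forms f add diff simplicial algebra_simps)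
    show "\<Theta> + S (U \<Theta>') - S (U (\<Theta> + S (U \<Theta>'))) = \<Theta> - S (U \<Theta>)"
      unfolding UU by (simp add: add)
    have "\<Theta> + S (U \<Theta>') - T (U \<Theta> + U \<Theta>') = (\<Theta> - T (U \<Theta>)) + S (U \<Theta>') - T (U \<Theta>')"
      by (simp add: add)
    then show "\<Theta> + S (U \<Theta>') - T (U (\<Theta> + S (U \<Theta>'))) = \<Theta>' - T (U \<Theta>')"
      unfolding UU match by simp
  next
    fix \<Theta> \<Theta>' \<Theta>'' assume "\<Theta>' \<in> ?aff" "\<Theta>'' \<in> ?aff"
    then show "\<Theta> + S (U \<Theta>') + S (U \<Theta>'') = \<Theta> + S (U (\<Theta>' + S (U \<Theta>'')))"
      using US[OF aff_forms] by (simp add: add)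
  qed
  then show ?thesis by (simp add: S_def T_def U_def)
qed

end

theorem theorem4p4:
  fixes G :: "('g, 'e::euclidean_space) manifold" and M :: "('m, 'b::euclidean_space) manifold"
    and s t :: "'g \<Rightarrow> 'm" and u :: "'m \<Rightarrow> 'g" and m :: "'g \<Rightarrow> 'g \<Rightarrow> 'g" and i :: "'g \<Rightarrow> 'g"
    and k :: nat
  assumes "lie_groupoid G M s t u m i"
  defines "\<Omega>aff \<equiv> affine_forms k G M s t u m"
    and "\<Omega>mult \<equiv> multiplicative_forms k G s t m"
    and "right \<equiv> (\<lambda>\<Theta>. \<Theta> - pullback k G M t (pullback k M G u \<Theta>))"
    and "left \<equiv> (\<lambda>\<Theta>. \<Theta> - pullback k G M s (pullback k M G u \<Theta>))"
    and "star \<equiv> (\<lambda>\<Theta> \<Theta>'. \<Theta> + pullback k G M s (pullback k M G u \<Theta>'))"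
  shows "two_vector_space \<Omega>mult \<Omega>aff right left (\<lambda>\<Theta>. \<Theta>) star \<and>
         (\<exists>inv. groupoid \<Omega>mult \<Omega>aff right left (\<lambda>\<Theta>. \<Theta>) star inv)"
proof -
  have "two_vector_space \<Omega>mult \<Omega>aff right left (\<lambda>\<Theta>. \<Theta>) star"
    unfolding \<Omega>aff_def \<Omega>mult_def right_def left_def star_def
    by (rule lie_groupoid.two_vector_space_affine_forms[OF assms(1)])
  with two_vector_space_groupoid[OF this] show ?thesis by blast
qed

end
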